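(* The lax 2-adjunction $\mathrm Q\dashv_l\mathrm U_q$ between $\mathbf{QRD}_l$ and $\mathbf{RD}_l$ restricts to a (pseudo) 2-adjunction between $\mathbf{QRD}$ and $\mathbf{RD}$. That is, for every relational doctrine $R$ and every relational doctrine with quotients $S$, the functor $$\mathrm U_q(-)\circ E^R:\ \mathbf{QRD}(R^q,S)\longrightarrow\mathbf{RD}(R,\mathrm U_q(S))$$ is an equivalence of categories.
   Context: $\mathbf{Pos}$ is the category of posets and monotone maps. A relational doctrine consists of a category $\mathcal C$ (its base); a functor $R:(\mathcal C\times\mathcal C)^{op}\to\mathbf{Pos}$ (for $f:X\to A$, $g:Y\to B$ write $R_{f,g}:R(A,B)\to R(X,Y)$); elements $d_X\in R(X,X)$ with $d_X\le R_{f,f}(d_Y)$ for all $f:X\to Y$; monotone maps $;:R(X,Y)\times R(Y,Z)\to R(X,Z)$ with $R_{f,g}(\alpha);R_{g,h}(\beta)\le R_{f,h}(\alpha;\beta)$; monotone maps $(-)^\bot:R(X,Y)\to R(Y,X)$ with $(R_{f,g}(\alpha))^\bot\le R_{g,f}(\alpha^\bot)$; such that $;$ is associative with units $d$, $(\alpha;\beta)^\bot=\beta^\bot;\alpha^\bot$, $d_X^\bot=d_X$, $\alpha^{\bot\bot}=\alpha$. The graph of $f:X\to Y$ is $\Gamma_f=R_{f,\mathrm{id}_Y}(d_Y)\in R(X,Y)$. An $R$-equivalence relation on $X$ is $\rho\in R(X,X)$ with $d_X\le\rho$, $\rho^\bot\le\rho$, $\rho;\rho\le\rho$. A quotient arrow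 of $\rho$ is $q:X\to W$ with $\rho\le\Gamma_q;\Gamma_q^\bot$ such that for every $f:X\to Z$ with $\rho\le\Gamma_f;\Gamma_f^\bot$ there is a unique $h:W\to Z$ with $f=h\circ q$. It is effective if $\rho=\Gamma_q;\Gamma_q^\bot$, and descent if $d_W\le\Gamma_q^\bot;\Gamma_q$. $R$ has quotients if every $R$-equivalence relation admits an effective descent quotient arrow. The 2-category $\mathbf{RD}_l$: objects are relational doctrines; a 1-arrow $F:R\to S$ (bases $\mathcal C,\mathcal D$) is a pair of a functor $\widehat F:\mathcal C\to\mathcal D$ and a natural transformation with components $\overline F_{X,Y}:R(X,Y)\to S(\widehat FX,\widehat FY)$ such that $d_{\widehat FX}\le\overline F_{X,X}(d_X)$, $\overline F_{X,Y}(\alpha);\overline F_{Y,Z}(\beta)\le\overline F_{X,Z}(\alpha;\beta)$, $(\overline F_{X,Y}(\alpha))^\bot\le\overline F_{Y,X}(\alpha^\bot)$; a 2-arrow $\theta:F\Rightarrow G$ is a natural transformation $\theta:\widehat F\to\widehat G$ with $\overline F_{X,Y}(\alpha)\le S_{\theta_X,\theta_Y}(\overline G_{X,Y}(\alpha))$. A 1-arrow is strict if it preserves relational identities $d$ and composition $;$ strictly (equality). $\mathbf{RD}$ is the sub-2-category of $\mathbf{RD}_l$ with the same objects, the strict 1-arrows, and all 2-arrows between them. $\mathbf{QRD}_l$ (resp. $\mathbf{QRD}$) is the sub-2-category (full on 2-arrows) of $\mathbf{RD}_l$ (resp. $\mathbf{RD}$) of relational doctrines with quotients and 1-arrows $F$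 preserving quotient arrows: if $q$ is a quotient arrow of an $R$-equivalence relation $\rho$ on $X$ then $\widehat Fq$ is a quotient arrow of $\overline F_{X,X}(\rho)$. $\mathrm U_q$ denotes the inclusion 2-functor. Intensional quotient completion $R^q$ of $R$ (base $\mathcal C$): the base has objects the pairs $(X,\rho)$ with $\rho$ an $R$-equivalence relation on $X$; arrows $(X,\rho)\to(Y,\sigma)$ are the arrows $f:X\to Y$ of $\mathcal C$ with $\rho\le R_{f,f}(\sigma)$; composition and identities as in $\mathcal C$. The fibres are $R^q((X,\rho),(Y,\sigma))=\{\alpha\in R(X,Y)\mid\rho^\bot;\alpha;\sigma\le\alpha\}$, reindexing, composition and converse are those of $R$, and $d_{(X,\rho)}=\rho$. The 2-functor $\mathrm Q$ sends $R$ to $R^q$, a 1-arrow $F$ to $F^q$ with $\widehat{F^q}(X,\rho)=(\widehat FX,\overline F_{X,X}(\rho))$, $\widehat{F^q}f=\widehat Ff$, $\overline{F^q}(\alpha)=\overline F_{X,Y}(\alpha)$, and a 2-arrow $\theta$ to $\theta^q_{(X,\rho)}=\theta_X$. The 1-arrow $E^R:R\to R^q$ has $\widehat{E^R}X=(X,d_X)$, $\widehat{E^R}f=f$, and $\overline{E^R}$ the identity; it is strict. The lax 2-adjunction $\mathrm Q\dashv_l\mathrm U_q$ means that the functors $\mathrm U_q(-)\circ E^R:\mathbf{QRD}_l(R^q,S)\to\mathbf{RD}_l(R,S)$ have reflection left adjoints. *)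

theory Defs
  imports Main "HOL-Library.FuncSet"
begin

section \<open>Categories\<close>

text \<open>
  Hom-sets are indexed by a pair of objects and need not be disjoint, so identities, composition
  and all further operations take the objects involved as arguments: for
  \<open>f \<in> hom C X Y\<close> and \<open>g \<in> hom C Y Z\<close>, the composite of \<open>f\<close> followed by \<open>g\<close> is \<open>cmp C X Y Z g f\<close>.
  Non-disjointness is used in the quotient completion, whose arrows
  \<open>(X,\<rho>) \<rightarrow> (Y,\<sigma>)\<close> literally are arrows \<open>X \<rightarrow> Y\<close>.
\<close>

record ('o, 'a) cat =
  ob :: "'o set"
  hom :: "'o \<Rightarrow> 'o \<Rightarrow> 'a set"
  ide :: "'o \<Rightarrow> 'a"
  cmp :: "'o \<Rightarrow> 'o \<Rightarrow> 'o \<Rightarrow> 'a \<Rightarrow> 'a \<Rightarrow> 'a"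

locale category =
  fixes C :: "('o, 'a) cat"
  assumes ide_hom: "X \<in> ob C \<Longrightarrow> ide C X \<in> hom C X X"
    and cmp_hom: "\<lbrakk>X \<in> ob C; Y \<in> ob C; Z \<in> ob C; f \<in> hom C X Y; g \<in> hom C Y Z\<rbrakk>
      \<Longrightarrow> cmp C X Y Z g f \<in> hom C X Z"
    and cmp_ide_right: "\<lbrakk>X \<in> ob C; Y \<in> ob C; f \<in> hom C X Y\<rbrakk> \<Longrightarrow> cmp C X X Y f (ide C X) = f"
    and cmp_ide_left: "\<lbrakk>X \<in> ob C; Y \<in> ob C; f \<in> hom C X Y\<rbrakk> \<Longrightarrow> cmp C X Y Y (ide C Y) f = f"
    and cmp_assoc: "\<lbrakk>X \<in> ob C; Y \<in> ob C; Z \<in> ob C; W \<in> ob C;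
        f \<in> hom C X Y; g \<in> hom C Y Z; h \<in> hom C Z W\<rbrakk>
      \<Longrightarrow> cmp C X Z W h (cmp C X Y Z g f) = cmp C X Y W (cmp C Y Z W h g) f"

definition is_iso :: "('o, 'a) cat \<Rightarrow> 'o \<Rightarrow> 'o \<Rightarrow> 'a \<Rightarrow> bool" where
  "is_iso C X Y f \<longleftrightarrow> f \<in> hom C X Y \<and>
    (\<exists>g \<in> hom C Y X. cmp C X Y X g f = ide C X \<and> cmp C Y X Y f g = ide C Y)"

definition full_sub :: "('o, 'a) cat \<Rightarrow> ('o \<Rightarrow> bool) \<Rightarrow> ('o, 'a) cat" where
  "full_sub C P = C\<lparr>ob := {X \<in> ob C. P X}\<rparr>"

text \<open>
  Functors and natural transformations are required to be \<open>undefined\<close> outside their domains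
  (extensional function spaces), so that equality of HOL values is equality of
  functors and of natural transformations.
\<close>

record ('o, 'a, 'p, 'b) ftor =
  fob :: "'o \<Rightarrow> 'p"
  far :: "'o \<Rightarrow> 'o \<Rightarrow> 'a \<Rightarrow> 'b"

definition is_functor ::
  "('o, 'a) cat \<Rightarrow> ('p, 'b) cat \<Rightarrow> ('o, 'a, 'p, 'b, 'z) ftor_scheme \<Rightarrow> bool" where
  "is_functor C D F \<longleftrightarrow>
    fob F \<in> ob C \<rightarrow>\<^sub>E ob D \<and>
    far F \<in> (\<Pi>\<^sub>E X \<in> ob C. \<Pi>\<^sub>E Y \<in> ob C. hom C X Y \<rightarrow>\<^sub>E hom D (fob F X) (fob F Y)) \<and>
    (\<forall>X \<in> ob C. far F X X (ide C X) = ide D (fob F X)) \<and>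
    (\<forall>X \<in> ob C. \<forall>Y \<in> ob C. \<forall>Z \<in> ob C. \<forall>f \<in> hom C X Y. \<forall>g \<in> hom C Y Z.
      far F X Z (cmp C X Y Z g f) =
        cmp D (fob F X) (fob F Y) (fob F Z) (far F Y Z g) (far F X Y f))"

definition id_functor :: "('o, 'a) cat \<Rightarrow> ('o, 'a, 'o, 'a) ftor" where
  "id_functor C = \<lparr>fob = (\<lambda>X\<in>ob C. X), far = (\<lambda>X\<in>ob C. \<lambda>Y\<in>ob C. \<lambda>f\<in>hom C X Y. f)\<rparr>"

definition comp_functor :: "('o, 'a) cat \<Rightarrow> ('p, 'b, 'q, 'c, 'y) ftor_scheme \<Rightarrow>
    ('o, 'a, 'p, 'b, 'z) ftor_scheme \<Rightarrow> ('o, 'a, 'q, 'c) ftor" where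
  "comp_functor C G F =
    \<lparr>fob = (\<lambda>X\<in>ob C. fob G (fob F X)),
     far = (\<lambda>X\<in>ob C. \<lambda>Y\<in>ob C. \<lambda>f\<in>hom C X Y. far G (fob F X) (fob F Y) (far F X Y f))\<rparr>"

definition natural_trans :: "('o, 'a) cat \<Rightarrow> ('p, 'b) cat \<Rightarrow> ('o, 'a, 'p, 'b, 'y) ftor_scheme \<Rightarrow>
    ('o, 'a, 'p, 'b, 'z) ftor_scheme \<Rightarrow> ('o \<Rightarrow> 'b) \<Rightarrow> bool" where
  "natural_trans C D F G \<theta> \<longleftrightarrow>
    \<theta> \<in> (\<Pi>\<^sub>E X \<in> ob C. hom D (fob F X) (fob G X)) \<and>
    (\<forall>X \<in> ob C. \<forall>Y \<in> ob C. \<forall>f \<in> hom C X Y.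
      cmp D (fob F X) (fob F Y) (fob G Y) (\<theta> Y) (far F X Y f) =
      cmp D (fob F X) (fob G X) (fob G Y) (far G X Y f) (\<theta> X))"

definition natural_iso :: "('o, 'a) cat \<Rightarrow> ('p, 'b) cat \<Rightarrow> ('o, 'a, 'p, 'b, 'y) ftor_scheme \<Rightarrow>
    ('o, 'a, 'p, 'b, 'z) ftor_scheme \<Rightarrow> ('o \<Rightarrow> 'b) \<Rightarrow> bool" where
  "natural_iso C D F G \<theta> \<longleftrightarrow>
    natural_trans C D F G \<theta> \<and> (\<forall>X \<in> ob C. is_iso D (fob F X) (fob G X) (\<theta> X))"

definition is_equivalence ::
  "('o, 'a) cat \<Rightarrow> ('p, 'b) cat \<Rightarrow> ('o, 'a, 'p, 'b) ftor \<Rightarrow> bool" where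
  "is_equivalence C D F \<longleftrightarrow> category C \<and> category D \<and> is_functor C D F \<and>
    (\<exists>(G :: ('p, 'b, 'o, 'a) ftor) \<eta> \<epsilon>. is_functor D C G \<and>
      natural_iso C C (id_functor C) (comp_functor C G F) \<eta> \<and>
      natural_iso D D (comp_functor D F G) (id_functor D) \<epsilon>)"


section \<open>Relational doctrines\<close>

text \<open>
  \<open>fibre R X Y\<close> is the carrier of the poset \<open>R(X,Y)\<close> and \<open>le R X Y\<close> its order.
  \<open>reix R X Y A B f g\<close> is the reindexing \<open>R(A,B) \<rightarrow> R(X,Y)\<close> along \<open>f : X \<rightarrow> A\<close> and
  \<open>g : Y \<rightarrow> B\<close>; \<open>rid R X\<close> is the relational identity \<open>d\<^sub>X\<close>; \<open>rcmp R X Y Z \<alpha> \<beta>\<close> is \<open>\<alpha> ; \<beta>\<close>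
  (diagrammatic order); \<open>conv R X Y \<alpha>\<close> is the converse of \<open>\<alpha> \<in> R(X,Y)\<close>.
\<close>

record ('o, 'a, 'r) rdoc =
  base :: "('o, 'a) cat"
  fibre :: "'o \<Rightarrow> 'o \<Rightarrow> 'r set"
  le :: "'o \<Rightarrow> 'o \<Rightarrow> 'r \<Rightarrow> 'r \<Rightarrow> bool"
  reix :: "'o \<Rightarrow> 'o \<Rightarrow> 'o \<Rightarrow> 'o \<Rightarrow> 'a \<Rightarrow> 'a \<Rightarrow> 'r \<Rightarrow> 'r"
  rid :: "'o \<Rightarrow> 'r"
  rcmp :: "'o \<Rightarrow> 'o \<Rightarrow> 'o \<Rightarrow> 'r \<Rightarrow> 'r \<Rightarrow> 'r"
  conv :: "'o \<Rightarrow> 'o \<Rightarrow> 'r \<Rightarrow> 'r"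

locale rel_doctrine = base_cat: category "base R"
  for R :: "('o, 'a, 'r) rdoc" +
  assumes le_refl: "\<lbrakk>X \<in> ob (base R); Y \<in> ob (base R)\<rbrakk> \<Longrightarrow> reflp_on (fibre R X Y) (le R X Y)"
    and le_trans: "\<lbrakk>X \<in> ob (base R); Y \<in> ob (base R)\<rbrakk> \<Longrightarrow> transp_on (fibre R X Y) (le R X Y)"
    and le_antisym: "\<lbrakk>X \<in> ob (base R); Y \<in> ob (base R)\<rbrakk> \<Longrightarrow> antisymp_on (fibre R X Y) (le R X Y)"
    and reix_fibre: "\<lbrakk>X \<in> ob (base R); Y \<in> ob (base R); A \<in> ob (base R); B \<in> ob (base R);
        f \<in> hom (base R) X A; g \<in> hom (base R) Y B; \<alpha> \<in> fibre R A B\<rbrakk>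
      \<Longrightarrow> reix R X Y A B f g \<alpha> \<in> fibre R X Y"
    and reix_mono: "\<lbrakk>X \<in> ob (base R); Y \<in> ob (base R); A \<in> ob (base R); B \<in> ob (base R);
        f \<in> hom (base R) X A; g \<in> hom (base R) Y B\<rbrakk>
      \<Longrightarrow> monotone_on (fibre R A B) (le R A B) (le R X Y) (reix R X Y A B f g)"
    and reix_ide: "\<lbrakk>X \<in> ob (base R); Y \<in> ob (base R); \<alpha> \<in> fibre R X Y\<rbrakk>
      \<Longrightarrow> reix R X Y X Y (ide (base R) X) (ide (base R) Y) \<alpha> = \<alpha>"
    and reix_cmp: "\<lbrakk>X \<in> ob (base R); Y \<in> ob (base R); A \<in> ob (base R); B \<in> ob (base R);
        A' \<in> ob (base R); B' \<in> ob (base R);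
        f \<in> hom (base R) X A; g \<in> hom (base R) Y B;
        f' \<in> hom (base R) A A'; g' \<in> hom (base R) B B'; \<alpha> \<in> fibre R A' B'\<rbrakk>
      \<Longrightarrow> reix R X Y A' B' (cmp (base R) X A A' f' f) (cmp (base R) Y B B' g' g) \<alpha> =
          reix R X Y A B f g (reix R A B A' B' f' g' \<alpha>)"
    and rid_fibre: "X \<in> ob (base R) \<Longrightarrow> rid R X \<in> fibre R X X"
    and rid_reix: "\<lbrakk>X \<in> ob (base R); Y \<in> ob (base R); f \<in> hom (base R) X Y\<rbrakk>
      \<Longrightarrow> le R X X (rid R X) (reix R X X Y Y f f (rid R Y))"
    and rcmp_fibre: "\<lbrakk>X \<in> ob (base R); Y \<in> ob (base R); Z \<in> ob (base R);
        \<alpha> \<in> fibre R X Y; \<beta> \<in> fibre R Y Z\<rbrakk> \<Longrightarrow> rcmp R X Y Z \<alpha> \<beta> \<in> fibre R X Z"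
    and rcmp_mono: "\<lbrakk>X \<in> ob (base R); Y \<in> ob (base R); Z \<in> ob (base R);
        \<alpha> \<in> fibre R X Y; \<alpha>' \<in> fibre R X Y; \<beta> \<in> fibre R Y Z; \<beta>' \<in> fibre R Y Z;
        le R X Y \<alpha> \<alpha>'; le R Y Z \<beta> \<beta>'\<rbrakk>
      \<Longrightarrow> le R X Z (rcmp R X Y Z \<alpha> \<beta>) (rcmp R X Y Z \<alpha>' \<beta>')"
    and rcmp_reix: "\<lbrakk>X \<in> ob (base R); Y \<in> ob (base R); Z \<in> ob (base R);
        A \<in> ob (base R); B \<in> ob (base R); D \<in> ob (base R);
        f \<in> hom (base R) X A; g \<in> hom (base R) Y B; h \<in> hom (base R) Z D;
        \<alpha> \<in> fibre R A B; \<beta> \<in> fibre R B D\<rbrakk>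
      \<Longrightarrow> le R X Z (rcmp R X Y Z (reix R X Y A B f g \<alpha>) (reix R Y Z B D g h \<beta>))
                   (reix R X Z A D f h (rcmp R A B D \<alpha> \<beta>))"
    and conv_fibre: "\<lbrakk>X \<in> ob (base R); Y \<in> ob (base R); \<alpha> \<in> fibre R X Y\<rbrakk>
      \<Longrightarrow> conv R X Y \<alpha> \<in> fibre R Y X"
    and conv_mono: "\<lbrakk>X \<in> ob (base R); Y \<in> ob (base R)\<rbrakk>
      \<Longrightarrow> monotone_on (fibre R X Y) (le R X Y) (le R Y X) (conv R X Y)"
    and conv_reix: "\<lbrakk>X \<in> ob (base R); Y \<in> ob (base R); A \<in> ob (base R); B \<in> ob (base R);
        f \<in> hom (base R) X A; g \<in> hom (base R) Y B; \<alpha> \<in> fibre R A B\<rbrakk>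
      \<Longrightarrow> le R Y X (conv R X Y (reix R X Y A B f g \<alpha>)) (reix R Y X B A g f (conv R A B \<alpha>))"
    and rcmp_assoc: "\<lbrakk>X \<in> ob (base R); Y \<in> ob (base R); Z \<in> ob (base R); W \<in> ob (base R);
        \<alpha> \<in> fibre R X Y; \<beta> \<in> fibre R Y Z; \<gamma> \<in> fibre R Z W\<rbrakk>
      \<Longrightarrow> rcmp R X Y W \<alpha> (rcmp R Y Z W \<beta> \<gamma>) = rcmp R X Z W (rcmp R X Y Z \<alpha> \<beta>) \<gamma>"
    and rcmp_rid_left: "\<lbrakk>X \<in> ob (base R); Y \<in> ob (base R); \<alpha> \<in> fibre R X Y\<rbrakk>
      \<Longrightarrow> rcmp R X X Y (rid R X) \<alpha> = \<alpha>"
    and rcmp_rid_right: "\<lbrakk>X \<in> ob (base R); Y \<in> ob (base R); \<alpha> \<in> fibre R X Y\<rbrakk>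
      \<Longrightarrow> rcmp R X Y Y \<alpha> (rid R Y) = \<alpha>"
    and conv_rcmp: "\<lbrakk>X \<in> ob (base R); Y \<in> ob (base R); Z \<in> ob (base R);
        \<alpha> \<in> fibre R X Y; \<beta> \<in> fibre R Y Z\<rbrakk>
      \<Longrightarrow> conv R X Z (rcmp R X Y Z \<alpha> \<beta>) = rcmp R Z Y X (conv R Y Z \<beta>) (conv R X Y \<alpha>)"
    and conv_rid: "X \<in> ob (base R) \<Longrightarrow> conv R X X (rid R X) = rid R X"
    and conv_conv: "\<lbrakk>X \<in> ob (base R); Y \<in> ob (base R); \<alpha> \<in> fibre R X Y\<rbrakk>
      \<Longrightarrow> conv R Y X (conv R X Y \<alpha>) = \<alpha>"

definition graph :: "('o, 'a, 'r) rdoc \<Rightarrow> 'o \<Rightarrow> 'o \<Rightarrow> 'a \<Rightarrow> 'r" where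
  "graph R X Y f = reix R X Y Y Y f (ide (base R) Y) (rid R Y)"

definition kernel :: "('o, 'a, 'r) rdoc \<Rightarrow> 'o \<Rightarrow> 'o \<Rightarrow> 'a \<Rightarrow> 'r" where
  "kernel R X Y f = rcmp R X Y X (graph R X Y f) (conv R X Y (graph R X Y f))"

definition equiv_rel :: "('o, 'a, 'r) rdoc \<Rightarrow> 'o \<Rightarrow> 'r \<Rightarrow> bool" where
  "equiv_rel R X \<rho> \<longleftrightarrow> \<rho> \<in> fibre R X X \<and> le R X X (rid R X) \<rho> \<and>
    le R X X (conv R X X \<rho>) \<rho> \<and> le R X X (rcmp R X X X \<rho> \<rho>) \<rho>"

definition quotient_arrow :: "('o, 'a, 'r) rdoc \<Rightarrow> 'o \<Rightarrow> 'r \<Rightarrow> 'o \<Rightarrow> 'a \<Rightarrow> bool" where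
  "quotient_arrow R X \<rho> W q \<longleftrightarrow>
    W \<in> ob (base R) \<and> q \<in> hom (base R) X W \<and> le R X X \<rho> (kernel R X W q) \<and>
    (\<forall>Z \<in> ob (base R). \<forall>f \<in> hom (base R) X Z. le R X X \<rho> (kernel R X Z f) \<longrightarrow>
      (\<exists>!h. h \<in> hom (base R) W Z \<and> f = cmp (base R) X W Z h q))"

definition effective :: "('o, 'a, 'r) rdoc \<Rightarrow> 'o \<Rightarrow> 'r \<Rightarrow> 'o \<Rightarrow> 'a \<Rightarrow> bool" where
  "effective R X \<rho> W q \<longleftrightarrow> \<rho> = kernel R X W q"

definition descent :: "('o, 'a, 'r) rdoc \<Rightarrow> 'o \<Rightarrow> 'o \<Rightarrow> 'a \<Rightarrow> bool" where
  "descent R X W q \<longleftrightarrow>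
    le R W W (rid R W) (rcmp R W X W (conv R X W (graph R X W q)) (graph R X W q))"

definition has_quotients :: "('o, 'a, 'r) rdoc \<Rightarrow> bool" where
  "has_quotients R \<longleftrightarrow> (\<forall>X \<in> ob (base R). \<forall>\<rho>. equiv_rel R X \<rho> \<longrightarrow>
    (\<exists>W q. quotient_arrow R X \<rho> W q \<and> effective R X \<rho> W q \<and> descent R X W q))"


section \<open>1-arrows and 2-arrows\<close>

record ('o, 'a, 'p, 'b, 'r, 's) onearr = "('o, 'a, 'p, 'b) ftor" +
  frel :: "'o \<Rightarrow> 'o \<Rightarrow> 'r \<Rightarrow> 's"

definition lax_arrow :: "('o, 'a, 'r) rdoc \<Rightarrow> ('p, 'b, 's) rdoc \<Rightarrow>
    ('o, 'a, 'p, 'b, 'r, 's) onearr \<Rightarrow> bool" where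
  "lax_arrow R S F \<longleftrightarrow>
    is_functor (base R) (base S) F \<and>
    frel F \<in> (\<Pi>\<^sub>E X \<in> ob (base R). \<Pi>\<^sub>E Y \<in> ob (base R).
      fibre R X Y \<rightarrow>\<^sub>E fibre S (fob F X) (fob F Y)) \<and>
    (\<forall>X \<in> ob (base R). \<forall>Y \<in> ob (base R).
      monotone_on (fibre R X Y) (le R X Y) (le S (fob F X) (fob F Y)) (frel F X Y)) \<and>
    (\<forall>X \<in> ob (base R). \<forall>Y \<in> ob (base R). \<forall>A \<in> ob (base R). \<forall>B \<in> ob (base R).
      \<forall>f \<in> hom (base R) X A. \<forall>g \<in> hom (base R) Y B. \<forall>\<alpha> \<in> fibre R A B.
      frel F X Y (reix R X Y A B f g \<alpha>) =
        reix S (fob F X) (fob F Y) (fob F A) (fob F B) (far F X A f) (far F Y B g)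
          (frel F A B \<alpha>)) \<and>
    (\<forall>X \<in> ob (base R). le S (fob F X) (fob F X) (rid S (fob F X)) (frel F X X (rid R X))) \<and>
    (\<forall>X \<in> ob (base R). \<forall>Y \<in> ob (base R). \<forall>Z \<in> ob (base R).
      \<forall>\<alpha> \<in> fibre R X Y. \<forall>\<beta> \<in> fibre R Y Z.
      le S (fob F X) (fob F Z)
        (rcmp S (fob F X) (fob F Y) (fob F Z) (frel F X Y \<alpha>) (frel F Y Z \<beta>))
        (frel F X Z (rcmp R X Y Z \<alpha> \<beta>))) \<and>
    (\<forall>X \<in> ob (base R). \<forall>Y \<in> ob (base R). \<forall>\<alpha> \<in> fibre R X Y.
      le S (fob F Y) (fob F X)
        (conv S (fob F X) (fob F Y) (frel F X Y \<alpha>)) (frel F Y X (conv R X Y \<alpha>)))"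

definition strict_arrow :: "('o, 'a, 'r) rdoc \<Rightarrow> ('p, 'b, 's) rdoc \<Rightarrow>
    ('o, 'a, 'p, 'b, 'r, 's) onearr \<Rightarrow> bool" where
  "strict_arrow R S F \<longleftrightarrow>
    (\<forall>X \<in> ob (base R). rid S (fob F X) = frel F X X (rid R X)) \<and>
    (\<forall>X \<in> ob (base R). \<forall>Y \<in> ob (base R). \<forall>Z \<in> ob (base R).
      \<forall>\<alpha> \<in> fibre R X Y. \<forall>\<beta> \<in> fibre R Y Z.
      rcmp S (fob F X) (fob F Y) (fob F Z) (frel F X Y \<alpha>) (frel F Y Z \<beta>) =
        frel F X Z (rcmp R X Y Z \<alpha> \<beta>))"

definition preserves_quotients :: "('o, 'a, 'r) rdoc \<Rightarrow> ('p, 'b, 's) rdoc \<Rightarrow>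
    ('o, 'a, 'p, 'b, 'r, 's) onearr \<Rightarrow> bool" where
  "preserves_quotients R S F \<longleftrightarrow> (\<forall>X \<in> ob (base R). \<forall>\<rho> W q.
    equiv_rel R X \<rho> \<longrightarrow> quotient_arrow R X \<rho> W q \<longrightarrow>
    quotient_arrow S (fob F X) (frel F X X \<rho>) (fob F W) (far F X W q))"

definition two_arrow :: "('o, 'a, 'r) rdoc \<Rightarrow> ('p, 'b, 's) rdoc \<Rightarrow>
    ('o, 'a, 'p, 'b, 'r, 's) onearr \<Rightarrow> ('o, 'a, 'p, 'b, 'r, 's) onearr \<Rightarrow> ('o \<Rightarrow> 'b) \<Rightarrow> bool" where
  "two_arrow R S F G \<theta> \<longleftrightarrow>
    natural_trans (base R) (base S) F G \<theta> \<and>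
    (\<forall>X \<in> ob (base R). \<forall>Y \<in> ob (base R). \<forall>\<alpha> \<in> fibre R X Y.
      le S (fob F X) (fob F Y) (frel F X Y \<alpha>)
        (reix S (fob F X) (fob F Y) (fob G X) (fob G Y) (\<theta> X) (\<theta> Y) (frel G X Y \<alpha>)))"

definition id_two :: "('o, 'a, 'r) rdoc \<Rightarrow> ('p, 'b, 's) rdoc \<Rightarrow>
    ('o, 'a, 'p, 'b, 'r, 's) onearr \<Rightarrow> 'o \<Rightarrow> 'b" where
  "id_two R S F = (\<lambda>X\<in>ob (base R). ide (base S) (fob F X))"

definition vcomp :: "('o, 'a, 'r) rdoc \<Rightarrow> ('p, 'b, 's) rdoc \<Rightarrow>
    ('o, 'a, 'p, 'b, 'r, 's) onearr \<Rightarrow> ('o, 'a, 'p, 'b, 'r, 's) onearr \<Rightarrow>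
    ('o, 'a, 'p, 'b, 'r, 's) onearr \<Rightarrow> ('o \<Rightarrow> 'b) \<Rightarrow> ('o \<Rightarrow> 'b) \<Rightarrow> 'o \<Rightarrow> 'b" where
  "vcomp R S F G H \<phi> \<theta> =
    (\<lambda>X\<in>ob (base R). cmp (base S) (fob F X) (fob G X) (fob H X) (\<phi> X) (\<theta> X))"

text \<open>The hom-categories of \<open>RD\<^sub>l\<close> and of its sub-2-categories \<open>RD\<close> and \<open>QRD\<close>, which are full on 2-arrows.\<close>

definition RDl_hom :: "('o, 'a, 'r) rdoc \<Rightarrow> ('p, 'b, 's) rdoc \<Rightarrow>
    (('o, 'a, 'p, 'b, 'r, 's) onearr, 'o \<Rightarrow> 'b) cat" where
  "RDl_hom R S =
    \<lparr>ob = {F. lax_arrow R S F},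
     hom = (\<lambda>F G. {\<theta>. two_arrow R S F G \<theta>}),
     ide = id_two R S,
     cmp = vcomp R S\<rparr>"

definition RD_hom :: "('o, 'a, 'r) rdoc \<Rightarrow> ('p, 'b, 's) rdoc \<Rightarrow>
    (('o, 'a, 'p, 'b, 'r, 's) onearr, 'o \<Rightarrow> 'b) cat" where
  "RD_hom R S = full_sub (RDl_hom R S) (strict_arrow R S)"

definition QRD_hom :: "('o, 'a, 'r) rdoc \<Rightarrow> ('p, 'b, 's) rdoc \<Rightarrow>
    (('o, 'a, 'p, 'b, 'r, 's) onearr, 'o \<Rightarrow> 'b) cat" where
  "QRD_hom R S = full_sub (RD_hom R S) (preserves_quotients R S)"

definition id_one :: "('o, 'a, 'r) rdoc \<Rightarrow> ('o, 'a, 'o, 'a, 'r, 'r) onearr" where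
  "id_one R =
    \<lparr>fob = fob (id_functor (base R)), far = far (id_functor (base R)),
     frel = (\<lambda>X\<in>ob (base R). \<lambda>Y\<in>ob (base R). \<lambda>\<alpha>\<in>fibre R X Y. \<alpha>)\<rparr>"

definition comp_one :: "('o, 'a, 'r) rdoc \<Rightarrow> ('p, 'b, 'q, 'c, 's, 't) onearr \<Rightarrow>
    ('o, 'a, 'p, 'b, 'r, 's) onearr \<Rightarrow> ('o, 'a, 'q, 'c, 'r, 't) onearr" where
  "comp_one R G F =
    \<lparr>fob = fob (comp_functor (base R) G F), far = far (comp_functor (base R) G F),
     frel = (\<lambda>X\<in>ob (base R). \<lambda>Y\<in>ob (base R). \<lambda>\<alpha>\<in>fibre R X Y.
       frel G (fob F X) (fob F Y) (frel F X Y \<alpha>))\<rparr>"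

text \<open>
  Horizontal composite \<open>\<phi> * \<theta> : H \<circ> F \<Rightarrow> K \<circ> G\<close> of \<open>\<theta> : F \<Rightarrow> G\<close>, between 1-arrows out of \<open>R\<close>, and
  \<open>\<phi> : H \<Rightarrow> K\<close>, between 1-arrows into \<open>T\<close>.
\<close>

definition hcomp :: "('o, 'a, 'r) rdoc \<Rightarrow> ('q, 'c, 't) rdoc \<Rightarrow>
    ('p, 'b, 'q, 'c, 's, 't) onearr \<Rightarrow> ('p, 'b, 'q, 'c, 's, 't) onearr \<Rightarrow>
    ('o, 'a, 'p, 'b, 'r, 's) onearr \<Rightarrow> ('o, 'a, 'p, 'b, 'r, 's) onearr \<Rightarrow>
    ('p \<Rightarrow> 'c) \<Rightarrow> ('o \<Rightarrow> 'b) \<Rightarrow> 'o \<Rightarrow> 'c" where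
  "hcomp R T H K F G \<phi> \<theta> =
    (\<lambda>X\<in>ob (base R). cmp (base T) (fob H (fob F X)) (fob H (fob G X)) (fob K (fob G X))
      (\<phi> (fob G X)) (far H (fob F X) (fob G X) (\<theta> X)))"


section \<open>The intensional quotient completion\<close>

definition Qbase :: "('o, 'a, 'r) rdoc \<Rightarrow> ('o \<times> 'r, 'a) cat" where
  "Qbase R =
    \<lparr>ob = {(X, \<rho>). X \<in> ob (base R) \<and> equiv_rel R X \<rho>},
     hom = (\<lambda>(X, \<rho>) (Y, \<sigma>). {f \<in> hom (base R) X Y. le R X X \<rho> (reix R X X Y Y f f \<sigma>)}),
     ide = (\<lambda>(X, \<rho>). ide (base R) X),
     cmp = (\<lambda>(X, \<rho>) (Y, \<sigma>) (Z, \<tau>). cmp (base R) X Y Z)\<rparr>"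

definition Q :: "('o, 'a, 'r) rdoc \<Rightarrow> ('o \<times> 'r, 'a, 'r) rdoc" where
  "Q R =
    \<lparr>base = Qbase R,
     fibre = (\<lambda>(X, \<rho>) (Y, \<sigma>). {\<alpha> \<in> fibre R X Y.
       le R X Y (rcmp R X Y Y (rcmp R X X Y (conv R X X \<rho>) \<alpha>) \<sigma>) \<alpha>}),
     le = (\<lambda>(X, \<rho>) (Y, \<sigma>). le R X Y),
     reix = (\<lambda>(X, \<rho>) (Y, \<sigma>) (A, \<rho>') (B, \<sigma>'). reix R X Y A B),
     rid = (\<lambda>(X, \<rho>). \<rho>),
     rcmp = (\<lambda>(X, \<rho>) (Y, \<sigma>) (Z, \<tau>). rcmp R X Y Z),
     conv = (\<lambda>(X, \<rho>) (Y, \<sigma>). conv R X Y)\<rparr>"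

definition Q_one :: "('o, 'a, 'r) rdoc \<Rightarrow> ('o, 'a, 'p, 'b, 'r, 's) onearr \<Rightarrow>
    ('o \<times> 'r, 'a, 'p \<times> 's, 'b, 'r, 's) onearr" where
  "Q_one R F =
    \<lparr>fob = (\<lambda>(X, \<rho>)\<in>ob (Qbase R). (fob F X, frel F X X \<rho>)),
     far = (\<lambda>(X, \<rho>)\<in>ob (Qbase R). \<lambda>(Y, \<sigma>)\<in>ob (Qbase R).
       \<lambda>f\<in>hom (Qbase R) (X, \<rho>) (Y, \<sigma>). far F X Y f),
     frel = (\<lambda>(X, \<rho>)\<in>ob (Qbase R). \<lambda>(Y, \<sigma>)\<in>ob (Qbase R).
       \<lambda>\<alpha>\<in>fibre (Q R) (X, \<rho>) (Y, \<sigma>). frel F X Y \<alpha>)\<rparr>"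

definition Q_two :: "('o, 'a, 'r) rdoc \<Rightarrow> ('o \<Rightarrow> 'b) \<Rightarrow> 'o \<times> 'r \<Rightarrow> 'b" where
  "Q_two R \<theta> = (\<lambda>(X, \<rho>)\<in>ob (Qbase R). \<theta> X)"

text \<open>The action of \<open>Q\<close> on a hom-category \<open>K\<close> of 1-arrows out of \<open>R\<close>.\<close>

definition Q_hom :: "('o, 'a, 'r) rdoc \<Rightarrow> (('o, 'a, 'p, 'b, 'r, 's) onearr, 'o \<Rightarrow> 'b) cat \<Rightarrow>
    (('o, 'a, 'p, 'b, 'r, 's) onearr, 'o \<Rightarrow> 'b,
     ('o \<times> 'r, 'a, 'p \<times> 's, 'b, 'r, 's) onearr, 'o \<times> 'r \<Rightarrow> 'b) ftor" where
  "Q_hom R K =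
    \<lparr>fob = (\<lambda>F\<in>ob K. Q_one R F),
     far = (\<lambda>F\<in>ob K. \<lambda>G\<in>ob K. \<lambda>\<theta>\<in>hom K F G. Q_two R \<theta>)\<rparr>"

definition E :: "('o, 'a, 'r) rdoc \<Rightarrow> ('o, 'a, 'o \<times> 'r, 'a, 'r, 'r) onearr" where
  "E R =
    \<lparr>fob = (\<lambda>X\<in>ob (base R). (X, rid R X)),
     far = (\<lambda>X\<in>ob (base R). \<lambda>Y\<in>ob (base R). \<lambda>f\<in>hom (base R) X Y. f),
     frel = (\<lambda>X\<in>ob (base R). \<lambda>Y\<in>ob (base R). \<lambda>\<alpha>\<in>fibre R X Y. \<alpha>)\<rparr>"

text \<open>
  The functor \<open>(-) \<circ> E\<^sup>R\<close> on a hom-category \<open>K\<close> of 1-arrows \<open>Q R \<rightarrow> S\<close>; on 2-arrows it is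
  whiskering with \<open>E\<^sup>R\<close>. The formula is that of the lax adjunction; only \<open>K\<close> distinguishes the
  lax from the strict case. The inclusion 2-functor \<open>U\<^sub>q\<close> is left implicit.
\<close>

definition precomp_E :: "('o, 'a, 'r) rdoc \<Rightarrow> ('p, 'b, 's) rdoc \<Rightarrow>
    (('o \<times> 'r, 'a, 'p, 'b, 'r, 's) onearr, 'o \<times> 'r \<Rightarrow> 'b) cat \<Rightarrow>
    (('o \<times> 'r, 'a, 'p, 'b, 'r, 's) onearr, 'o \<times> 'r \<Rightarrow> 'b,
     ('o, 'a, 'p, 'b, 'r, 's) onearr, 'o \<Rightarrow> 'b) ftor" where
  "precomp_E R S K =
    \<lparr>fob = (\<lambda>F\<in>ob K. comp_one R F (E R)),
     far = (\<lambda>F\<in>ob K. \<lambda>G\<in>ob K. \<lambda>\<theta>\<in>hom K F G.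
       hcomp R S F G (E R) (E R) \<theta> (id_two R (Q R) (E R)))\<rparr>"

end

theory Submission
  imports Defs
begin

text \<open>
  The unit \<open>E R\<close> sends \<open>X\<close> to \<open>(X, d\<^sub>X)\<close>, and every object \<open>(X, \<rho>)\<close> of the completion is a
  quotient of such an object: the identity of \<open>X\<close>, seen as an arrow \<open>(X, d\<^sub>X) \<rightarrow> (X, \<rho>)\<close>, is an
  effective descent quotient arrow of \<open>\<rho>\<close> (\<open>quotient_arrow_Q\<close>). A 1-arrow out of \<open>Q R\<close> that
  preserves quotient arrows is therefore controlled by its restriction along \<open>E R\<close>, and
  restriction along \<open>E R\<close> is shown to be full, faithful and surjective on objects.

  The engine is a calculus of relations. Reindexing is composition with graphs,
  \<open>R\<^bsub>f,g\<^esub>(\<alpha>) = \<Gamma>\<^sub>f ; \<alpha> ; \<Gamma>\<^sub>g\<^sup>\<bottom>\<close> (\<open>reix_eq_rcmp\<close>), so along descent arrows, for which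
  \<open>\<Gamma>\<^sub>q\<^sup>\<bottom> ; \<Gamma>\<^sub>q = d\<close>, reindexing reflects the order, is injective and commutes with composition
  (\<open>reix_descent_le\<close>, \<open>reix_descent_inj\<close>, \<open>rcmp_reix_descent\<close>), and it hits every relation that
  composition with the kernels on both sides leaves unchanged (\<open>reix_dimg\<close>). A relation on a
  descent quotient may thus be replaced by its reindexing to the covering objects.

  Surjectivity on objects. Given a strict \<open>F : R \<rightarrow> S\<close>, choose an effective descent quotient arrow
  \<open>q : F X \<rightarrow> W\<close> of each equivalence relation \<open>F \<rho>\<close>. Arrows extend by the universal property of
  \<open>q\<close>. A relation \<open>\<alpha>\<close> from \<open>(X, \<rho>)\<close> to \<open>(Y, \<sigma>)\<close> satisfies \<open>\<rho> ; \<alpha> = \<alpha> = \<alpha> ; \<sigma>\<close>, so \<open>F \<alpha>\<close> is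
  unchanged by composition with \<open>F \<rho>\<close> and \<open>F \<sigma>\<close>, the kernels of the two projections, and hence
  is the reindexing of exactly one relation between the quotients (\<open>reix_push\<close>, \<open>push_eqI\<close>).
  Because \<open>F d\<^sub>X = d\<^bsub>F X\<^esub>\<close>, the identity may be chosen as \<open>q\<close> when \<open>\<rho> = d\<^sub>X\<close>, and then the
  extension restricts to \<open>F\<close> exactly, not merely up to isomorphism (\<open>extension_E\<close>).

  Full faithfulness. If \<open>F\<close> and \<open>G\<close> are strict and preserve quotient arrows, the images of
  \<open>(X, d\<^sub>X) \<rightarrow> (X, \<rho>)\<close> are quotient arrows; naturality at these arrows determines the component of
  a 2-arrow at \<open>(X, \<rho>)\<close> from its component at \<open>(X, d\<^sub>X)\<close> (\<open>two_arrow_eq_on_unit\<close>), and their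
  universal property provides it (\<open>two_arrow_extends_from_unit\<close>). Strictness makes the images
  descent arrows as well, and this is what yields the inequality required of a 2-arrow.
\<close>

section \<open>Equivalences of categories\<close>

lemma category_full_sub: "category C \<Longrightarrow> category (full_sub C P)"
  by (simp add: category_def full_sub_def)

lemma is_functorI:
  assumes "\<And>X. X \<in> ob C \<Longrightarrow> fob F X \<in> ob D"
    and "\<And>X. X \<notin> ob C \<Longrightarrow> fob F X = undefined"
    and "\<And>X Y f. \<lbrakk>X \<in> ob C; Y \<in> ob C; f \<in> hom C X Y\<rbrakk> \<Longrightarrow> far F X Y f \<in> hom D (fob F X) (fob F Y)"
    and "\<And>X. X \<notin> ob C \<Longrightarrow> far F X = undefined"
    and "\<And>X Y. \<lbrakk>X \<in> ob C; Y \<notin> ob C\<rbrakk> \<Longrightarrow> far F X Y = undefined"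
    and "\<And>X Y f. \<lbrakk>X \<in> ob C; Y \<in> ob C; f \<notin> hom C X Y\<rbrakk> \<Longrightarrow> far F X Y f = undefined"
    and "\<And>X. X \<in> ob C \<Longrightarrow> far F X X (ide C X) = ide D (fob F X)"
    and "\<And>X Y Z f g. \<lbrakk>X \<in> ob C; Y \<in> ob C; Z \<in> ob C; f \<in> hom C X Y; g \<in> hom C Y Z\<rbrakk> \<Longrightarrow>
      far F X Z (cmp C X Y Z g f) =
        cmp D (fob F X) (fob F Y) (fob F Z) (far F Y Z g) (far F X Y f)"
  shows "is_functor C D F"
  unfolding is_functor_def using assms by (auto simp: PiE_iff extensional_def)

text \<open>
  Surjectivity on objects is required on the nose. A chosen preimage of each object then defines the
  inverse on objects, the counit is an identity, and full faithfulness transports arrows back.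
\<close>

lemma full_faithful_surj_is_equivalence:
  assumes C: "category C" and D: "category D" and F: "is_functor C D F"
    and surj: "\<And>Y. Y \<in> ob D \<Longrightarrow> \<exists>X \<in> ob C. fob F X = Y"
    and ff: "\<And>X Y. \<lbrakk>X \<in> ob C; Y \<in> ob C\<rbrakk> \<Longrightarrow>
      bij_betw (far F X Y) (hom C X Y) (hom D (fob F X) (fob F Y))"
  shows "is_equivalence C D F"
proof -
  interpret C: category C by fact
  interpret D: category D by fact
  note [simp] = C.ide_hom C.cmp_hom C.cmp_ide_left C.cmp_ide_right
    D.ide_hom D.cmp_hom D.cmp_ide_left D.cmp_ide_right
  define s where "s Y = (SOME X. X \<in> ob C \<and> fob F X = Y)" for Y
  have s: "s Y \<in> ob C" "fob F (s Y) = Y" if "Y \<in> ob D" for Y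
    using someI_ex[of "\<lambda>X. X \<in> ob C \<and> fob F X = Y"] surj[OF that] unfolding s_def by blast+
  have Fo[simp]: "fob F X \<in> ob D" if "X \<in> ob C" for X
    using F that by (auto simp: is_functor_def)
  have Fh: "far F X Y f \<in> hom D (fob F X) (fob F Y)" if "X \<in> ob C" "Y \<in> ob C" "f \<in> hom C X Y" for X Y f
    using ff[OF that(1,2)] that(3) by (auto simp: bij_betw_def)
  have Fi: "far F X X (ide C X) = ide D (fob F X)" if "X \<in> ob C" for X
    using F that by (auto simp: is_functor_def)
  have Fc: "far F X Z (cmp C X Y Z g f) =
        cmp D (fob F X) (fob F Y) (fob F Z) (far F Y Z g) (far F X Y f)"
    if "X \<in> ob C" "Y \<in> ob C" "Z \<in> ob C" "f \<in> hom C X Y" "g \<in> hom C Y Z" for X Y Z f g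
    using F that by (auto simp: is_functor_def)
  define l where "l X Y = inv_into (hom C X Y) (far F X Y)" for X Y
  have lh: "l X Y g \<in> hom C X Y" and Fl: "far F X Y (l X Y g) = g"
    if "X \<in> ob C" "Y \<in> ob C" "g \<in> hom D (fob F X) (fob F Y)" for X Y g
  proof -
    have "g \<in> far F X Y ` hom C X Y" using ff[OF that(1,2)] that(3) by (auto simp: bij_betw_def)
    then show "l X Y g \<in> hom C X Y" "far F X Y (l X Y g) = g"
      unfolding l_def by (auto intro: inv_into_into f_inv_into_f)
  qed
  have eqI: "f = g" if "far F X Y f = far F X Y g" "X \<in> ob C" "Y \<in> ob C"
      "f \<in> hom C X Y" "g \<in> hom C X Y" for X Y f g
    using ff[OF that(2,3)] that by (auto simp: bij_betw_def inj_on_def)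
  define G where "G = \<lparr>fob = (\<lambda>Y\<in>ob D. s Y),
    far = (\<lambda>Y\<in>ob D. \<lambda>Z\<in>ob D. \<lambda>g\<in>hom D Y Z. l (s Y) (s Z) g)\<rparr>"
  have G: "is_functor D C G"
    by (rule is_functorI)
      (auto simp: G_def s lh Fl Fi Fc intro: eqI[OF _ _ _ lh] eqI[OF _ _ _ lh C.cmp_hom])
  define \<eta> where "\<eta> = (\<lambda>X\<in>ob C. l X (s (fob F X)) (ide D (fob F X)))"
  define \<epsilon> where "\<epsilon> = (\<lambda>Y\<in>ob D. ide D Y)"
  have 1: "is_iso C X (s (fob F X)) (l X (s (fob F X)) (ide D (fob F X)))" if X: "X \<in> ob C" for X
    unfolding is_iso_def
  proof (intro conjI bexI)
    let ?Y = "s (fob F X)"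
    have Y: "?Y \<in> ob C" "fob F ?Y = fob F X" using s X by auto
    let ?i = "l X ?Y (ide D (fob F X))" and ?j = "l ?Y X (ide D (fob F X))"
    have i: "?i \<in> hom C X ?Y" "far F X ?Y ?i = ide D (fob F X)" using X Y by (auto intro: lh Fl)
    have j: "?j \<in> hom C ?Y X" "far F ?Y X ?j = ide D (fob F X)" using X Y by (auto intro: lh Fl)
    show "?i \<in> hom C X ?Y" by (rule i)
    show "?j \<in> hom C ?Y X" by (rule j)
    show "cmp C X ?Y X ?j ?i = ide C X"
      by (rule eqI[OF _ X X]) (use X Y i j in \<open>auto simp: Fc Fi\<close>)
    show "cmp C ?Y X ?Y ?i ?j = ide C ?Y"
      by (rule eqI[OF _ Y(1) Y(1)]) (use X Y i j in \<open>auto simp: Fc Fi\<close>)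
  qed
  have \<eta>: "natural_iso C C (id_functor C) (comp_functor C G F) \<eta>"
    unfolding natural_iso_def natural_trans_def
  proof (intro conjI ballI)
    show "\<eta> \<in> (\<Pi>\<^sub>E X\<in>ob C. hom C (fob (id_functor C) X) (fob (comp_functor C G F) X))"
      using 1 by (auto simp: \<eta>_def id_functor_def comp_functor_def G_def is_iso_def)
    fix X assume X: "X \<in> ob C"
    show "is_iso C (fob (id_functor C) X) (fob (comp_functor C G F) X) (\<eta> X)"
      using 1 X by (auto simp: \<eta>_def id_functor_def comp_functor_def G_def)
    fix Y f assume Y: "Y \<in> ob C" and f: "f \<in> hom C X Y"
    let ?sX = "s (fob F X)" and ?sY = "s (fob F Y)"
    have s': "?sX \<in> ob C" "?sY \<in> ob C" "fob F ?sX = fob F X" "fob F ?sY = fob F Y"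
      using s X Y by auto
    have "cmp C X Y ?sY (l Y ?sY (ide D (fob F Y))) f =
      cmp C X ?sX ?sY (l ?sX ?sY (far F X Y f)) (l X ?sX (ide D (fob F X)))"
      by (rule eqI[OF _ X s'(2)]) (use X Y f s' in \<open>auto simp: Fc Fl Fh lh\<close>)
    then show "cmp C (fob (id_functor C) X) (fob (id_functor C) Y) (fob (comp_functor C G F) Y) (\<eta> Y)
        (far (id_functor C) X Y f) =
      cmp C (fob (id_functor C) X) (fob (comp_functor C G F) X) (fob (comp_functor C G F) Y)
        (far (comp_functor C G F) X Y f) (\<eta> X)"
      using X Y f Fh[OF X Y f] by (simp add: \<eta>_def id_functor_def comp_functor_def G_def)
  qed
  have 2: "is_iso D Y Y (ide D Y)" if "Y \<in> ob D" for Y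
    unfolding is_iso_def using that by auto
  have \<epsilon>: "natural_iso D D (comp_functor D F G) (id_functor D) \<epsilon>"
    unfolding natural_iso_def natural_trans_def
    by (auto simp: \<epsilon>_def id_functor_def comp_functor_def G_def s Fl 2)
  show ?thesis
    unfolding is_equivalence_def using C D F G \<eta> \<epsilon> by blast
qed

section \<open>The calculus of relations in a doctrine\<close>

context rel_doctrine
begin

lemmas closed [simp] =
  base_cat.ide_hom base_cat.cmp_hom base_cat.cmp_ide_left base_cat.cmp_ide_right
  reix_fibre rid_fibre rcmp_fibre conv_fibre reix_ide rcmp_rid_left rcmp_rid_right conv_rid conv_conv

lemma le_refl': "\<lbrakk>X \<in> ob (base R); Y \<in> ob (base R); \<alpha> \<in> fibre R X Y\<rbrakk> \<Longrightarrow> le R X Y \<alpha> \<alpha>"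
  by (blast intro: reflp_onD[OF le_refl])

lemma le_tr: "\<lbrakk>le R X Y \<alpha> \<beta>; le R X Y \<beta> \<gamma>; X \<in> ob (base R); Y \<in> ob (base R);
    \<alpha> \<in> fibre R X Y; \<beta> \<in> fibre R X Y; \<gamma> \<in> fibre R X Y\<rbrakk> \<Longrightarrow> le R X Y \<alpha> \<gamma>"
  by (blast intro: transp_onD[OF le_trans])

lemma le_asym: "\<lbrakk>le R X Y \<alpha> \<beta>; le R X Y \<beta> \<alpha>; X \<in> ob (base R); Y \<in> ob (base R);
    \<alpha> \<in> fibre R X Y; \<beta> \<in> fibre R X Y\<rbrakk> \<Longrightarrow> \<alpha> = \<beta>"
  by (blast intro: antisymp_onD[OF le_antisym])

lemma reix_le: "\<lbrakk>le R A B \<alpha> \<beta>; X \<in> ob (base R); Y \<in> ob (base R); A \<in> ob (base R); B \<in> ob (base R);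
    f \<in> hom (base R) X A; g \<in> hom (base R) Y B; \<alpha> \<in> fibre R A B; \<beta> \<in> fibre R A B\<rbrakk>
  \<Longrightarrow> le R X Y (reix R X Y A B f g \<alpha>) (reix R X Y A B f g \<beta>)"
  by (blast intro: monotone_onD[OF reix_mono])

lemma conv_le: "\<lbrakk>le R X Y \<alpha> \<beta>; X \<in> ob (base R); Y \<in> ob (base R);
    \<alpha> \<in> fibre R X Y; \<beta> \<in> fibre R X Y\<rbrakk> \<Longrightarrow> le R Y X (conv R X Y \<alpha>) (conv R X Y \<beta>)"
  by (blast intro: monotone_onD[OF conv_mono])

text \<open>
  The lax law for the converse of a reindexing, applied to the converse relation, gives the opposite
  inequality because the converse is an involution.
\<close>

lemma conv_reix_eq: "\<lbrakk>X \<in> ob (base R); Y \<in> ob (base R); A \<in> ob (base R); B \<in> ob (base R);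
    f \<in> hom (base R) X A; g \<in> hom (base R) Y B; \<alpha> \<in> fibre R A B\<rbrakk>
  \<Longrightarrow> conv R X Y (reix R X Y A B f g \<alpha>) = reix R Y X B A g f (conv R A B \<alpha>)"
  using conv_le[OF conv_reix[of Y X B A g f "conv R A B \<alpha>"]]
  by (intro le_asym[of Y X]) (auto intro: conv_reix)

lemma graph_fibre [simp]: "\<lbrakk>X \<in> ob (base R); Y \<in> ob (base R); f \<in> hom (base R) X Y\<rbrakk> \<Longrightarrow>
    graph R X Y f \<in> fibre R X Y"
  by (simp add: graph_def)

lemma kernel_fibre [simp]: "\<lbrakk>X \<in> ob (base R); Y \<in> ob (base R); f \<in> hom (base R) X Y\<rbrakk> \<Longrightarrow>
    kernel R X Y f \<in> fibre R X X"
  by (simp add: kernel_def)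

lemma conv_graph: "\<lbrakk>X \<in> ob (base R); Y \<in> ob (base R); f \<in> hom (base R) X Y\<rbrakk> \<Longrightarrow>
    conv R X Y (graph R X Y f) = reix R Y X Y Y (ide (base R) Y) f (rid R Y)"
  by (simp add: graph_def conv_reix_eq)

text \<open>
  The inequality \<open>\<ge>\<close> is the lax law for reindexing composites. For \<open>\<le>\<close>, splitting
  \<open>d\<^sub>X \<le> R\<^bsub>f,f\<^esub>(d\<^sub>A)\<close> into two reindexings yields \<open>d\<^sub>X \<le> R\<^bsub>id,f\<^esub>(\<Gamma>\<^sub>f)\<close>, and dually for \<open>g\<close>; composing
  the reindexed relation with these two bounds and applying the lax law moves the reindexing onto
  the graphs.
\<close>

lemma reix_eq_rcmp:
  assumes "X \<in> ob (base R)" "Y \<in> ob (base R)" "A \<in> ob (base R)" "B \<in> ob (base R)"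
    "f \<in> hom (base R) X A" "g \<in> hom (base R) Y B" "\<alpha> \<in> fibre R A B"
  shows "reix R X Y A B f g \<alpha> =
    rcmp R X A Y (graph R X A f) (rcmp R A B Y \<alpha> (conv R Y B (graph R Y B g)))"
proof (rule le_asym[of X Y])
  let ?iX = "ide (base R) X" and ?iY = "ide (base R) Y" and ?iA = "ide (base R) A"
    and ?iB = "ide (base R) B" and ?\<rho> = "reix R X Y A B f g \<alpha>"
  note [simp] = assms
  have "le R X X (rid R X) (reix R X X X A ?iX f (graph R X A f))"
    using rid_reix[of X A f] reix_cmp[of X X X A A A ?iX f f ?iA "rid R A"] by (simp add: graph_def)
  moreover have "le R Y Y (rid R Y) (reix R Y Y B Y g ?iY (conv R Y B (graph R Y B g)))"
    using rid_reix[of Y B g] reix_cmp[of Y Y B Y B B g ?iY ?iB g "rid R B"] by (simp add: conv_graph)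
  ultimately have 1: "le R X Y (rcmp R X X Y (rid R X) (rcmp R X Y Y ?\<rho> (rid R Y)))
      (rcmp R X X Y (reix R X X X A ?iX f (graph R X A f))
        (rcmp R X Y Y ?\<rho> (reix R Y Y B Y g ?iY (conv R Y B (graph R Y B g)))))"
    by (intro rcmp_mono) (auto intro: le_refl')
  have 2: "le R X Y \<dots> (rcmp R X X Y (reix R X X X A ?iX f (graph R X A f))
        (reix R X Y A Y f ?iY (rcmp R A B Y \<alpha> (conv R Y B (graph R Y B g)))))"
    by (intro rcmp_mono rcmp_reix) (auto intro: le_refl')
  have 3: "le R X Y \<dots> (reix R X Y X Y ?iX ?iY
      (rcmp R X A Y (graph R X A f) (rcmp R A B Y \<alpha> (conv R Y B (graph R Y B g)))))"
    by (intro rcmp_reix) auto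
  from le_tr[OF 1 le_tr[OF 2 3]] show "le R X Y ?\<rho>
      (rcmp R X A Y (graph R X A f) (rcmp R A B Y \<alpha> (conv R Y B (graph R Y B g))))"
    by simp
  have 4: "le R X Y (rcmp R X A Y (graph R X A f) (rcmp R A B Y \<alpha> (conv R Y B (graph R Y B g))))
      (rcmp R X A Y (graph R X A f) (reix R A Y A B ?iA g (rcmp R A B B \<alpha> (rid R B))))"
    using rcmp_reix[of A B Y A B B ?iA ?iB g \<alpha> "rid R B"]
    by (intro rcmp_mono) (auto intro: le_refl' simp: conv_graph)
  have 5: "le R X Y \<dots> (reix R X Y A B f g (rcmp R A A B (rid R A) (rcmp R A B B \<alpha> (rid R B))))"
    unfolding graph_def by (intro rcmp_reix) auto
  from le_tr[OF 4 5] show "le R X Y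
      (rcmp R X A Y (graph R X A f) (rcmp R A B Y \<alpha> (conv R Y B (graph R Y B g)))) ?\<rho>"
    by simp
qed (simp_all add: assms)

lemma kernel_eq_reix: "\<lbrakk>X \<in> ob (base R); Y \<in> ob (base R); f \<in> hom (base R) X Y\<rbrakk> \<Longrightarrow>
    kernel R X Y f = reix R X X Y Y f f (rid R Y)"
  by (simp add: kernel_def reix_eq_rcmp)

lemma kernel_cmp:
  "\<lbrakk>X \<in> ob (base R); Y \<in> ob (base R); Z \<in> ob (base R); f \<in> hom (base R) X Y; g \<in> hom (base R) Y Z\<rbrakk> \<Longrightarrow>
    kernel R X Z (cmp (base R) X Y Z g f) = reix R X X Y Y f f (kernel R Y Z g)"
  by (simp add: kernel_eq_reix reix_cmp)

lemma kernel_le_kernel_cmp: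
  "\<lbrakk>X \<in> ob (base R); Y \<in> ob (base R); Z \<in> ob (base R); f \<in> hom (base R) X Y; g \<in> hom (base R) Y Z\<rbrakk> \<Longrightarrow>
    le R X X (kernel R X Y f) (kernel R X Z (cmp (base R) X Y Z g f))"
  using reix_le[OF rid_reix[of Y Z g], of X X f f] by (simp add: kernel_eq_reix reix_cmp)

text \<open>
  The inequality opposite to descent holds for every arrow, since a graph is left adjoint to its
  converse.
\<close>

lemma descent_eq:
  assumes "X \<in> ob (base R)" "W \<in> ob (base R)" "q \<in> hom (base R) X W" "descent R X W q"
  shows "rcmp R W X W (conv R X W (graph R X W q)) (graph R X W q) = rid R W"
proof (rule le_asym[of W W])
  have "le R W W (rcmp R W X W (conv R X W (graph R X W q)) (graph R X W q))
    (reix R W W W W (ide (base R) W) (ide (base R) W) (rcmp R W W W (rid R W) (rid R W)))"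
    using rcmp_reix[of W X W W W W "ide (base R) W" q "ide (base R) W" "rid R W" "rid R W"] assms
    unfolding conv_graph[OF assms(1-3)] by (simp add: graph_def)
  then show "le R W W (rcmp R W X W (conv R X W (graph R X W q)) (graph R X W q)) (rid R W)"
    using assms by simp
qed (use assms in \<open>auto simp: descent_def\<close>)

end

text \<open>
  Direct image along a pair of arrows: the left adjoint of reindexing.
\<close>

definition dimg :: "('o, 'a, 'r) rdoc \<Rightarrow> 'o \<Rightarrow> 'o \<Rightarrow> 'o \<Rightarrow> 'o \<Rightarrow> 'a \<Rightarrow> 'a \<Rightarrow> 'r \<Rightarrow> 'r" where
  "dimg R X Y A B p q \<alpha> =
    rcmp R A X B (conv R X A (graph R X A p)) (rcmp R X Y B \<alpha> (graph R Y B q))"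

context rel_doctrine
begin

lemma dimg_fibre [simp]:
  "\<lbrakk>X \<in> ob (base R); Y \<in> ob (base R); A \<in> ob (base R); B \<in> ob (base R);
    p \<in> hom (base R) X A; q \<in> hom (base R) Y B; \<alpha> \<in> fibre R X Y\<rbrakk> \<Longrightarrow>
    dimg R X Y A B p q \<alpha> \<in> fibre R A B"
  by (simp add: dimg_def)

lemma dimg_reix:
  assumes "X \<in> ob (base R)" "Y \<in> ob (base R)" "A \<in> ob (base R)" "B \<in> ob (base R)"
    "p \<in> hom (base R) X A" "q \<in> hom (base R) Y B" "descent R X A p" "descent R Y B q"
    "\<beta> \<in> fibre R A B"
  shows "dimg R X Y A B p q (reix R X Y A B p q \<beta>) = \<beta>"
proof -
  note [simp] = assms
  let ?p = "graph R X A p" and ?q = "graph R Y B q"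
  let ?p' = "conv R X A ?p" and ?q' = "conv R Y B ?q"
  have "rcmp R X Y B (reix R X Y A B p q \<beta>) ?q = rcmp R X A B ?p (rcmp R A Y B (rcmp R A B Y \<beta> ?q') ?q)"
    by (simp add: reix_eq_rcmp rcmp_assoc)
  also have "rcmp R A Y B (rcmp R A B Y \<beta> ?q') ?q = rcmp R A B B \<beta> (rcmp R B Y B ?q' ?q)"
    by (simp add: rcmp_assoc)
  also have "\<dots> = \<beta>" by (simp add: descent_eq)
  finally have "dimg R X Y A B p q (reix R X Y A B p q \<beta>) = rcmp R A X B ?p' (rcmp R X A B ?p \<beta>)"
    by (simp add: dimg_def)
  also have "\<dots> = rcmp R A A B (rcmp R A X A ?p' ?p) \<beta>" by (simp add: rcmp_assoc)
  finally show ?thesis by (simp add: descent_eq)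
qed

text \<open>
  When \<open>\<alpha>\<close> is unchanged by composition with the two kernels, the right-hand side is \<open>\<alpha>\<close>; such
  relations are therefore in the image of reindexing.
\<close>

lemma reix_dimg:
  assumes "X \<in> ob (base R)" "Y \<in> ob (base R)" "A \<in> ob (base R)" "B \<in> ob (base R)"
    "p \<in> hom (base R) X A" "q \<in> hom (base R) Y B" "\<alpha> \<in> fibre R X Y"
  shows "reix R X Y A B p q (dimg R X Y A B p q \<alpha>) =
    rcmp R X Y Y (rcmp R X X Y (kernel R X A p) \<alpha>) (kernel R Y B q)"
proof -
  note [simp] = assms
  let ?p = "graph R X A p" and ?q = "graph R Y B q"
  let ?p' = "conv R X A ?p" and ?q' = "conv R Y B ?q"
  have "reix R X Y A B p q (dimg R X Y A B p q \<alpha>) =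
    rcmp R X A Y ?p (rcmp R A X Y ?p' (rcmp R X B Y (rcmp R X Y B \<alpha> ?q) ?q'))"
    by (simp add: reix_eq_rcmp dimg_def rcmp_assoc)
  also have "rcmp R X B Y (rcmp R X Y B \<alpha> ?q) ?q' = rcmp R X Y Y \<alpha> (kernel R Y B q)"
    by (simp add: kernel_def rcmp_assoc)
  finally show ?thesis by (simp add: rcmp_assoc kernel_def)
qed

lemma dimg_le:
  "\<lbrakk>le R X Y \<alpha> \<beta>; X \<in> ob (base R); Y \<in> ob (base R); A \<in> ob (base R); B \<in> ob (base R);
    p \<in> hom (base R) X A; q \<in> hom (base R) Y B; \<alpha> \<in> fibre R X Y; \<beta> \<in> fibre R X Y\<rbrakk> \<Longrightarrow>
    le R A B (dimg R X Y A B p q \<alpha>) (dimg R X Y A B p q \<beta>)"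
  unfolding dimg_def by (intro rcmp_mono) (auto intro: le_refl')

lemma reix_descent_le:
  assumes "X \<in> ob (base R)" "Y \<in> ob (base R)" "A \<in> ob (base R)" "B \<in> ob (base R)"
    "p \<in> hom (base R) X A" "q \<in> hom (base R) Y B" "descent R X A p" "descent R Y B q"
    "\<alpha> \<in> fibre R A B" "\<beta> \<in> fibre R A B"
    "le R X Y (reix R X Y A B p q \<alpha>) (reix R X Y A B p q \<beta>)"
  shows "le R A B \<alpha> \<beta>"
  using dimg_le[OF assms(11), of A B p q] assms by (simp add: dimg_reix)

lemma reix_descent_inj:
  assumes "X \<in> ob (base R)" "Y \<in> ob (base R)" "A \<in> ob (base R)" "B \<in> ob (base R)"
    "p \<in> hom (base R) X A" "q \<in> hom (base R) Y B" "descent R X A p" "descent R Y B q"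
    "\<alpha> \<in> fibre R A B" "\<beta> \<in> fibre R A B"
    "reix R X Y A B p q \<alpha> = reix R X Y A B p q \<beta>"
  shows "\<alpha> = \<beta>"
  using dimg_reix[OF assms(1-8)] assms(9-11) by metis

text \<open>
  For a general middle arrow this is only an inequality; for a descent arrow the factor
  \<open>\<Gamma>\<^sub>q\<^sup>\<bottom> ; \<Gamma>\<^sub>q\<close> in the middle is an identity.
\<close>

lemma rcmp_reix_descent:
  assumes "X \<in> ob (base R)" "Y \<in> ob (base R)" "Z \<in> ob (base R)"
    "A \<in> ob (base R)" "B \<in> ob (base R)" "D \<in> ob (base R)"
    "f \<in> hom (base R) X A" "q \<in> hom (base R) Y B" "h \<in> hom (base R) Z D"
    "\<alpha> \<in> fibre R A B" "\<beta> \<in> fibre R B D" "descent R Y B q"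
  shows "rcmp R X Y Z (reix R X Y A B f q \<alpha>) (reix R Y Z B D q h \<beta>) =
    reix R X Z A D f h (rcmp R A B D \<alpha> \<beta>)"
proof -
  note [simp] = assms
  let ?f = "graph R X A f" and ?q = "graph R Y B q" and ?h = "graph R Z D h"
  let ?q' = "conv R Y B ?q" and ?h' = "conv R Z D ?h"
  have "rcmp R X Y Z (reix R X Y A B f q \<alpha>) (reix R Y Z B D q h \<beta>) =
    rcmp R X B Z (rcmp R X Y B (rcmp R X B Y (rcmp R X A B ?f \<alpha>) ?q') ?q) (rcmp R B D Z \<beta> ?h')"
    by (simp add: reix_eq_rcmp rcmp_assoc)
  also have "rcmp R X Y B (rcmp R X B Y (rcmp R X A B ?f \<alpha>) ?q') ?q =
    rcmp R X B B (rcmp R X A B ?f \<alpha>) (rcmp R B Y B ?q' ?q)"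
    by (simp add: rcmp_assoc)
  finally show ?thesis by (simp add: descent_eq reix_eq_rcmp rcmp_assoc)
qed

lemma equiv_rel_fibre: "equiv_rel R X \<rho> \<Longrightarrow> \<rho> \<in> fibre R X X"
  by (simp add: equiv_rel_def)

lemma equiv_rel_rid: "X \<in> ob (base R) \<Longrightarrow> equiv_rel R X (rid R X)"
  by (simp add: equiv_rel_def le_refl')

lemma equiv_rel_conv:
  assumes "X \<in> ob (base R)" "equiv_rel R X \<rho>" shows "conv R X X \<rho> = \<rho>"
proof (rule le_asym[of X X])
  have "le R X X (conv R X X (conv R X X \<rho>)) (conv R X X \<rho>)"
    using assms by (intro conv_le) (auto simp: equiv_rel_def)
  then show "le R X X \<rho> (conv R X X \<rho>)" using assms by (simp add: equiv_rel_def)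
qed (use assms in \<open>auto simp: equiv_rel_def\<close>)

lemma rcmp_equiv_left:
  assumes "X \<in> ob (base R)" "Y \<in> ob (base R)" "equiv_rel R X \<rho>" "\<alpha> \<in> fibre R X Y"
  shows "le R X Y \<alpha> (rcmp R X X Y \<rho> \<alpha>)"
  using rcmp_mono[of X X Y "rid R X" \<rho> \<alpha> \<alpha>] assms by (simp add: equiv_rel_def le_refl')

lemma rcmp_equiv_right:
  assumes "X \<in> ob (base R)" "Y \<in> ob (base R)" "equiv_rel R Y \<sigma>" "\<alpha> \<in> fibre R X Y"
  shows "le R X Y \<alpha> (rcmp R X Y Y \<alpha> \<sigma>)"
  using rcmp_mono[of X Y Y \<alpha> \<alpha> "rid R Y" \<sigma>] assms by (simp add: equiv_rel_def le_refl')

lemma rcmp_equiv_idem: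
  assumes "X \<in> ob (base R)" "equiv_rel R X \<rho>" shows "rcmp R X X X \<rho> \<rho> = \<rho>"
  by (rule le_asym[of X X]) (use assms rcmp_equiv_left in \<open>auto simp: equiv_rel_def\<close>)

section \<open>Quotient arrows\<close>

lemma quotient_arrow_factor:
  assumes "quotient_arrow R X \<rho> W q" "Z \<in> ob (base R)" "f \<in> hom (base R) X Z"
    "le R X X \<rho> (kernel R X Z f)"
  obtains h where "h \<in> hom (base R) W Z" "cmp (base R) X W Z h q = f"
  using assms unfolding quotient_arrow_def by blast

text \<open>
  The universal property applies to any composite \<open>h \<circ> q\<close>, because the kernel of \<open>q\<close> lies below that
  of \<open>h \<circ> q\<close>; its uniqueness part then cancels \<open>q\<close>.
\<close>

lemma quotient_arrow_epi:
  assumes "quotient_arrow R X \<rho> W q" "X \<in> ob (base R)" "\<rho> \<in> fibre R X X" "Z \<in> ob (base R)"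
    "h \<in> hom (base R) W Z" "k \<in> hom (base R) W Z"
    "cmp (base R) X W Z h q = cmp (base R) X W Z k q"
  shows "h = k"
proof -
  have q: "W \<in> ob (base R)" "q \<in> hom (base R) X W" "le R X X \<rho> (kernel R X W q)"
    using assms unfolding quotient_arrow_def by auto
  have "le R X X \<rho> (kernel R X Z (cmp (base R) X W Z h q))"
    by (rule le_tr[OF q(3) kernel_le_kernel_cmp]) (use assms q in auto)
  then have "\<exists>!k. k \<in> hom (base R) W Z \<and> cmp (base R) X W Z h q = cmp (base R) X W Z k q"
    using assms q unfolding quotient_arrow_def by auto
  then show ?thesis using assms(5-7) by blast
qed

lemma quotient_arrow_cmp_iso:
  assumes q: "quotient_arrow R X \<rho> W q" and X: "X \<in> ob (base R)" "\<rho> \<in> fibre R X X"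
    and V: "V \<in> ob (base R)" and i: "is_iso (base R) W V i"
  shows "quotient_arrow R X \<rho> V (cmp (base R) X W V i q)"
proof -
  have q': "W \<in> ob (base R)" "q \<in> hom (base R) X W" "le R X X \<rho> (kernel R X W q)"
    using q unfolding quotient_arrow_def by auto
  obtain j where j: "i \<in> hom (base R) W V" "j \<in> hom (base R) V W"
    "cmp (base R) W V W j i = ide (base R) W" "cmp (base R) V W V i j = ide (base R) V"
    using i unfolding is_iso_def by blast
  note [simp] = X V q'(1,2) j
  have ker: "le R X X \<rho> (kernel R X V (cmp (base R) X W V i q))"
    by (rule le_tr[OF q'(3) kernel_le_kernel_cmp]) auto
  have ji: "cmp (base R) W V Z (cmp (base R) V W Z h j) i = h"
    if "Z \<in> ob (base R)" "h \<in> hom (base R) W Z" for Z h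
    using base_cat.cmp_assoc[of W V W Z i j h] that by simp
  have ij: "cmp (base R) V W Z (cmp (base R) W V Z k i) j = k"
    if "Z \<in> ob (base R)" "k \<in> hom (base R) V Z" for Z k
    using base_cat.cmp_assoc[of V W V Z j i k] that by simp
  show ?thesis
    unfolding quotient_arrow_def
  proof (intro conjI ballI impI)
    fix Z f assume Z[simp]: "Z \<in> ob (base R)" and f: "f \<in> hom (base R) X Z"
      and "le R X X \<rho> (kernel R X Z f)"
    then obtain h where h[simp]: "h \<in> hom (base R) W Z" and hf: "cmp (base R) X W Z h q = f"
      using quotient_arrow_factor[OF q] by blast
    show "\<exists>!k. k \<in> hom (base R) V Z \<and> f = cmp (base R) X V Z k (cmp (base R) X W V i q)"
    proof (rule ex1I[of _ "cmp (base R) V W Z h j"])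
      have "cmp (base R) X V Z (cmp (base R) V W Z h j) (cmp (base R) X W V i q) =
          cmp (base R) X W Z (cmp (base R) W V Z (cmp (base R) V W Z h j) i) q"
        by (rule base_cat.cmp_assoc) simp_all
      also have "\<dots> = f" by (simp only: ji[OF Z h] hf)
      finally show "cmp (base R) V W Z h j \<in> hom (base R) V Z \<and>
        f = cmp (base R) X V Z (cmp (base R) V W Z h j) (cmp (base R) X W V i q)"
        by simp
      fix k assume k: "k \<in> hom (base R) V Z \<and> f = cmp (base R) X V Z k (cmp (base R) X W V i q)"
      then have k'[simp]: "k \<in> hom (base R) V Z" by (rule conjunct1)
      have "cmp (base R) X W Z (cmp (base R) W V Z k i) q =
          cmp (base R) X V Z k (cmp (base R) X W V i q)"
        by (rule base_cat.cmp_assoc[symmetric]) simp_all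
      also have "\<dots> = cmp (base R) X W Z h q"
        by (rule trans[OF k[THEN conjunct2, symmetric] hf[symmetric]])
      finally have "cmp (base R) W V Z k i = h"
        by - (rule quotient_arrow_epi[OF q, of Z], simp_all)
      then show "k = cmp (base R) V W Z h j" using ij[OF Z k'] by simp
    qed
  qed (use ker in auto)
qed

lemma quotient_arrow_unique:
  assumes q: "quotient_arrow R X \<rho> W q" and r: "quotient_arrow R X \<rho> V r"
    and X: "X \<in> ob (base R)" "\<rho> \<in> fibre R X X"
  obtains i where "is_iso (base R) W V i" "cmp (base R) X W V i q = r"
proof -
  have q': "W \<in> ob (base R)" "q \<in> hom (base R) X W" "le R X X \<rho> (kernel R X W q)"
    using q unfolding quotient_arrow_def by auto
  have r': "V \<in> ob (base R)" "r \<in> hom (base R) X V" "le R X X \<rho> (kernel R X V r)"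
    using r unfolding quotient_arrow_def by auto
  note [simp] = X q'(1,2) r'(1,2)
  obtain i where i[simp]: "i \<in> hom (base R) W V" "cmp (base R) X W V i q = r"
    using quotient_arrow_factor[OF q _ _ r'(3)] by auto
  obtain j where j[simp]: "j \<in> hom (base R) V W" "cmp (base R) X V W j r = q"
    using quotient_arrow_factor[OF r _ _ q'(3)] by auto
  have "cmp (base R) W V W j i = ide (base R) W"
    using base_cat.cmp_assoc[of X W V W q i j] by - (rule quotient_arrow_epi[OF q, of W], simp_all)
  moreover have "cmp (base R) V W V i j = ide (base R) V"
    using base_cat.cmp_assoc[of X V W V r j i] by - (rule quotient_arrow_epi[OF r, of V], simp_all)
  ultimately have "is_iso (base R) W V i" using i j unfolding is_iso_def by blast
  then show ?thesis using that i by blast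
qed

end

section \<open>1-arrows and 2-arrows\<close>

lemma onearr_eqI:
  assumes F: "lax_arrow R S F" and G: "lax_arrow R S G"
    and ob: "\<And>X. X \<in> ob (base R) \<Longrightarrow> fob F X = fob G X"
    and ar: "\<And>X Y f. \<lbrakk>X \<in> ob (base R); Y \<in> ob (base R); f \<in> hom (base R) X Y\<rbrakk> \<Longrightarrow>
      far F X Y f = far G X Y f"
    and re: "\<And>X Y \<alpha>. \<lbrakk>X \<in> ob (base R); Y \<in> ob (base R); \<alpha> \<in> fibre R X Y\<rbrakk> \<Longrightarrow>
      frel F X Y \<alpha> = frel G X Y \<alpha>"
  shows "F = G"
proof -
  have F0: "fob F \<in> ob (base R) \<rightarrow>\<^sub>E ob (base S)"
    "far F \<in> (\<Pi>\<^sub>E X \<in> ob (base R). \<Pi>\<^sub>E Y \<in> ob (base R).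
      hom (base R) X Y \<rightarrow>\<^sub>E hom (base S) (fob F X) (fob F Y))"
    "frel F \<in> (\<Pi>\<^sub>E X \<in> ob (base R). \<Pi>\<^sub>E Y \<in> ob (base R).
      fibre R X Y \<rightarrow>\<^sub>E fibre S (fob F X) (fob F Y))"
    using F by (simp_all add: lax_arrow_def is_functor_def)
  have G0: "fob G \<in> ob (base R) \<rightarrow>\<^sub>E ob (base S)"
    "far G \<in> (\<Pi>\<^sub>E X \<in> ob (base R). \<Pi>\<^sub>E Y \<in> ob (base R).
      hom (base R) X Y \<rightarrow>\<^sub>E hom (base S) (fob G X) (fob G Y))"
    "frel G \<in> (\<Pi>\<^sub>E X \<in> ob (base R). \<Pi>\<^sub>E Y \<in> ob (base R).
      fibre R X Y \<rightarrow>\<^sub>E fibre S (fob G X) (fob G Y))"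
    using G by (simp_all add: lax_arrow_def is_functor_def)
  have "fob F = fob G" by (rule PiE_ext[OF F0(1) G0(1) ob])
  moreover have "far F X Y f = far G X Y f" for X Y f
    using F0(2) G0(2) ar[of X Y f]
    by (cases "X \<in> ob (base R)"; cases "Y \<in> ob (base R)"; cases "f \<in> hom (base R) X Y")
      (auto simp: PiE_iff extensional_def)
  moreover have "frel F X Y \<alpha> = frel G X Y \<alpha>" for X Y \<alpha>
    using F0(3) G0(3) re[of X Y \<alpha>]
    by (cases "X \<in> ob (base R)"; cases "Y \<in> ob (base R)"; cases "\<alpha> \<in> fibre R X Y")
      (auto simp: PiE_iff extensional_def)
  ultimately have "fob F = fob G" "far F = far G" "frel F = frel G" by (auto simp: fun_eq_iff)
  then show ?thesis by simp
qed

locale lax_one_arrow = R: rel_doctrine R + S: rel_doctrine S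
  for R :: "('o, 'a, 'r) rdoc" and S :: "('p, 'b, 's) rdoc" +
  fixes F :: "('o, 'a, 'p, 'b, 'r, 's) onearr"
  assumes lax: "lax_arrow R S F"
begin

lemma underlying_functor: "is_functor (base R) (base S) F"
  using lax by (simp add: lax_arrow_def)

lemma fob_ob [simp]: "X \<in> ob (base R) \<Longrightarrow> fob F X \<in> ob (base S)"
  using underlying_functor unfolding is_functor_def by blast

lemma far_hom [simp]:
  "\<lbrakk>X \<in> ob (base R); Y \<in> ob (base R); f \<in> hom (base R) X Y\<rbrakk> \<Longrightarrow>
    far F X Y f \<in> hom (base S) (fob F X) (fob F Y)"
  using underlying_functor unfolding is_functor_def by blast

lemma far_ide [simp]: "X \<in> ob (base R) \<Longrightarrow> far F X X (ide (base R) X) = ide (base S) (fob F X)"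
  using underlying_functor unfolding is_functor_def by blast

lemma far_cmp:
  "\<lbrakk>X \<in> ob (base R); Y \<in> ob (base R); Z \<in> ob (base R); f \<in> hom (base R) X Y; g \<in> hom (base R) Y Z\<rbrakk> \<Longrightarrow>
    far F X Z (cmp (base R) X Y Z g f) =
      cmp (base S) (fob F X) (fob F Y) (fob F Z) (far F Y Z g) (far F X Y f)"
  using underlying_functor unfolding is_functor_def by blast

lemma frel_fibre [simp]:
  assumes "X \<in> ob (base R)" "Y \<in> ob (base R)" "\<alpha> \<in> fibre R X Y"
  shows "frel F X Y \<alpha> \<in> fibre S (fob F X) (fob F Y)"
proof -
  have "frel F \<in> (\<Pi>\<^sub>E X \<in> ob (base R). \<Pi>\<^sub>E Y \<in> ob (base R).
      fibre R X Y \<rightarrow>\<^sub>E fibre S (fob F X) (fob F Y))"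
    using lax by (simp add: lax_arrow_def)
  then show ?thesis using assms by (simp add: PiE_iff)
qed

lemma frel_le:
  assumes "le R X Y \<alpha> \<beta>" "X \<in> ob (base R)" "Y \<in> ob (base R)" "\<alpha> \<in> fibre R X Y" "\<beta> \<in> fibre R X Y"
  shows "le S (fob F X) (fob F Y) (frel F X Y \<alpha>) (frel F X Y \<beta>)"
proof -
  have "monotone_on (fibre R X Y) (le R X Y) (le S (fob F X) (fob F Y)) (frel F X Y)"
    using lax assms by (simp add: lax_arrow_def)
  then show ?thesis using assms by (blast dest: monotone_onD)
qed

lemma frel_reix:
  "\<lbrakk>X \<in> ob (base R); Y \<in> ob (base R); A \<in> ob (base R); B \<in> ob (base R);
    f \<in> hom (base R) X A; g \<in> hom (base R) Y B; \<alpha> \<in> fibre R A B\<rbrakk> \<Longrightarrow>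
    frel F X Y (reix R X Y A B f g \<alpha>) =
      reix S (fob F X) (fob F Y) (fob F A) (fob F B) (far F X A f) (far F Y B g) (frel F A B \<alpha>)"
  using lax unfolding lax_arrow_def by blast

lemma frel_rid_le:
  "X \<in> ob (base R) \<Longrightarrow> le S (fob F X) (fob F X) (rid S (fob F X)) (frel F X X (rid R X))"
  using lax unfolding lax_arrow_def by blast

lemma frel_rcmp_le:
  "\<lbrakk>X \<in> ob (base R); Y \<in> ob (base R); Z \<in> ob (base R); \<alpha> \<in> fibre R X Y; \<beta> \<in> fibre R Y Z\<rbrakk> \<Longrightarrow>
    le S (fob F X) (fob F Z)
      (rcmp S (fob F X) (fob F Y) (fob F Z) (frel F X Y \<alpha>) (frel F Y Z \<beta>))
      (frel F X Z (rcmp R X Y Z \<alpha> \<beta>))"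
  using lax unfolding lax_arrow_def by blast

lemma frel_conv_le:
  "\<lbrakk>X \<in> ob (base R); Y \<in> ob (base R); \<alpha> \<in> fibre R X Y\<rbrakk> \<Longrightarrow>
    le S (fob F Y) (fob F X)
      (conv S (fob F X) (fob F Y) (frel F X Y \<alpha>)) (frel F Y X (conv R X Y \<alpha>))"
  using lax unfolding lax_arrow_def by blast

text \<open>
  Strictness for converses comes for free: the lax inequality at \<open>\<alpha>\<^sup>\<bottom>\<close> is the opposite one, as the
  converse is a monotone involution.
\<close>

lemma frel_conv:
  assumes "X \<in> ob (base R)" "Y \<in> ob (base R)" "\<alpha> \<in> fibre R X Y"
  shows "frel F Y X (conv R X Y \<alpha>) = conv S (fob F X) (fob F Y) (frel F X Y \<alpha>)"
proof (rule S.le_asym[of "fob F Y" "fob F X"])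
  have "le S (fob F X) (fob F Y) (conv S (fob F Y) (fob F X) (frel F Y X (conv R X Y \<alpha>)))
      (frel F X Y \<alpha>)"
    using frel_conv_le[of Y X "conv R X Y \<alpha>"] assms by simp
  from S.conv_le[OF this] show "le S (fob F Y) (fob F X)
      (frel F Y X (conv R X Y \<alpha>)) (conv S (fob F X) (fob F Y) (frel F X Y \<alpha>))"
    using assms by simp
qed (use assms frel_conv_le in auto)

lemma equiv_rel_frel:
  assumes X: "X \<in> ob (base R)" and \<rho>: "equiv_rel R X \<rho>"
  shows "equiv_rel S (fob F X) (frel F X X \<rho>)"
  unfolding equiv_rel_def
proof (intro conjI)
  have \<rho>': "\<rho> \<in> fibre R X X" using \<rho> by (simp add: equiv_rel_def)
  note [simp] = X \<rho>'
  show "frel F X X \<rho> \<in> fibre S (fob F X) (fob F X)" by simp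
  show "le S (fob F X) (fob F X) (rid S (fob F X)) (frel F X X \<rho>)"
    using \<rho> by (intro S.le_tr[OF frel_rid_le[OF X] frel_le]) (auto simp: equiv_rel_def)
  show "le S (fob F X) (fob F X) (conv S (fob F X) (fob F X) (frel F X X \<rho>)) (frel F X X \<rho>)"
    using \<rho> by (intro S.le_tr[OF frel_conv_le[OF X X \<rho>'] frel_le]) (auto simp: equiv_rel_def)
  show "le S (fob F X) (fob F X)
      (rcmp S (fob F X) (fob F X) (fob F X) (frel F X X \<rho>) (frel F X X \<rho>)) (frel F X X \<rho>)"
    using \<rho> by (intro S.le_tr[OF frel_rcmp_le[OF X X X \<rho>' \<rho>'] frel_le]) (auto simp: equiv_rel_def)
qed

lemma far_iso:
  assumes "X \<in> ob (base R)" "Y \<in> ob (base R)" "is_iso (base R) X Y i"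
  shows "is_iso (base S) (fob F X) (fob F Y) (far F X Y i)"
proof -
  obtain j where "i \<in> hom (base R) X Y" "j \<in> hom (base R) Y X"
    "cmp (base R) X Y X j i = ide (base R) X" "cmp (base R) Y X Y i j = ide (base R) Y"
    using assms unfolding is_iso_def by blast
  then show ?thesis
    using assms far_cmp[of X Y X i j] far_cmp[of Y X Y j i] unfolding is_iso_def
    by (intro conjI bexI[of _ "far F Y X j"]) simp_all
qed

text \<open>
  Any two quotient arrows of a relation differ by an isomorphism, and functors preserve isomorphisms;
  so preservation can be tested on one quotient arrow of each relation.
\<close>

lemma preserves_quotientsI:
  assumes "\<And>X \<rho>. \<lbrakk>X \<in> ob (base R); equiv_rel R X \<rho>\<rbrakk> \<Longrightarrow> \<exists>W q. quotient_arrow R X \<rho> W q \<and>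
    quotient_arrow S (fob F X) (frel F X X \<rho>) (fob F W) (far F X W q)"
  shows "preserves_quotients R S F"
  unfolding preserves_quotients_def
proof (intro ballI allI impI)
  fix X \<rho> V r
  assume X: "X \<in> ob (base R)" and \<rho>: "equiv_rel R X \<rho>" and r: "quotient_arrow R X \<rho> V r"
  obtain W q where q: "quotient_arrow R X \<rho> W q"
    and Fq: "quotient_arrow S (fob F X) (frel F X X \<rho>) (fob F W) (far F X W q)"
    using assms[OF X \<rho>] by blast
  have \<rho>': "\<rho> \<in> fibre R X X" using \<rho> by (rule R.equiv_rel_fibre)
  have [simp]: "W \<in> ob (base R)" "V \<in> ob (base R)" "q \<in> hom (base R) X W"
    using q r unfolding quotient_arrow_def by auto
  obtain i where i: "is_iso (base R) W V i" and r_eq: "cmp (base R) X W V i q = r"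
    by (rule R.quotient_arrow_unique[OF q r X \<rho>'])
  have "i \<in> hom (base R) W V" using i unfolding is_iso_def by blast
  then have "far F X V r = cmp (base S) (fob F X) (fob F W) (fob F V) (far F W V i) (far F X W q)"
    using far_cmp[of X W V q i] X r_eq by simp
  then show "quotient_arrow S (fob F X) (frel F X X \<rho>) (fob F V) (far F X V r)"
    using S.quotient_arrow_cmp_iso[OF Fq _ _ _ far_iso[OF _ _ i]] X \<rho>' by simp
qed

end

locale strict_one_arrow = lax_one_arrow +
  assumes strict: "strict_arrow R S F"
begin

lemma frel_rid [simp]: "X \<in> ob (base R) \<Longrightarrow> frel F X X (rid R X) = rid S (fob F X)"
  using strict unfolding strict_arrow_def by simp

lemma frel_rcmp:
  "\<lbrakk>X \<in> ob (base R); Y \<in> ob (base R); Z \<in> ob (base R); \<alpha> \<in> fibre R X Y; \<beta> \<in> fibre R Y Z\<rbrakk> \<Longrightarrow>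
    frel F X Z (rcmp R X Y Z \<alpha> \<beta>) =
      rcmp S (fob F X) (fob F Y) (fob F Z) (frel F X Y \<alpha>) (frel F Y Z \<beta>)"
  using strict unfolding strict_arrow_def by simp

lemma frel_graph:
  "\<lbrakk>X \<in> ob (base R); Y \<in> ob (base R); f \<in> hom (base R) X Y\<rbrakk> \<Longrightarrow>
    frel F X Y (graph R X Y f) = graph S (fob F X) (fob F Y) (far F X Y f)"
  by (simp add: graph_def frel_reix)

lemma frel_kernel:
  "\<lbrakk>X \<in> ob (base R); Y \<in> ob (base R); f \<in> hom (base R) X Y\<rbrakk> \<Longrightarrow>
    frel F X X (kernel R X Y f) = kernel S (fob F X) (fob F Y) (far F X Y f)"
  by (simp add: kernel_def frel_rcmp frel_conv frel_graph)

text \<open>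
  Strict 1-arrows preserve graphs, converses and composites, the ingredients of descent.
\<close>

lemma descent_far:
  assumes "X \<in> ob (base R)" "W \<in> ob (base R)" "q \<in> hom (base R) X W" "descent R X W q"
  shows "descent S (fob F X) (fob F W) (far F X W q)"
  using frel_le[of W W "rid R W" "rcmp R W X W (conv R X W (graph R X W q)) (graph R X W q)"] assms
  by (simp add: descent_def frel_rcmp frel_conv frel_graph)

end

lemma is_functor_comp_functor:
  assumes F: "is_functor C D F" and G: "is_functor D E' G" and "category C"
  shows "is_functor C E' (comp_functor C G F)"
proof -
  interpret C: category C by fact
  have F1: "fob F X \<in> ob D" if "X \<in> ob C" for X
    using F that unfolding is_functor_def by blast
  have F2: "far F X Y f \<in> hom D (fob F X) (fob F Y)" if "X \<in> ob C" "Y \<in> ob C" "f \<in> hom C X Y" for X Y f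
    using F that unfolding is_functor_def by blast
  have F3: "far F X X (ide C X) = ide D (fob F X)" if "X \<in> ob C" for X
    using F that unfolding is_functor_def by blast
  have F4: "far F X Z (cmp C X Y Z g f) =
        cmp D (fob F X) (fob F Y) (fob F Z) (far F Y Z g) (far F X Y f)"
    if "X \<in> ob C" "Y \<in> ob C" "Z \<in> ob C" "f \<in> hom C X Y" "g \<in> hom C Y Z" for X Y Z f g
    using F that unfolding is_functor_def by blast
  have G1: "fob G X \<in> ob E'" if "X \<in> ob D" for X
    using G that unfolding is_functor_def by blast
  have G2: "far G X Y f \<in> hom E' (fob G X) (fob G Y)" if "X \<in> ob D" "Y \<in> ob D" "f \<in> hom D X Y" for X Y f
    using G that unfolding is_functor_def by blast
  have G3: "far G X X (ide D X) = ide E' (fob G X)" if "X \<in> ob D" for X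
    using G that unfolding is_functor_def by blast
  have G4: "far G X Z (cmp D X Y Z g f) =
        cmp E' (fob G X) (fob G Y) (fob G Z) (far G Y Z g) (far G X Y f)"
    if "X \<in> ob D" "Y \<in> ob D" "Z \<in> ob D" "f \<in> hom D X Y" "g \<in> hom D Y Z" for X Y Z f g
    using G that unfolding is_functor_def by blast
  show ?thesis
    by (rule is_functorI)
      (simp_all add: comp_functor_def F1 F2 F3 F4 G1 G2 G3 G4 C.ide_hom C.cmp_hom)
qed

lemma comp_one_sel [simp]:
  "X \<in> ob (base R) \<Longrightarrow> fob (comp_one R G F) X = fob G (fob F X)"
  "\<lbrakk>X \<in> ob (base R); Y \<in> ob (base R); f \<in> hom (base R) X Y\<rbrakk> \<Longrightarrow>
    far (comp_one R G F) X Y f = far G (fob F X) (fob F Y) (far F X Y f)"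
  "\<lbrakk>X \<in> ob (base R); Y \<in> ob (base R); \<alpha> \<in> fibre R X Y\<rbrakk> \<Longrightarrow>
    frel (comp_one R G F) X Y \<alpha> = frel G (fob F X) (fob F Y) (frel F X Y \<alpha>)"
  by (simp_all add: comp_one_def comp_functor_def)

lemma lax_arrowI:
  assumes "is_functor (base R) (base S) F"
    and "frel F \<in> (\<Pi>\<^sub>E X \<in> ob (base R). \<Pi>\<^sub>E Y \<in> ob (base R).
      fibre R X Y \<rightarrow>\<^sub>E fibre S (fob F X) (fob F Y))"
    and "\<And>X Y \<alpha> \<beta>. \<lbrakk>X \<in> ob (base R); Y \<in> ob (base R); \<alpha> \<in> fibre R X Y; \<beta> \<in> fibre R X Y;
      le R X Y \<alpha> \<beta>\<rbrakk> \<Longrightarrow> le S (fob F X) (fob F Y) (frel F X Y \<alpha>) (frel F X Y \<beta>)"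
    and "\<And>X Y A B f g \<alpha>. \<lbrakk>X \<in> ob (base R); Y \<in> ob (base R); A \<in> ob (base R); B \<in> ob (base R);
      f \<in> hom (base R) X A; g \<in> hom (base R) Y B; \<alpha> \<in> fibre R A B\<rbrakk> \<Longrightarrow>
      frel F X Y (reix R X Y A B f g \<alpha>) =
        reix S (fob F X) (fob F Y) (fob F A) (fob F B) (far F X A f) (far F Y B g) (frel F A B \<alpha>)"
    and "\<And>X. X \<in> ob (base R) \<Longrightarrow> le S (fob F X) (fob F X) (rid S (fob F X)) (frel F X X (rid R X))"
    and "\<And>X Y Z \<alpha> \<beta>. \<lbrakk>X \<in> ob (base R); Y \<in> ob (base R); Z \<in> ob (base R);
      \<alpha> \<in> fibre R X Y; \<beta> \<in> fibre R Y Z\<rbrakk> \<Longrightarrow>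
      le S (fob F X) (fob F Z)
        (rcmp S (fob F X) (fob F Y) (fob F Z) (frel F X Y \<alpha>) (frel F Y Z \<beta>))
        (frel F X Z (rcmp R X Y Z \<alpha> \<beta>))"
    and "\<And>X Y \<alpha>. \<lbrakk>X \<in> ob (base R); Y \<in> ob (base R); \<alpha> \<in> fibre R X Y\<rbrakk> \<Longrightarrow>
      le S (fob F Y) (fob F X)
        (conv S (fob F X) (fob F Y) (frel F X Y \<alpha>)) (frel F Y X (conv R X Y \<alpha>))"
  shows "lax_arrow R S F"
  unfolding lax_arrow_def using assms by (auto intro!: monotone_onI)

lemma strict_arrowI:
  assumes "\<And>X. X \<in> ob (base R) \<Longrightarrow> rid S (fob F X) = frel F X X (rid R X)"
    and "\<And>X Y Z \<alpha> \<beta>. \<lbrakk>X \<in> ob (base R); Y \<in> ob (base R); Z \<in> ob (base R);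
      \<alpha> \<in> fibre R X Y; \<beta> \<in> fibre R Y Z\<rbrakk> \<Longrightarrow>
      rcmp S (fob F X) (fob F Y) (fob F Z) (frel F X Y \<alpha>) (frel F Y Z \<beta>) =
        frel F X Z (rcmp R X Y Z \<alpha> \<beta>)"
  shows "strict_arrow R S F"
  using assms unfolding strict_arrow_def by simp

lemma is_functor_fields:
  assumes "is_functor C D F" "fob G = fob F" "far G = far F"
  shows "is_functor C D G"
  using assms unfolding is_functor_def by simp

lemma strict_arrow_comp_one:
  assumes F: "lax_arrow R S F" "strict_arrow R S F" and G: "lax_arrow S T G" "strict_arrow S T G"
    and R: "rel_doctrine R" "rel_doctrine S" "rel_doctrine T"
  shows "lax_arrow R T (comp_one R G F)" "strict_arrow R T (comp_one R G F)"
proof -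
  interpret F: strict_one_arrow R S F
    using F R by (simp add: strict_one_arrow_def lax_one_arrow_def lax_one_arrow_axioms_def
        strict_one_arrow_axioms_def)
  interpret G: strict_one_arrow S T G
    using G R by (simp add: strict_one_arrow_def lax_one_arrow_def lax_one_arrow_axioms_def
        strict_one_arrow_axioms_def)
  show "lax_arrow R T (comp_one R G F)"
  proof (rule lax_arrowI)
    show "is_functor (base R) (base T) (comp_one R G F)"
      using is_functor_comp_functor[OF F.underlying_functor G.underlying_functor F.R.base_cat.category_axioms]
      by (rule is_functor_fields) (simp_all add: comp_one_def)
    show "frel (comp_one R G F) \<in> (\<Pi>\<^sub>E X \<in> ob (base R). \<Pi>\<^sub>E Y \<in> ob (base R).
      fibre R X Y \<rightarrow>\<^sub>E fibre T (fob (comp_one R G F) X) (fob (comp_one R G F) Y))"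
      by (auto simp: comp_one_def comp_functor_def)
  qed (simp_all add: F.frel_le G.frel_le F.frel_reix G.frel_reix F.frel_rcmp G.frel_rcmp
      F.frel_conv G.frel_conv G.S.le_refl')
  show "strict_arrow R T (comp_one R G F)"
    unfolding strict_arrow_def by (simp add: F.frel_rcmp G.frel_rcmp)
qed

lemma two_arrowI:
  assumes "\<And>X. X \<in> ob (base R) \<Longrightarrow> \<theta> X \<in> hom (base S) (fob F X) (fob G X)"
    and "\<theta> \<in> extensional (ob (base R))"
    and "\<And>X Y f. \<lbrakk>X \<in> ob (base R); Y \<in> ob (base R); f \<in> hom (base R) X Y\<rbrakk> \<Longrightarrow>
      cmp (base S) (fob F X) (fob F Y) (fob G Y) (\<theta> Y) (far F X Y f) =
      cmp (base S) (fob F X) (fob G X) (fob G Y) (far G X Y f) (\<theta> X)"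
    and "\<And>X Y \<alpha>. \<lbrakk>X \<in> ob (base R); Y \<in> ob (base R); \<alpha> \<in> fibre R X Y\<rbrakk> \<Longrightarrow>
      le S (fob F X) (fob F Y) (frel F X Y \<alpha>)
        (reix S (fob F X) (fob F Y) (fob G X) (fob G Y) (\<theta> X) (\<theta> Y) (frel G X Y \<alpha>))"
  shows "two_arrow R S F G \<theta>"
  using assms unfolding two_arrow_def natural_trans_def by (auto simp: PiE_iff)

lemma two_arrow_hom:
  "\<lbrakk>two_arrow R S F G \<theta>; X \<in> ob (base R)\<rbrakk> \<Longrightarrow> \<theta> X \<in> hom (base S) (fob F X) (fob G X)"
  unfolding two_arrow_def natural_trans_def by blast

lemma two_arrow_ext: "two_arrow R S F G \<theta> \<Longrightarrow> \<theta> \<in> extensional (ob (base R))"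
  unfolding two_arrow_def natural_trans_def by (auto simp: PiE_iff)

lemma two_arrow_natural:
  "\<lbrakk>two_arrow R S F G \<theta>; X \<in> ob (base R); Y \<in> ob (base R); f \<in> hom (base R) X Y\<rbrakk> \<Longrightarrow>
    cmp (base S) (fob F X) (fob F Y) (fob G Y) (\<theta> Y) (far F X Y f) =
    cmp (base S) (fob F X) (fob G X) (fob G Y) (far G X Y f) (\<theta> X)"
  unfolding two_arrow_def natural_trans_def by blast

lemma two_arrow_le:
  "\<lbrakk>two_arrow R S F G \<theta>; X \<in> ob (base R); Y \<in> ob (base R); \<alpha> \<in> fibre R X Y\<rbrakk> \<Longrightarrow>
    le S (fob F X) (fob F Y) (frel F X Y \<alpha>)
      (reix S (fob F X) (fob F Y) (fob G X) (fob G Y) (\<theta> X) (\<theta> Y) (frel G X Y \<alpha>))"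
  unfolding two_arrow_def by blast

lemma lax_one_arrowI:
  "\<lbrakk>rel_doctrine R; rel_doctrine S; lax_arrow R S F\<rbrakk> \<Longrightarrow> lax_one_arrow R S F"
  by (simp add: lax_one_arrow_def lax_one_arrow_axioms_def)

lemma strict_one_arrowI:
  "\<lbrakk>rel_doctrine R; rel_doctrine S; lax_arrow R S F; strict_arrow R S F\<rbrakk> \<Longrightarrow> strict_one_arrow R S F"
  by (simp add: lax_one_arrowI strict_one_arrow_def strict_one_arrow_axioms_def)

lemma two_arrow_id_two:
  assumes "rel_doctrine R" "rel_doctrine S" "lax_arrow R S F"
  shows "two_arrow R S F F (id_two R S F)"
proof -
  interpret F: lax_one_arrow R S F using assms by (rule lax_one_arrowI)
  show ?thesis by (rule two_arrowI) (simp_all add: id_two_def F.S.le_refl')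
qed

lemma two_arrow_vcomp:
  assumes "rel_doctrine R" "rel_doctrine S"
    and "lax_arrow R S F" "lax_arrow R S G" "lax_arrow R S H"
    and \<theta>: "two_arrow R S F G \<theta>" and \<phi>: "two_arrow R S G H \<phi>"
  shows "two_arrow R S F H (vcomp R S F G H \<phi> \<theta>)"
proof -
  interpret F: lax_one_arrow R S F using assms by (intro lax_one_arrowI)
  interpret G: lax_one_arrow R S G using assms by (intro lax_one_arrowI)
  interpret H: lax_one_arrow R S H using assms by (intro lax_one_arrowI)
  note [simp] = two_arrow_hom[OF \<theta>] two_arrow_hom[OF \<phi>]
  show ?thesis
  proof (rule two_arrowI)
    fix X Y f assume X[simp]: "X \<in> ob (base R)" and Y[simp]: "Y \<in> ob (base R)" and f[simp]: "f \<in> hom (base R) X Y"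
    let ?F = "fob F" and ?G = "fob G" and ?H = "fob H"
    have "cmp (base S) (?F X) (?F Y) (?H Y) (cmp (base S) (?F Y) (?G Y) (?H Y) (\<phi> Y) (\<theta> Y)) (far F X Y f) =
      cmp (base S) (?F X) (?G Y) (?H Y) (\<phi> Y) (cmp (base S) (?F X) (?F Y) (?G Y) (\<theta> Y) (far F X Y f))"
      by (rule F.S.base_cat.cmp_assoc[symmetric]) simp_all
    also have "\<dots> = cmp (base S) (?F X) (?G Y) (?H Y) (\<phi> Y) (cmp (base S) (?F X) (?G X) (?G Y) (far G X Y f) (\<theta> X))"
      by (simp only: two_arrow_natural[OF \<theta> X Y f])
    also have "\<dots> = cmp (base S) (?F X) (?G X) (?H Y) (cmp (base S) (?G X) (?G Y) (?H Y) (\<phi> Y) (far G X Y f)) (\<theta> X)"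
      by (rule F.S.base_cat.cmp_assoc) simp_all
    also have "\<dots> = cmp (base S) (?F X) (?G X) (?H Y) (cmp (base S) (?G X) (?H X) (?H Y) (far H X Y f) (\<phi> X)) (\<theta> X)"
      by (simp only: two_arrow_natural[OF \<phi> X Y f])
    also have "\<dots> = cmp (base S) (?F X) (?H X) (?H Y) (far H X Y f) (cmp (base S) (?F X) (?G X) (?H X) (\<phi> X) (\<theta> X))"
      by (rule F.S.base_cat.cmp_assoc[symmetric]) simp_all
    finally show "cmp (base S) (?F X) (?F Y) (?H Y) (vcomp R S F G H \<phi> \<theta> Y) (far F X Y f) =
      cmp (base S) (?F X) (?H X) (?H Y) (far H X Y f) (vcomp R S F G H \<phi> \<theta> X)"
      by (simp add: vcomp_def)
  next
    fix X Y \<alpha> assume X[simp]: "X \<in> ob (base R)" and Y[simp]: "Y \<in> ob (base R)" and \<alpha>[simp]: "\<alpha> \<in> fibre R X Y"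
    have "le S (fob F X) (fob F Y)
      (reix S (fob F X) (fob F Y) (fob G X) (fob G Y) (\<theta> X) (\<theta> Y) (frel G X Y \<alpha>))
      (reix S (fob F X) (fob F Y) (fob G X) (fob G Y) (\<theta> X) (\<theta> Y)
        (reix S (fob G X) (fob G Y) (fob H X) (fob H Y) (\<phi> X) (\<phi> Y) (frel H X Y \<alpha>)))"
      by (rule F.S.reix_le[OF two_arrow_le[OF \<phi> X Y \<alpha>]]) simp_all
    from F.S.le_tr[OF two_arrow_le[OF \<theta> X Y \<alpha>] this]
    show "le S (fob F X) (fob F Y) (frel F X Y \<alpha>)
      (reix S (fob F X) (fob F Y) (fob H X) (fob H Y)
        (vcomp R S F G H \<phi> \<theta> X) (vcomp R S F G H \<phi> \<theta> Y) (frel H X Y \<alpha>))"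
      by (simp add: vcomp_def F.S.reix_cmp)
  qed (simp_all add: vcomp_def)
qed

lemma category_RDl_hom:
  assumes "rel_doctrine R" "rel_doctrine S"
  shows "category (RDl_hom R S)"
proof -
  interpret R: rel_doctrine R by fact
  interpret S: rel_doctrine S by fact
  have ob: "fob F X \<in> ob (base S)" if "lax_arrow R S F" "X \<in> ob (base R)" for F X
    using lax_one_arrow.fob_ob[OF lax_one_arrowI[OF assms]] that by blast
  show ?thesis
  proof
    fix F G H K \<theta> \<phi> \<psi>
    assume "F \<in> ob (RDl_hom R S)"
    then have F: "lax_arrow R S F" by (simp add: RDl_hom_def)
    show "ide (RDl_hom R S) F \<in> hom (RDl_hom R S) F F"
      using two_arrow_id_two[OF assms F] by (simp add: RDl_hom_def)
    assume "G \<in> ob (RDl_hom R S)"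
    then have FG: "lax_arrow R S F" "lax_arrow R S G" using F by (simp_all add: RDl_hom_def)
    assume "\<theta> \<in> hom (RDl_hom R S) F G"
    then have \<theta>: "two_arrow R S F G \<theta>" by (simp add: RDl_hom_def)
    have \<theta>': "\<theta> = (\<lambda>X\<in>ob (base R). \<theta> X)"
      using two_arrow_ext[OF \<theta>] by (simp add: extensional_restrict)
    have "vcomp R S F F G \<theta> (id_two R S F) = (\<lambda>X\<in>ob (base R). \<theta> X)"
      unfolding vcomp_def id_two_def by (rule restrict_ext) (simp add: FG ob two_arrow_hom[OF \<theta>])
    then show "cmp (RDl_hom R S) F F G \<theta> (ide (RDl_hom R S) F) = \<theta>"
      using \<theta>' by (simp add: RDl_hom_def)
    have "vcomp R S F G G (id_two R S G) \<theta> = (\<lambda>X\<in>ob (base R). \<theta> X)"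
      unfolding vcomp_def id_two_def by (rule restrict_ext) (simp add: FG ob two_arrow_hom[OF \<theta>])
    then show "cmp (RDl_hom R S) F G G (ide (RDl_hom R S) G) \<theta> = \<theta>"
      using \<theta>' by (simp add: RDl_hom_def)
    assume "H \<in> ob (RDl_hom R S)" "\<phi> \<in> hom (RDl_hom R S) G H"
    then have H: "lax_arrow R S H" and \<phi>: "two_arrow R S G H \<phi>" by (simp_all add: RDl_hom_def)
    show "cmp (RDl_hom R S) F G H \<phi> \<theta> \<in> hom (RDl_hom R S) F H"
      using two_arrow_vcomp[OF assms FG H \<theta> \<phi>] by (simp add: RDl_hom_def)
    assume "K \<in> ob (RDl_hom R S)" "\<psi> \<in> hom (RDl_hom R S) H K"
    then have K: "lax_arrow R S K" and \<psi>: "two_arrow R S H K \<psi>" by (simp_all add: RDl_hom_def)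
    have "vcomp R S F H K \<psi> (vcomp R S F G H \<phi> \<theta>) = vcomp R S F G K (vcomp R S G H K \<psi> \<phi>) \<theta>"
      unfolding vcomp_def
      by (rule restrict_ext)
        (simp add: FG H K ob two_arrow_hom[OF \<theta>] two_arrow_hom[OF \<phi>] two_arrow_hom[OF \<psi>]
          S.base_cat.cmp_assoc)
    then show "cmp (RDl_hom R S) F H K \<psi> (cmp (RDl_hom R S) F G H \<phi> \<theta>) =
      cmp (RDl_hom R S) F G K (cmp (RDl_hom R S) G H K \<psi> \<phi>) \<theta>"
      by (simp add: RDl_hom_def)
  qed
qed

lemma RD_hom_simps [simp]:
  "F \<in> ob (RD_hom R S) \<longleftrightarrow> lax_arrow R S F \<and> strict_arrow R S F"
  "\<theta> \<in> hom (RD_hom R S) F G \<longleftrightarrow> two_arrow R S F G \<theta>"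
  "ide (RD_hom R S) = id_two R S"
  "cmp (RD_hom R S) = vcomp R S"
  by (simp_all add: RD_hom_def full_sub_def RDl_hom_def)

lemma QRD_hom_simps [simp]:
  "F \<in> ob (QRD_hom R S) \<longleftrightarrow> lax_arrow R S F \<and> strict_arrow R S F \<and> preserves_quotients R S F"
  "\<theta> \<in> hom (QRD_hom R S) F G \<longleftrightarrow> two_arrow R S F G \<theta>"
  "ide (QRD_hom R S) = id_two R S"
  "cmp (QRD_hom R S) = vcomp R S"
  by (simp_all add: QRD_hom_def RD_hom_def full_sub_def RDl_hom_def)

lemma category_RD_hom: "\<lbrakk>rel_doctrine R; rel_doctrine S\<rbrakk> \<Longrightarrow> category (RD_hom R S)"
  unfolding RD_hom_def by (intro category_full_sub category_RDl_hom)

lemma category_QRD_hom: "\<lbrakk>rel_doctrine R; rel_doctrine S\<rbrakk> \<Longrightarrow> category (QRD_hom R S)"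
  unfolding QRD_hom_def by (intro category_full_sub category_RD_hom)

section \<open>The intensional quotient completion is a doctrine with quotients\<close>

lemma Q_simps [simp]:
  "(X, \<rho>) \<in> ob (base (Q R)) \<longleftrightarrow> X \<in> ob (base R) \<and> equiv_rel R X \<rho>"
  "f \<in> hom (base (Q R)) (X, \<rho>) (Y, \<sigma>) \<longleftrightarrow>
    f \<in> hom (base R) X Y \<and> le R X X \<rho> (reix R X X Y Y f f \<sigma>)"
  "ide (base (Q R)) (X, \<rho>) = ide (base R) X"
  "cmp (base (Q R)) (X, \<rho>) (Y, \<sigma>) (Z, \<tau>) = cmp (base R) X Y Z"
  "le (Q R) (X, \<rho>) (Y, \<sigma>) = le R X Y"
  "reix (Q R) (X, \<rho>) (Y, \<sigma>) (A, \<rho>') (B, \<sigma>') = reix R X Y A B"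
  "rid (Q R) (X, \<rho>) = \<rho>"
  "rcmp (Q R) (X, \<rho>) (Y, \<sigma>) (Z, \<tau>) = rcmp R X Y Z"
  "conv (Q R) (X, \<rho>) (Y, \<sigma>) = conv R X Y"
  by (simp_all add: Q_def Qbase_def)

context rel_doctrine
begin

text \<open>
  Since \<open>\<rho>\<close> is symmetric and both relations are reflexive, the single inequality that defines the
  fibre splits into invariance under each of them.
\<close>

lemma fibre_Q_iff:
  assumes X: "X \<in> ob (base R)" and Y: "Y \<in> ob (base R)"
    and \<rho>: "equiv_rel R X \<rho>" and \<sigma>: "equiv_rel R Y \<sigma>"
  shows "\<alpha> \<in> fibre (Q R) (X, \<rho>) (Y, \<sigma>) \<longleftrightarrow>
    \<alpha> \<in> fibre R X Y \<and> rcmp R X X Y \<rho> \<alpha> = \<alpha> \<and> rcmp R X Y Y \<alpha> \<sigma> = \<alpha>" (is "_ \<longleftrightarrow> ?R")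
proof
  note [simp] = X Y equiv_rel_fibre[OF \<rho>] equiv_rel_fibre[OF \<sigma>] equiv_rel_conv[OF X \<rho>]
  assume "\<alpha> \<in> fibre (Q R) (X, \<rho>) (Y, \<sigma>)"
  then have [simp]: "\<alpha> \<in> fibre R X Y"
    and le: "le R X Y (rcmp R X Y Y (rcmp R X X Y \<rho> \<alpha>) \<sigma>) \<alpha>"
    by (simp_all add: Q_def)
  have "le R X Y (rcmp R X X Y \<rho> \<alpha>) \<alpha>"
    by (rule le_tr[OF rcmp_equiv_right[OF X Y \<sigma>] le]) simp_all
  moreover have "le R X Y (rcmp R X Y Y \<alpha> \<sigma>) (rcmp R X Y Y (rcmp R X X Y \<rho> \<alpha>) \<sigma>)"
    by (rule rcmp_mono) (simp_all add: rcmp_equiv_left[OF X Y \<rho>] le_refl')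
  then have "le R X Y (rcmp R X Y Y \<alpha> \<sigma>) \<alpha>" by (rule le_tr[OF _ le]) simp_all
  ultimately show ?R
    using rcmp_equiv_left[OF X Y \<rho>] rcmp_equiv_right[OF X Y \<sigma>] by (auto intro: le_asym[of X Y])
next
  assume ?R
  then show "\<alpha> \<in> fibre (Q R) (X, \<rho>) (Y, \<sigma>)"
    using equiv_rel_conv[OF X \<rho>] X Y by (simp add: Q_def le_refl')
qed

lemma fibre_QI:
  assumes "X \<in> ob (base R)" "Y \<in> ob (base R)" "equiv_rel R X \<rho>" "equiv_rel R Y \<sigma>"
    "\<alpha> \<in> fibre R X Y" "le R X Y (rcmp R X X Y \<rho> \<alpha>) \<alpha>" "le R X Y (rcmp R X Y Y \<alpha> \<sigma>) \<alpha>"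
  shows "\<alpha> \<in> fibre (Q R) (X, \<rho>) (Y, \<sigma>)"
  using assms rcmp_equiv_left[of X Y \<rho> \<alpha>] rcmp_equiv_right[of X Y \<sigma> \<alpha>]
  by (simp add: fibre_Q_iff equiv_rel_fibre le_asym[of X Y])

lemma fibre_QD:
  assumes "\<alpha> \<in> fibre (Q R) (X, \<rho>) (Y, \<sigma>)" shows "\<alpha> \<in> fibre R X Y"
  using assms by (simp add: Q_def)

lemma fibre_Q_rid:
  assumes "X \<in> ob (base R)" "Y \<in> ob (base R)"
  shows "fibre (Q R) (X, rid R X) (Y, rid R Y) = fibre R X Y"
  using assms by (auto simp: fibre_Q_iff equiv_rel_rid)

lemma category_Qbase: "category (base (Q R))"
proof (unfold_locales, unfold split_paired_all)
  fix X \<rho> Y \<sigma> Z \<tau> f g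
  assume "(X, \<rho>) \<in> ob (base (Q R))" "(Y, \<sigma>) \<in> ob (base (Q R))" "(Z, \<tau>) \<in> ob (base (Q R))"
    "f \<in> hom (base (Q R)) (X, \<rho>) (Y, \<sigma>)" "g \<in> hom (base (Q R)) (Y, \<sigma>) (Z, \<tau>)"
  then have [simp]: "X \<in> ob (base R)" "Y \<in> ob (base R)" "Z \<in> ob (base R)"
    "f \<in> hom (base R) X Y" "g \<in> hom (base R) Y Z"
    "\<rho> \<in> fibre R X X" "\<sigma> \<in> fibre R Y Y" "\<tau> \<in> fibre R Z Z"
    and f: "le R X X \<rho> (reix R X X Y Y f f \<sigma>)" and g: "le R Y Y \<sigma> (reix R Y Y Z Z g g \<tau>)"
    by (simp_all add: equiv_rel_fibre)
  have "le R X X (reix R X X Y Y f f \<sigma>) (reix R X X Y Y f f (reix R Y Y Z Z g g \<tau>))"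
    by (rule reix_le[OF g]) simp_all
  from le_tr[OF f this]
  show "cmp (base (Q R)) (X, \<rho>) (Y, \<sigma>) (Z, \<tau>) g f \<in> hom (base (Q R)) (X, \<rho>) (Z, \<tau>)"
    by (simp add: reix_cmp)
qed (simp_all add: equiv_rel_fibre le_refl' base_cat.cmp_assoc)

lemma rel_doctrine_Q: "rel_doctrine (Q R)"
proof (intro rel_doctrine.intro rel_doctrine_axioms.intro category_Qbase; unfold split_paired_all Q_simps)
  fix X \<rho> Y \<sigma> A \<rho>' B \<sigma>' f g \<alpha>
  assume "X \<in> ob (base R) \<and> equiv_rel R X \<rho>" "Y \<in> ob (base R) \<and> equiv_rel R Y \<sigma>"
    "A \<in> ob (base R) \<and> equiv_rel R A \<rho>'" "B \<in> ob (base R) \<and> equiv_rel R B \<sigma>'"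
    "f \<in> hom (base R) X A \<and> le R X X \<rho> (reix R X X A A f f \<rho>')"
    "g \<in> hom (base R) Y B \<and> le R Y Y \<sigma> (reix R Y Y B B g g \<sigma>')"
    "\<alpha> \<in> fibre (Q R) (A, \<rho>') (B, \<sigma>')"
  then have [simp]: "X \<in> ob (base R)" "Y \<in> ob (base R)" "A \<in> ob (base R)" "B \<in> ob (base R)"
    "equiv_rel R X \<rho>" "equiv_rel R Y \<sigma>" "equiv_rel R A \<rho>'" "equiv_rel R B \<sigma>'"
    "\<rho> \<in> fibre R X X" "\<sigma> \<in> fibre R Y Y" "\<rho>' \<in> fibre R A A" "\<sigma>' \<in> fibre R B B"
    "f \<in> hom (base R) X A" "g \<in> hom (base R) Y B" "\<alpha> \<in> fibre R A B"
    and f: "le R X X \<rho> (reix R X X A A f f \<rho>')" and g: "le R Y Y \<sigma> (reix R Y Y B B g g \<sigma>')"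
    and \<alpha>: "rcmp R A A B \<rho>' \<alpha> = \<alpha>" "rcmp R A B B \<alpha> \<sigma>' = \<alpha>"
    by (auto simp: equiv_rel_fibre fibre_Q_iff)
  let ?\<alpha> = "reix R X Y A B f g \<alpha>"
  show "?\<alpha> \<in> fibre (Q R) (X, \<rho>) (Y, \<sigma>)"
  proof (rule fibre_QI)
    have "le R X Y (rcmp R X X Y \<rho> ?\<alpha>) (rcmp R X X Y (reix R X X A A f f \<rho>') ?\<alpha>)"
      by (rule rcmp_mono) (simp_all add: f le_refl')
    moreover have "le R X Y (rcmp R X X Y (reix R X X A A f f \<rho>') ?\<alpha>) ?\<alpha>"
      using rcmp_reix[of X X Y A A B f f g \<rho>' \<alpha>] by (simp add: \<alpha>)
    ultimately show "le R X Y (rcmp R X X Y \<rho> ?\<alpha>) ?\<alpha>" by (rule le_tr) simp_all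
    have "le R X Y (rcmp R X Y Y ?\<alpha> \<sigma>) (rcmp R X Y Y ?\<alpha> (reix R Y Y B B g g \<sigma>'))"
      by (rule rcmp_mono) (simp_all add: g le_refl')
    moreover have "le R X Y (rcmp R X Y Y ?\<alpha> (reix R Y Y B B g g \<sigma>')) ?\<alpha>"
      using rcmp_reix[of X Y Y A B B f g g \<alpha> \<sigma>'] by (simp add: \<alpha>)
    ultimately show "le R X Y (rcmp R X Y Y ?\<alpha> \<sigma>) ?\<alpha>" by (rule le_tr) simp_all
  qed simp_all
next
  fix X \<rho>
  assume *: "X \<in> ob (base R) \<and> equiv_rel R X \<rho>"
  then show "\<rho> \<in> fibre (Q R) (X, \<rho>) (X, \<rho>)"
    by (simp add: fibre_Q_iff equiv_rel_fibre rcmp_equiv_idem)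
next
  fix X \<rho> Y \<sigma> Z \<tau> \<alpha> \<beta>
  assume "X \<in> ob (base R) \<and> equiv_rel R X \<rho>" "Y \<in> ob (base R) \<and> equiv_rel R Y \<sigma>"
    "Z \<in> ob (base R) \<and> equiv_rel R Z \<tau>"
    "\<alpha> \<in> fibre (Q R) (X, \<rho>) (Y, \<sigma>)" "\<beta> \<in> fibre (Q R) (Y, \<sigma>) (Z, \<tau>)"
  then show "rcmp R X Y Z \<alpha> \<beta> \<in> fibre (Q R) (X, \<rho>) (Z, \<tau>)"
    using rcmp_assoc[of X X Y Z \<rho> \<alpha> \<beta>] rcmp_assoc[of X Y Z Z \<alpha> \<beta> \<tau>]
    by (simp add: fibre_Q_iff equiv_rel_fibre)
next
  fix X \<rho> Y \<sigma> \<alpha>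
  assume "X \<in> ob (base R) \<and> equiv_rel R X \<rho>" "Y \<in> ob (base R) \<and> equiv_rel R Y \<sigma>"
    "\<alpha> \<in> fibre (Q R) (X, \<rho>) (Y, \<sigma>)"
  then show "conv R X Y \<alpha> \<in> fibre (Q R) (Y, \<sigma>) (X, \<rho>)"
    using conv_rcmp[of X X Y \<rho> \<alpha>] conv_rcmp[of X Y Y \<alpha> \<sigma>]
    by (simp add: fibre_Q_iff equiv_rel_fibre equiv_rel_conv)
next
  fix X \<rho> Y \<sigma>
  assume "X \<in> ob (base R) \<and> equiv_rel R X \<rho>" "Y \<in> ob (base R) \<and> equiv_rel R Y \<sigma>"
  then have XY: "X \<in> ob (base R)" "Y \<in> ob (base R)" by auto
  show "reflp_on (fibre (Q R) (X, \<rho>) (Y, \<sigma>)) (le R X Y)"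
    using le_refl[OF XY] by (rule reflp_on_subset) (auto dest: fibre_QD)
  show "transp_on (fibre (Q R) (X, \<rho>) (Y, \<sigma>)) (le R X Y)"
    using le_trans[OF XY] by (rule transp_on_subset) (auto dest: fibre_QD)
  show "antisymp_on (fibre (Q R) (X, \<rho>) (Y, \<sigma>)) (le R X Y)"
    using le_antisym[OF XY] by (rule antisymp_on_subset) (auto dest: fibre_QD)
qed (auto dest!: fibre_QD simp: reix_cmp conv_rcmp rcmp_assoc fibre_Q_iff equiv_rel_conv
    intro!: monotone_onI intro: reix_le conv_le rcmp_mono rcmp_reix conv_reix)

text \<open>
  An equivalence relation coarser than \<open>\<rho>\<close> is automatically invariant under \<open>\<rho>\<close>, by transitivity.
\<close>

lemma equiv_rel_Q_iff:
  assumes X: "X \<in> ob (base R)" and \<rho>: "equiv_rel R X \<rho>"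
  shows "equiv_rel (Q R) (X, \<rho>) \<tau> \<longleftrightarrow> equiv_rel R X \<tau> \<and> le R X X \<rho> \<tau>"
proof
  note \<rho>' = equiv_rel_fibre[OF \<rho>]
  note [simp] = X \<rho>'
  assume \<tau>: "equiv_rel (Q R) (X, \<rho>) \<tau>"
  then have [simp]: "\<tau> \<in> fibre R X X" and "le R X X \<rho> \<tau>"
    by (auto simp: equiv_rel_def dest: fibre_QD)
  moreover have "le R X X (rid R X) \<tau>"
    using \<rho> by (intro le_tr[OF _ \<open>le R X X \<rho> \<tau>\<close>]) (simp_all add: equiv_rel_def)
  ultimately show "equiv_rel R X \<tau> \<and> le R X X \<rho> \<tau>" using \<tau> by (simp add: equiv_rel_def)
next
  assume \<tau>: "equiv_rel R X \<tau> \<and> le R X X \<rho> \<tau>"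
  then have t: "\<tau> \<in> fibre R X X" "equiv_rel R X \<tau>" "le R X X \<rho> \<tau>" by (simp_all add: equiv_rel_def)
  note [simp] = t(1) X equiv_rel_fibre[OF \<rho>]
  have "le R X X (rcmp R X X X \<rho> \<tau>) (rcmp R X X X \<tau> \<tau>)"
    by (rule rcmp_mono) (simp_all add: t le_refl')
  moreover have "le R X X (rcmp R X X X \<tau> \<rho>) (rcmp R X X X \<tau> \<tau>)"
    by (rule rcmp_mono) (simp_all add: t le_refl')
  ultimately have "\<tau> \<in> fibre (Q R) (X, \<rho>) (X, \<rho>)"
    by (intro fibre_QI) (simp_all add: rcmp_equiv_idem[OF X t(2)] \<rho>)
  then show "equiv_rel (Q R) (X, \<rho>) \<tau>" using \<tau> by (simp add: equiv_rel_def)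
qed

text \<open>
  In the completion the graph of the identity arrow \<open>(X, \<rho>) \<rightarrow> (X, \<tau>)\<close> is \<open>\<tau>\<close> itself, which gives
  effectiveness and descent at once. The universal property reads: an arrow of the base whose
  kernel contains \<open>\<tau>\<close> is the same thing as an arrow out of \<open>(X, \<tau>)\<close>. The case \<open>\<rho> = d\<^sub>X\<close> exhibits
  every object as a quotient of one in the image of the unit.
\<close>

lemma quotient_arrow_Q:
  assumes X: "X \<in> ob (base R)" and \<rho>: "equiv_rel R X \<rho>" and \<tau>: "equiv_rel R X \<tau>"
    and le: "le R X X \<rho> \<tau>"
  shows "ide (base R) X \<in> hom (base (Q R)) (X, \<rho>) (X, \<tau>)"
    and "graph (Q R) (X, \<rho>) (X, \<tau>) (ide (base R) X) = \<tau>"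
    and "quotient_arrow (Q R) (X, \<rho>) \<tau> (X, \<tau>) (ide (base R) X)"
    and "effective (Q R) (X, \<rho>) \<tau> (X, \<tau>) (ide (base R) X)"
    and "descent (Q R) (X, \<rho>) (X, \<tau>) (ide (base R) X)"
proof -
  interpret QR: rel_doctrine "Q R" by (rule rel_doctrine_Q)
  note [simp] = X \<rho> \<tau> equiv_rel_fibre[OF \<rho>] equiv_rel_fibre[OF \<tau>] equiv_rel_conv[OF X \<tau>]
    rcmp_equiv_idem[OF X \<tau>]
  show graph: "graph (Q R) (X, \<rho>) (X, \<tau>) (ide (base R) X) = \<tau>"
    by (simp add: graph_def)
  show id: "ide (base R) X \<in> hom (base (Q R)) (X, \<rho>) (X, \<tau>)" using le by simp
  have ker: "kernel (Q R) (X, \<rho>) (X, \<tau>) (ide (base R) X) = \<tau>"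
    by (simp add: kernel_def graph)
  show "effective (Q R) (X, \<rho>) \<tau> (X, \<tau>) (ide (base R) X)"
    by (simp add: effective_def ker)
  show "descent (Q R) (X, \<rho>) (X, \<tau>) (ide (base R) X)"
    by (simp add: descent_def graph le_refl')
  show "quotient_arrow (Q R) (X, \<rho>) \<tau> (X, \<tau>) (ide (base R) X)"
    unfolding quotient_arrow_def
  proof (intro conjI ballI impI, goal_cases)
    case (4 Z' f)
    obtain Z \<zeta> where Z': "Z' = (Z, \<zeta>)" by (cases Z')
    have f: "f \<in> hom (base R) X Z" and Z[simp]: "Z \<in> ob (base R)" "equiv_rel R Z \<zeta>"
      using 4 by (simp_all add: Z')
    have "kernel (Q R) (X, \<rho>) (Z, \<zeta>) f = reix R X X Z Z f f \<zeta>"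
      using QR.kernel_eq_reix[of "(X, \<rho>)" "(Z, \<zeta>)" f] 4 by (simp add: Z')
    then show ?case
      using 4 f unfolding Z' by (intro ex1I[of _ f]) simp_all
  qed (use id in \<open>simp_all add: ker le_refl'\<close>)
qed

lemma has_quotients_Q: "has_quotients (Q R)"
  unfolding has_quotients_def
proof (intro ballI allI impI)
  fix Z \<tau> assume Z: "Z \<in> ob (base (Q R))" and \<tau>: "equiv_rel (Q R) Z \<tau>"
  obtain X \<rho> where [simp]: "Z = (X, \<rho>)" by (cases Z)
  have "X \<in> ob (base R)" "equiv_rel R X \<rho>" "equiv_rel R X \<tau>" "le R X X \<rho> \<tau>"
    using Z \<tau> by (auto simp: equiv_rel_Q_iff)
  from quotient_arrow_Q[OF this]
  show "\<exists>W q. quotient_arrow (Q R) Z \<tau> W q \<and> effective (Q R) Z \<tau> W q \<and> descent (Q R) Z W q"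
    by auto
qed

end

section \<open>The quotient completion as a 2-functor\<close>

lemma Qbase_eq: "Qbase R = base (Q R)"
  by (simp add: Q_def)

lemma Q_one_sel [simp]:
  "\<lbrakk>X \<in> ob (base R); equiv_rel R X \<rho>\<rbrakk> \<Longrightarrow> fob (Q_one R F) (X, \<rho>) = (fob F X, frel F X X \<rho>)"
  "\<lbrakk>X \<in> ob (base R); equiv_rel R X \<rho>; Y \<in> ob (base R); equiv_rel R Y \<sigma>;
    f \<in> hom (base R) X Y; le R X X \<rho> (reix R X X Y Y f f \<sigma>)\<rbrakk> \<Longrightarrow>
    far (Q_one R F) (X, \<rho>) (Y, \<sigma>) f = far F X Y f"
  "\<lbrakk>X \<in> ob (base R); equiv_rel R X \<rho>; Y \<in> ob (base R); equiv_rel R Y \<sigma>;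
    \<alpha> \<in> fibre (Q R) (X, \<rho>) (Y, \<sigma>)\<rbrakk> \<Longrightarrow>
    frel (Q_one R F) (X, \<rho>) (Y, \<sigma>) \<alpha> = frel F X Y \<alpha>"
  by (simp_all add: Q_one_def Qbase_eq)

lemma Q_two_sel [simp]:
  "\<lbrakk>X \<in> ob (base R); equiv_rel R X \<rho>\<rbrakk> \<Longrightarrow> Q_two R \<theta> (X, \<rho>) = \<theta> X"
  by (simp add: Q_two_def Qbase_eq)

context lax_one_arrow
begin

lemma frel_hom_Q:
  assumes "X \<in> ob (base R)" "equiv_rel R X \<rho>" "Y \<in> ob (base R)" "equiv_rel R Y \<sigma>"
    "f \<in> hom (base R) X Y" "le R X X \<rho> (reix R X X Y Y f f \<sigma>)"
  shows "le S (fob F X) (fob F X) (frel F X X \<rho>)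
    (reix S (fob F X) (fob F X) (fob F Y) (fob F Y) (far F X Y f) (far F X Y f) (frel F Y Y \<sigma>))"
  using frel_le[OF assms(6)] assms by (simp add: R.equiv_rel_fibre frel_reix)

end

context strict_one_arrow
begin

lemma frel_fibre_Q:
  assumes "X \<in> ob (base R)" "equiv_rel R X \<rho>" "Y \<in> ob (base R)" "equiv_rel R Y \<sigma>"
    "\<alpha> \<in> fibre (Q R) (X, \<rho>) (Y, \<sigma>)"
  shows "frel F X Y \<alpha> \<in> fibre (Q S) (fob F X, frel F X X \<rho>) (fob F Y, frel F Y Y \<sigma>)"
  using assms
  by (simp add: S.fibre_Q_iff R.fibre_Q_iff equiv_rel_frel R.equiv_rel_fibre frel_rcmp[symmetric])

lemma is_functor_Q_one: "is_functor (base (Q R)) (base (Q S)) (Q_one R F)"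
proof (rule is_functorI, unfold split_paired_all)
  fix X \<rho> Y \<sigma> Z \<tau> f g
  assume *: "(X, \<rho>) \<in> ob (base (Q R))" "(Y, \<sigma>) \<in> ob (base (Q R))" "(Z, \<tau>) \<in> ob (base (Q R))"
    "f \<in> hom (base (Q R)) (X, \<rho>) (Y, \<sigma>)" "g \<in> hom (base (Q R)) (Y, \<sigma>) (Z, \<tau>)"
  have "cmp (base (Q R)) (X, \<rho>) (Y, \<sigma>) (Z, \<tau>) g f \<in> hom (base (Q R)) (X, \<rho>) (Z, \<tau>)"
    by (rule category.cmp_hom[OF R.category_Qbase *])
  then show "far (Q_one R F) (X, \<rho>) (Z, \<tau>) (cmp (base (Q R)) (X, \<rho>) (Y, \<sigma>) (Z, \<tau>) g f) =
    cmp (base (Q S)) (fob (Q_one R F) (X, \<rho>)) (fob (Q_one R F) (Y, \<sigma>)) (fob (Q_one R F) (Z, \<tau>))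
      (far (Q_one R F) (Y, \<sigma>) (Z, \<tau>) g) (far (Q_one R F) (X, \<rho>) (Y, \<sigma>) f)"
    using * by (simp add: far_cmp)
next
  fix X \<rho> assume "(X, \<rho>) \<in> ob (base (Q R))"
  then show "far (Q_one R F) (X, \<rho>) (X, \<rho>) (ide (base (Q R)) (X, \<rho>)) =
      ide (base (Q S)) (fob (Q_one R F) (X, \<rho>))"
    by (simp add: R.equiv_rel_fibre R.le_refl')
qed (auto simp: equiv_rel_frel frel_hom_Q, auto simp: Q_one_def Qbase_eq)

lemma lax_arrow_Q_one: "lax_arrow (Q R) (Q S) (Q_one R F)"
proof (rule lax_arrowI, unfold split_paired_all)
  interpret QR: rel_doctrine "Q R" by (rule R.rel_doctrine_Q)
  interpret QS: rel_doctrine "Q S" by (rule S.rel_doctrine_Q)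
  show "is_functor (base (Q R)) (base (Q S)) (Q_one R F)" by (rule is_functor_Q_one)
  show "frel (Q_one R F) \<in> (\<Pi>\<^sub>E X \<in> ob (base (Q R)). \<Pi>\<^sub>E Y \<in> ob (base (Q R)).
      fibre (Q R) X Y \<rightarrow>\<^sub>E fibre (Q S) (fob (Q_one R F) X) (fob (Q_one R F) Y))"
    by (auto simp: Q_one_def Qbase_eq frel_fibre_Q)
  {
    fix X \<rho> Y \<sigma> A \<rho>' B \<sigma>' f g \<alpha>
    assume *: "(X, \<rho>) \<in> ob (base (Q R))" "(Y, \<sigma>) \<in> ob (base (Q R))"
      "(A, \<rho>') \<in> ob (base (Q R))" "(B, \<sigma>') \<in> ob (base (Q R))"
      "f \<in> hom (base (Q R)) (X, \<rho>) (A, \<rho>')" "g \<in> hom (base (Q R)) (Y, \<sigma>) (B, \<sigma>')"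
      "\<alpha> \<in> fibre (Q R) (A, \<rho>') (B, \<sigma>')"
    show "frel (Q_one R F) (X, \<rho>) (Y, \<sigma>) (reix (Q R) (X, \<rho>) (Y, \<sigma>) (A, \<rho>') (B, \<sigma>') f g \<alpha>) =
      reix (Q S) (fob (Q_one R F) (X, \<rho>)) (fob (Q_one R F) (Y, \<sigma>)) (fob (Q_one R F) (A, \<rho>'))
        (fob (Q_one R F) (B, \<sigma>')) (far (Q_one R F) (X, \<rho>) (A, \<rho>') f)
        (far (Q_one R F) (Y, \<sigma>) (B, \<sigma>') g) (frel (Q_one R F) (A, \<rho>') (B, \<sigma>') \<alpha>)"
      using QR.reix_fibre[OF *] * R.fibre_QD[OF *(7)] by (simp add: frel_reix)
  next
    fix X \<rho> Y \<sigma> Z \<tau> \<alpha> \<beta>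
    assume *: "(X, \<rho>) \<in> ob (base (Q R))" "(Y, \<sigma>) \<in> ob (base (Q R))" "(Z, \<tau>) \<in> ob (base (Q R))"
      "\<alpha> \<in> fibre (Q R) (X, \<rho>) (Y, \<sigma>)" "\<beta> \<in> fibre (Q R) (Y, \<sigma>) (Z, \<tau>)"
    show "le (Q S) (fob (Q_one R F) (X, \<rho>)) (fob (Q_one R F) (Z, \<tau>))
      (rcmp (Q S) (fob (Q_one R F) (X, \<rho>)) (fob (Q_one R F) (Y, \<sigma>)) (fob (Q_one R F) (Z, \<tau>))
        (frel (Q_one R F) (X, \<rho>) (Y, \<sigma>) \<alpha>) (frel (Q_one R F) (Y, \<sigma>) (Z, \<tau>) \<beta>))
      (frel (Q_one R F) (X, \<rho>) (Z, \<tau>) (rcmp (Q R) (X, \<rho>) (Y, \<sigma>) (Z, \<tau>) \<alpha> \<beta>))"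
      using QR.rcmp_fibre[OF *] * R.fibre_QD[OF *(4)] R.fibre_QD[OF *(5)] by (simp add: frel_rcmp_le)
  next
    fix X \<rho> Y \<sigma> \<alpha>
    assume *: "(X, \<rho>) \<in> ob (base (Q R))" "(Y, \<sigma>) \<in> ob (base (Q R))" "\<alpha> \<in> fibre (Q R) (X, \<rho>) (Y, \<sigma>)"
    show "le (Q S) (fob (Q_one R F) (Y, \<sigma>)) (fob (Q_one R F) (X, \<rho>))
      (conv (Q S) (fob (Q_one R F) (X, \<rho>)) (fob (Q_one R F) (Y, \<sigma>)) (frel (Q_one R F) (X, \<rho>) (Y, \<sigma>) \<alpha>))
      (frel (Q_one R F) (Y, \<sigma>) (X, \<rho>) (conv (Q R) (X, \<rho>) (Y, \<sigma>) \<alpha>))"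
      using QR.conv_fibre[OF *] * R.fibre_QD[OF *(3)] by (simp add: frel_conv_le)
  next
    fix X \<rho>
    assume *: "(X, \<rho>) \<in> ob (base (Q R))"
    show "le (Q S) (fob (Q_one R F) (X, \<rho>)) (fob (Q_one R F) (X, \<rho>)) (rid (Q S) (fob (Q_one R F) (X, \<rho>)))
      (frel (Q_one R F) (X, \<rho>) (X, \<rho>) (rid (Q R) (X, \<rho>)))"
      using * QR.rid_fibre[OF *] by (simp add: R.equiv_rel_fibre S.le_refl')
  }
qed (auto intro!: frel_le dest: R.fibre_QD)

lemma strict_arrow_Q_one: "strict_arrow (Q R) (Q S) (Q_one R F)"
proof (rule strict_arrowI, unfold split_paired_all)
  interpret QR: rel_doctrine "Q R" by (rule R.rel_doctrine_Q)
  {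
    fix X \<rho> assume *: "(X, \<rho>) \<in> ob (base (Q R))"
    show "rid (Q S) (fob (Q_one R F) (X, \<rho>)) = frel (Q_one R F) (X, \<rho>) (X, \<rho>) (rid (Q R) (X, \<rho>))"
      using * QR.rid_fibre[OF *] by simp
  next
    fix X \<rho> Y \<sigma> Z \<tau> \<alpha> \<beta>
    assume *: "(X, \<rho>) \<in> ob (base (Q R))" "(Y, \<sigma>) \<in> ob (base (Q R))" "(Z, \<tau>) \<in> ob (base (Q R))"
      "\<alpha> \<in> fibre (Q R) (X, \<rho>) (Y, \<sigma>)" "\<beta> \<in> fibre (Q R) (Y, \<sigma>) (Z, \<tau>)"
    show "rcmp (Q S) (fob (Q_one R F) (X, \<rho>)) (fob (Q_one R F) (Y, \<sigma>)) (fob (Q_one R F) (Z, \<tau>))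
        (frel (Q_one R F) (X, \<rho>) (Y, \<sigma>) \<alpha>) (frel (Q_one R F) (Y, \<sigma>) (Z, \<tau>) \<beta>) =
      frel (Q_one R F) (X, \<rho>) (Z, \<tau>) (rcmp (Q R) (X, \<rho>) (Y, \<sigma>) (Z, \<tau>) \<alpha> \<beta>)"
      using QR.rcmp_fibre[OF *] * R.fibre_QD[OF *(4)] R.fibre_QD[OF *(5)] by (simp add: frel_rcmp)
  }
qed

text \<open>
  The canonical quotient arrows of the completion are identities of the base, which every functor
  preserves.
\<close>

lemma preserves_quotients_Q_one: "preserves_quotients (Q R) (Q S) (Q_one R F)"
proof (rule lax_one_arrow.preserves_quotientsI)
  show "lax_one_arrow (Q R) (Q S) (Q_one R F)"
    by (intro lax_one_arrowI R.rel_doctrine_Q S.rel_doctrine_Q lax_arrow_Q_one)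
  fix Z \<tau> assume Z: "Z \<in> ob (base (Q R))" and \<tau>: "equiv_rel (Q R) Z \<tau>"
  obtain X \<rho> where [simp]: "Z = (X, \<rho>)" by (cases Z)
  have *: "X \<in> ob (base R)" "equiv_rel R X \<rho>" "equiv_rel R X \<tau>" "le R X X \<rho> \<tau>"
    using Z \<tau> by (auto simp: R.equiv_rel_Q_iff)
  have **: "\<tau> \<in> fibre (Q R) (X, \<rho>) (X, \<rho>)" using \<tau> by (simp add: equiv_rel_def)
  have "quotient_arrow (Q S) (fob F X, frel F X X \<rho>) (frel F X X \<tau>) (fob F X, frel F X X \<tau>)
      (ide (base S) (fob F X))"
    using * by (intro S.quotient_arrow_Q) (simp_all add: equiv_rel_frel frel_le R.equiv_rel_fibre)
  then have "quotient_arrow (Q S) (fob (Q_one R F) Z) (frel (Q_one R F) Z Z \<tau>)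
      (fob (Q_one R F) (X, \<tau>)) (far (Q_one R F) Z (X, \<tau>) (ide (base R) X))"
    using * ** by (simp add: R.equiv_rel_fibre)
  then show "\<exists>W q. quotient_arrow (Q R) Z \<tau> W q \<and>
      quotient_arrow (Q S) (fob (Q_one R F) Z) (frel (Q_one R F) Z Z \<tau>)
        (fob (Q_one R F) W) (far (Q_one R F) Z W q)"
    using R.quotient_arrow_Q(3)[OF *] by auto
qed

end

lemma two_arrow_Q_two:
  assumes "rel_doctrine R" "rel_doctrine S" "lax_arrow R S F" "lax_arrow R S G"
    and \<theta>: "two_arrow R S F G \<theta>"
  shows "two_arrow (Q R) (Q S) (Q_one R F) (Q_one R G) (Q_two R \<theta>)"
proof -
  interpret F: lax_one_arrow R S F using assms by (intro lax_one_arrowI)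
  interpret G: lax_one_arrow R S G using assms by (intro lax_one_arrowI)
  show ?thesis
  proof (rule two_arrowI, unfold split_paired_all)
    fix X \<rho> assume "(X, \<rho>) \<in> ob (base (Q R))"
    then show "Q_two R \<theta> (X, \<rho>) \<in> hom (base (Q S)) (fob (Q_one R F) (X, \<rho>)) (fob (Q_one R G) (X, \<rho>))"
      using two_arrow_hom[OF \<theta>] two_arrow_le[OF \<theta>] by (simp add: F.R.equiv_rel_fibre)
  qed (auto simp: Q_two_def Qbase_eq two_arrow_natural[OF \<theta>] intro!: two_arrow_le[OF \<theta>]
      dest: F.R.fibre_QD)
qed

text \<open>
  Both sides are functions on pairs with the default value outside the objects of the completion,
  so comparison on those objects suffices.
\<close>

lemma Q_two_eqI:
  assumes "\<phi> \<in> extensional (ob (base (Q R)))"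
    and "\<And>X \<rho>. \<lbrakk>X \<in> ob (base R); equiv_rel R X \<rho>\<rbrakk> \<Longrightarrow> \<phi> (X, \<rho>) = \<theta> X"
  shows "Q_two R \<theta> = \<phi>"
proof
  fix P :: "'a \<times> 'b"
  show "Q_two R \<theta> P = \<phi> P"
    using assms by (cases P; cases "P \<in> ob (base (Q R))") (auto simp: Q_two_def Qbase_eq extensional_def)
qed

lemma Q_two_id_two:
  assumes "lax_one_arrow R S F"
  shows "Q_two R (id_two R S F) = id_two (Q R) (Q S) (Q_one R F)"
  by (rule Q_two_eqI) (simp_all add: id_two_def)

lemma Q_two_vcomp: "Q_two R (vcomp R S F G H \<phi> \<theta>) =
    vcomp (Q R) (Q S) (Q_one R F) (Q_one R G) (Q_one R H) (Q_two R \<phi>) (Q_two R \<theta>)"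
  by (rule Q_two_eqI) (simp_all add: vcomp_def)

lemma is_functor_Q_hom:
  assumes R: "rel_doctrine R" and S: "rel_doctrine S"
  shows "is_functor (RD_hom R S) (QRD_hom (Q R) (Q S)) (Q_hom R (RD_hom R S))"
proof -
  interpret RD: category "RD_hom R S" by (rule category_RD_hom[OF assms])
  have sel [simp]: "fob (Q_hom R (RD_hom R S)) F = Q_one R F" if "F \<in> ob (RD_hom R S)" for F
    using that by (simp add: Q_hom_def)
  have sel2 [simp]: "far (Q_hom R (RD_hom R S)) F G \<theta> = Q_two R \<theta>"
    if "F \<in> ob (RD_hom R S)" "G \<in> ob (RD_hom R S)" "\<theta> \<in> hom (RD_hom R S) F G" for F G \<theta>
    using that by (simp add: Q_hom_def)
  show ?thesis
  proof (rule is_functorI)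
    fix F assume F: "F \<in> ob (RD_hom R S)"
    then interpret F: strict_one_arrow R S F using assms by (intro strict_one_arrowI) simp_all
    show "fob (Q_hom R (RD_hom R S)) F \<in> ob (QRD_hom (Q R) (Q S))"
      using F F.lax_arrow_Q_one F.strict_arrow_Q_one F.preserves_quotients_Q_one by simp
    show "far (Q_hom R (RD_hom R S)) F F (ide (RD_hom R S) F) =
        ide (QRD_hom (Q R) (Q S)) (fob (Q_hom R (RD_hom R S)) F)"
      using sel2[OF F F RD.ide_hom[OF F]] sel[OF F] Q_two_id_two[OF F.lax_one_arrow_axioms] by simp
  next
    fix F G \<theta>
    assume "F \<in> ob (RD_hom R S)" "G \<in> ob (RD_hom R S)" "\<theta> \<in> hom (RD_hom R S) F G"
    then show "far (Q_hom R (RD_hom R S)) F G \<theta> \<in>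
        hom (QRD_hom (Q R) (Q S)) (fob (Q_hom R (RD_hom R S)) F) (fob (Q_hom R (RD_hom R S)) G)"
      using two_arrow_Q_two[OF R S, of F G \<theta>] by simp
  next
    fix F G H \<theta> \<phi>
    assume *: "F \<in> ob (RD_hom R S)" "G \<in> ob (RD_hom R S)" "H \<in> ob (RD_hom R S)"
      "\<theta> \<in> hom (RD_hom R S) F G" "\<phi> \<in> hom (RD_hom R S) G H"
    from RD.cmp_hom[OF this] this
    show "far (Q_hom R (RD_hom R S)) F H (cmp (RD_hom R S) F G H \<phi> \<theta>) =
      cmp (QRD_hom (Q R) (Q S)) (fob (Q_hom R (RD_hom R S)) F) (fob (Q_hom R (RD_hom R S)) G)
        (fob (Q_hom R (RD_hom R S)) H) (far (Q_hom R (RD_hom R S)) G H \<phi>)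
        (far (Q_hom R (RD_hom R S)) F G \<theta>)"
      by (simp add: Q_two_vcomp)
  qed (auto simp: Q_hom_def)
qed

lemma id_one_sel [simp]:
  "X \<in> ob (base R) \<Longrightarrow> fob (id_one R) X = X"
  "\<lbrakk>X \<in> ob (base R); Y \<in> ob (base R); f \<in> hom (base R) X Y\<rbrakk> \<Longrightarrow> far (id_one R) X Y f = f"
  "\<lbrakk>X \<in> ob (base R); Y \<in> ob (base R); \<alpha> \<in> fibre R X Y\<rbrakk> \<Longrightarrow> frel (id_one R) X Y \<alpha> = \<alpha>"
  by (simp_all add: id_one_def id_functor_def)

lemma (in rel_doctrine) lax_arrow_id_one: "lax_arrow R R (id_one R)"
  by (rule lax_arrowI, rule is_functorI) (simp_all add: le_refl', auto simp: id_one_def id_functor_def)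

lemma (in rel_doctrine) strict_arrow_id_one: "strict_arrow R R (id_one R)"
  by (rule strict_arrowI) simp_all

lemma Q_one_id_one:
  assumes "rel_doctrine R"
  shows "Q_one R (id_one R) = id_one (Q R)"
proof -
  interpret R: rel_doctrine R by fact
  interpret QR: rel_doctrine "Q R" by (rule R.rel_doctrine_Q)
  interpret I: strict_one_arrow R R "id_one R"
    by (intro strict_one_arrowI assms R.lax_arrow_id_one R.strict_arrow_id_one)
  show ?thesis
    by (rule onearr_eqI[OF I.lax_arrow_Q_one QR.lax_arrow_id_one], unfold split_paired_all)
      (auto simp: R.equiv_rel_fibre dest: R.fibre_QD)
qed

lemma Q_one_comp_one:
  assumes "strict_one_arrow R R' F" and "strict_one_arrow R' R'' G"
  shows "Q_one R (comp_one R G F) = comp_one (Q R) (Q_one R' G) (Q_one R F)"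
proof -
  interpret F: strict_one_arrow R R' F by fact
  interpret G: strict_one_arrow R' R'' G by fact
  note GF = strict_arrow_comp_one[OF F.lax F.strict G.lax G.strict F.R.rel_doctrine_axioms
      F.S.rel_doctrine_axioms G.S.rel_doctrine_axioms]
  interpret GF: strict_one_arrow R R'' "comp_one R G F"
    by (intro strict_one_arrowI F.R.rel_doctrine_axioms G.S.rel_doctrine_axioms GF)
  note QGF = strict_arrow_comp_one[OF F.lax_arrow_Q_one F.strict_arrow_Q_one
      G.lax_arrow_Q_one G.strict_arrow_Q_one F.R.rel_doctrine_Q F.S.rel_doctrine_Q G.S.rel_doctrine_Q]
  show ?thesis
    by (rule onearr_eqI[OF GF.lax_arrow_Q_one QGF(1)], unfold split_paired_all)
      (auto simp: F.R.equiv_rel_fibre F.equiv_rel_frel F.frel_hom_Q F.frel_fibre_Q dest: F.R.fibre_QD)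
qed

lemma Q_two_hcomp:
  assumes "strict_one_arrow R R' F" "strict_one_arrow R R' G"
    and \<theta>: "two_arrow R R' F G \<theta>"
  shows "Q_two R (hcomp R R'' H K F G \<phi> \<theta>) =
    hcomp (Q R) (Q R'') (Q_one R' H) (Q_one R' K) (Q_one R F) (Q_one R G) (Q_two R' \<phi>) (Q_two R \<theta>)"
proof -
  interpret F: strict_one_arrow R R' F by fact
  interpret G: strict_one_arrow R R' G by fact
  show ?thesis
    by (rule Q_two_eqI)
      (simp_all add: hcomp_def F.equiv_rel_frel G.equiv_rel_frel two_arrow_hom[OF \<theta>]
        two_arrow_le[OF \<theta>] F.R.equiv_rel_fibre)
qed

section \<open>The unit\<close>

lemma E_sel [simp]:
  "X \<in> ob (base R) \<Longrightarrow> fob (E R) X = (X, rid R X)"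
  "\<lbrakk>X \<in> ob (base R); Y \<in> ob (base R); f \<in> hom (base R) X Y\<rbrakk> \<Longrightarrow> far (E R) X Y f = f"
  "\<lbrakk>X \<in> ob (base R); Y \<in> ob (base R); \<alpha> \<in> fibre R X Y\<rbrakk> \<Longrightarrow> frel (E R) X Y \<alpha> = \<alpha>"
  by (simp_all add: E_def)

context rel_doctrine
begin

lemma strict_arrow_E: "lax_arrow R (Q R) (E R)" "strict_arrow R (Q R) (E R)"
proof -
  show "lax_arrow R (Q R) (E R)"
  proof (rule lax_arrowI)
    show "is_functor (base R) (base (Q R)) (E R)"
      by (rule is_functorI) (simp_all add: equiv_rel_rid rid_reix, simp_all add: E_def)
    show "frel (E R) \<in> (\<Pi>\<^sub>E X \<in> ob (base R). \<Pi>\<^sub>E Y \<in> ob (base R).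
      fibre R X Y \<rightarrow>\<^sub>E fibre (Q R) (fob (E R) X) (fob (E R) Y))"
      by (auto simp: E_def fibre_Q_rid)
  qed (simp_all add: le_refl')
  show "strict_arrow R (Q R) (E R)"
    by (rule strict_arrowI) simp_all
qed

end

lemma Q_one_E:
  assumes "strict_one_arrow R R' F"
  shows "comp_one R (Q_one R F) (E R) = comp_one R (E R') F"
proof -
  interpret F: strict_one_arrow R R' F by fact
  note 1 = strict_arrow_comp_one(1)[OF F.R.strict_arrow_E F.lax_arrow_Q_one F.strict_arrow_Q_one
      F.R.rel_doctrine_axioms F.R.rel_doctrine_Q F.S.rel_doctrine_Q]
  note 2 = strict_arrow_comp_one(1)[OF F.lax F.strict F.S.strict_arrow_E
      F.R.rel_doctrine_axioms F.S.rel_doctrine_axioms F.S.rel_doctrine_Q]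
  show ?thesis
    by (rule onearr_eqI[OF 1 2])
      (simp_all add: F.R.equiv_rel_rid F.R.rid_reix F.R.fibre_Q_rid)
qed

text \<open>
  Whiskering with the unit restricts a 2-arrow to the objects \<open>(X, d\<^sub>X)\<close>.
\<close>

lemma hcomp_E:
  assumes "rel_doctrine R" "rel_doctrine S" and F: "lax_arrow (Q R) S F"
    and \<theta>: "two_arrow (Q R) S F G \<theta>" and "lax_arrow (Q R) S G"
  shows "hcomp R S F G (E R) (E R) \<theta> (id_two R (Q R) (E R)) = (\<lambda>X\<in>ob (base R). \<theta> (X, rid R X))"
proof -
  interpret R: rel_doctrine R by fact
  interpret F: lax_one_arrow "Q R" S F using assms by (intro lax_one_arrowI R.rel_doctrine_Q)
  interpret G: lax_one_arrow "Q R" S G using assms by (intro lax_one_arrowI R.rel_doctrine_Q)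
  show ?thesis
    unfolding hcomp_def
  proof (rule restrict_ext)
    fix X assume X: "X \<in> ob (base R)"
    then have X': "(X, rid R X) \<in> ob (base (Q R))" by (simp add: R.equiv_rel_rid)
    show "cmp (base S) (fob F (fob (E R) X)) (fob F (fob (E R) X)) (fob G (fob (E R) X))
        (\<theta> (fob (E R) X)) (far F (fob (E R) X) (fob (E R) X) (id_two R (Q R) (E R) X)) =
      \<theta> (X, rid R X)"
      using X X' F.far_ide[OF X'] two_arrow_hom[OF \<theta> X'] F.fob_ob[OF X'] G.fob_ob[OF X']
      by (simp add: id_two_def del: Q_simps F.far_ide)
  qed
qed

lemma Q_two_E:
  assumes "strict_one_arrow R R' F" "strict_one_arrow R R' G"
    and \<theta>: "two_arrow R R' F G \<theta>"
  shows "hcomp R (Q R') (Q_one R F) (Q_one R G) (E R) (E R) (Q_two R \<theta>) (id_two R (Q R) (E R)) =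
    hcomp R (Q R') (E R') (E R') F G (id_two R' (Q R') (E R')) \<theta>"
proof -
  interpret F: strict_one_arrow R R' F by fact
  interpret G: strict_one_arrow R R' G by fact
  have "hcomp R (Q R') (E R') (E R') F G (id_two R' (Q R') (E R')) \<theta> =
      (\<lambda>X\<in>ob (base R). Q_two R \<theta> (X, rid R X))"
    unfolding hcomp_def
    by (rule restrict_ext) (simp add: id_two_def F.R.equiv_rel_rid two_arrow_hom[OF \<theta>])
  also have "\<dots> = hcomp R (Q R') (Q_one R F) (Q_one R G) (E R) (E R) (Q_two R \<theta>)
      (id_two R (Q R) (E R))"
    by (rule hcomp_E[symmetric])
      (simp_all add: F.R.rel_doctrine_axioms F.S.rel_doctrine_Q F.lax_arrow_Q_one G.lax_arrow_Q_one
        two_arrow_Q_two[OF F.R.rel_doctrine_axioms F.S.rel_doctrine_axioms F.lax G.lax \<theta>])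
  finally show ?thesis ..
qed

section \<open>Extending a strict 1-arrow along the unit\<close>

lemma (in rel_doctrine) quotient_arrow_ide:
  assumes [simp]: "X \<in> ob (base R)"
  shows "quotient_arrow R X (rid R X) X (ide (base R) X)"
    and "effective R X (rid R X) X (ide (base R) X)"
    and "descent R X X (ide (base R) X)"
proof -
  have gr: "graph R X X (ide (base R) X) = rid R X" by (simp add: graph_def)
  have ker: "kernel R X X (ide (base R) X) = rid R X" by (simp add: kernel_def gr)
  show "effective R X (rid R X) X (ide (base R) X)" by (simp add: effective_def ker)
  show "descent R X X (ide (base R) X)" by (simp add: descent_def gr le_refl')
  show "quotient_arrow R X (rid R X) X (ide (base R) X)"
    unfolding quotient_arrow_def by (auto simp: ker le_refl')
qed

locale strict_into_quotients = strict_one_arrow R S F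
  for R :: "('o, 'a, 'r) rdoc" and S :: "('p, 'b, 's) rdoc"
    and F :: "('o, 'a, 'p, 'b, 'r, 's) onearr" +
  assumes quotients: "has_quotients S"
begin

text \<open>
  An effective descent quotient arrow of \<open>F \<rho>\<close>. The last conjunct is what makes the extension restrict
  to \<open>F\<close> exactly; it can be met because \<open>F\<close> sends \<open>d\<^sub>X\<close> to \<open>d\<^bsub>F X\<^esub>\<close>, of which the identity is an
  effective descent quotient arrow.
\<close>

definition chosen :: "'o \<Rightarrow> 'r \<Rightarrow> 'p \<times> 'b" where
  "chosen X \<rho> = (SOME (W, q).
    quotient_arrow S (fob F X) (frel F X X \<rho>) W q \<and>
    effective S (fob F X) (frel F X X \<rho>) W q \<and> descent S (fob F X) W q \<and>
    (\<rho> = rid R X \<longrightarrow> W = fob F X \<and> q = ide (base S) (fob F X)))"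

definition quo :: "'o \<Rightarrow> 'r \<Rightarrow> 'p" where "quo X \<rho> = fst (chosen X \<rho>)"
definition prj :: "'o \<Rightarrow> 'r \<Rightarrow> 'b" where "prj X \<rho> = snd (chosen X \<rho>)"

lemma chosen:
  assumes X: "X \<in> ob (base R)" and \<rho>: "equiv_rel R X \<rho>"
  shows quotient_prj: "quotient_arrow S (fob F X) (frel F X X \<rho>) (quo X \<rho>) (prj X \<rho>)"
    and kernel_prj: "kernel S (fob F X) (quo X \<rho>) (prj X \<rho>) = frel F X X \<rho>"
    and descent_prj: "descent S (fob F X) (quo X \<rho>) (prj X \<rho>)"
    and quo_ob: "quo X \<rho> \<in> ob (base S)"
    and prj_hom: "prj X \<rho> \<in> hom (base S) (fob F X) (quo X \<rho>)"
    and quo_rid: "\<rho> = rid R X \<Longrightarrow> quo X \<rho> = fob F X"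
    and prj_rid: "\<rho> = rid R X \<Longrightarrow> prj X \<rho> = ide (base S) (fob F X)"
proof -
  let ?P = "\<lambda>(W, q). quotient_arrow S (fob F X) (frel F X X \<rho>) W q \<and>
    effective S (fob F X) (frel F X X \<rho>) W q \<and> descent S (fob F X) W q \<and>
    (\<rho> = rid R X \<longrightarrow> W = fob F X \<and> q = ide (base S) (fob F X))"
  have "\<exists>p. ?P p"
  proof (cases "\<rho> = rid R X")
    case True
    then have "?P (fob F X, ide (base S) (fob F X))"
      using S.quotient_arrow_ide[of "fob F X"] X by simp
    then show ?thesis by (rule exI)
  next
    case False
    obtain W q where "quotient_arrow S (fob F X) (frel F X X \<rho>) W q"
      "effective S (fob F X) (frel F X X \<rho>) W q" "descent S (fob F X) W q"
      using quotients equiv_rel_frel[OF X \<rho>] X unfolding has_quotients_def by (meson fob_ob)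
    then have "?P (W, q)" using False by simp
    then show ?thesis by (rule exI)
  qed
  then have *: "?P (chosen X \<rho>)" unfolding chosen_def by (rule someI_ex)
  then show "quotient_arrow S (fob F X) (frel F X X \<rho>) (quo X \<rho>) (prj X \<rho>)"
    "descent S (fob F X) (quo X \<rho>) (prj X \<rho>)"
    "\<rho> = rid R X \<Longrightarrow> quo X \<rho> = fob F X"
    "\<rho> = rid R X \<Longrightarrow> prj X \<rho> = ide (base S) (fob F X)"
    by (auto simp: quo_def prj_def split: prod.splits)
  then show "quo X \<rho> \<in> ob (base S)" "prj X \<rho> \<in> hom (base S) (fob F X) (quo X \<rho>)"
    unfolding quotient_arrow_def by blast+
  show "kernel S (fob F X) (quo X \<rho>) (prj X \<rho>) = frel F X X \<rho>"
    using * by (auto simp: effective_def quo_def prj_def split: prod.splits)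
qed

lemmas [simp] = quo_ob prj_hom descent_prj

lemma prj_epi:
  assumes "X \<in> ob (base R)" "equiv_rel R X \<rho>" "Z \<in> ob (base S)"
    "h \<in> hom (base S) (quo X \<rho>) Z" "k \<in> hom (base S) (quo X \<rho>) Z"
    "cmp (base S) (fob F X) (quo X \<rho>) Z h (prj X \<rho>) = cmp (base S) (fob F X) (quo X \<rho>) Z k (prj X \<rho>)"
  shows "h = k"
  using S.quotient_arrow_epi[OF quotient_prj[OF assms(1,2)] _ _ assms(3-6)] assms
  by (simp add: R.equiv_rel_fibre)

definition lift :: "'o \<Rightarrow> 'r \<Rightarrow> 'o \<Rightarrow> 'r \<Rightarrow> 'a \<Rightarrow> 'b" where
  "lift X \<rho> Y \<sigma> f = (SOME h. h \<in> hom (base S) (quo X \<rho>) (quo Y \<sigma>) \<and>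
    cmp (base S) (fob F X) (quo X \<rho>) (quo Y \<sigma>) h (prj X \<rho>) =
    cmp (base S) (fob F X) (fob F Y) (quo Y \<sigma>) (prj Y \<sigma>) (far F X Y f))"

text \<open>
  The relation \<open>F \<rho>\<close> lies below the kernel of \<open>prj Y \<sigma> \<circ> F f\<close>, since that kernel is the reindexing
  of \<open>F \<sigma>\<close> along \<open>F f\<close>; the universal property of \<open>prj X \<rho>\<close> provides the lift.
\<close>

lemma lift:
  assumes X: "X \<in> ob (base R)" "equiv_rel R X \<rho>" and Y: "Y \<in> ob (base R)" "equiv_rel R Y \<sigma>"
    and f: "f \<in> hom (base R) X Y" "le R X X \<rho> (reix R X X Y Y f f \<sigma>)"
  shows lift_hom: "lift X \<rho> Y \<sigma> f \<in> hom (base S) (quo X \<rho>) (quo Y \<sigma>)"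
    and lift_prj: "cmp (base S) (fob F X) (quo X \<rho>) (quo Y \<sigma>) (lift X \<rho> Y \<sigma> f) (prj X \<rho>) =
      cmp (base S) (fob F X) (fob F Y) (quo Y \<sigma>) (prj Y \<sigma>) (far F X Y f)"
proof -
  let ?g = "cmp (base S) (fob F X) (fob F Y) (quo Y \<sigma>) (prj Y \<sigma>) (far F X Y f)"
  have g: "?g \<in> hom (base S) (fob F X) (quo Y \<sigma>)" using X Y f by simp
  have "kernel S (fob F X) (quo Y \<sigma>) ?g =
      reix S (fob F X) (fob F X) (fob F Y) (fob F Y) (far F X Y f) (far F X Y f) (frel F Y Y \<sigma>)"
    using X Y f by (simp add: S.kernel_cmp kernel_prj)
  then have "le S (fob F X) (fob F X) (frel F X X \<rho>) (kernel S (fob F X) (quo Y \<sigma>) ?g)"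
    using frel_hom_Q[OF X Y f] by simp
  then obtain h where "h \<in> hom (base S) (quo X \<rho>) (quo Y \<sigma>)"
    "cmp (base S) (fob F X) (quo X \<rho>) (quo Y \<sigma>) h (prj X \<rho>) = ?g"
    using S.quotient_arrow_factor[OF quotient_prj[OF X] quo_ob[OF Y] g] by blast
  then have "\<exists>h. h \<in> hom (base S) (quo X \<rho>) (quo Y \<sigma>) \<and>
    cmp (base S) (fob F X) (quo X \<rho>) (quo Y \<sigma>) h (prj X \<rho>) = ?g" by blast
  from someI_ex[OF this]
  show "lift X \<rho> Y \<sigma> f \<in> hom (base S) (quo X \<rho>) (quo Y \<sigma>)"
    "cmp (base S) (fob F X) (quo X \<rho>) (quo Y \<sigma>) (lift X \<rho> Y \<sigma> f) (prj X \<rho>) = ?g"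
    unfolding lift_def by auto
qed

lemma lift_eqI:
  assumes "X \<in> ob (base R)" "equiv_rel R X \<rho>" "Y \<in> ob (base R)" "equiv_rel R Y \<sigma>"
    "f \<in> hom (base R) X Y" "le R X X \<rho> (reix R X X Y Y f f \<sigma>)"
    "h \<in> hom (base S) (quo X \<rho>) (quo Y \<sigma>)"
    "cmp (base S) (fob F X) (quo X \<rho>) (quo Y \<sigma>) h (prj X \<rho>) =
      cmp (base S) (fob F X) (fob F Y) (quo Y \<sigma>) (prj Y \<sigma>) (far F X Y f)"
  shows "lift X \<rho> Y \<sigma> f = h"
  using prj_epi[OF assms(1,2) quo_ob[OF assms(3,4)] lift_hom[OF assms(1-6)] assms(7)]
    lift_prj[OF assms(1-6)] assms(8) by simp

definition push :: "'o \<Rightarrow> 'r \<Rightarrow> 'o \<Rightarrow> 'r \<Rightarrow> 'r \<Rightarrow> 's" where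
  "push X \<rho> Y \<sigma> \<alpha> =
    dimg S (fob F X) (fob F Y) (quo X \<rho>) (quo Y \<sigma>) (prj X \<rho>) (prj Y \<sigma>) (frel F X Y \<alpha>)"

lemma push_fibre:
  assumes "X \<in> ob (base R)" "equiv_rel R X \<rho>" "Y \<in> ob (base R)" "equiv_rel R Y \<sigma>"
    "\<alpha> \<in> fibre (Q R) (X, \<rho>) (Y, \<sigma>)"
  shows "push X \<rho> Y \<sigma> \<alpha> \<in> fibre S (quo X \<rho>) (quo Y \<sigma>)"
  using assms R.fibre_QD[OF assms(5)] by (simp add: push_def)

text \<open>
  Reindexing the direct image of \<open>F \<alpha>\<close> composes it with the kernels \<open>F \<rho>\<close> and \<open>F \<sigma>\<close>, and these are
  absorbed because \<open>\<alpha>\<close> is invariant under \<open>\<rho>\<close> and \<open>\<sigma>\<close>.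
\<close>

lemma reix_push:
  assumes "X \<in> ob (base R)" "equiv_rel R X \<rho>" "Y \<in> ob (base R)" "equiv_rel R Y \<sigma>"
    "\<alpha> \<in> fibre (Q R) (X, \<rho>) (Y, \<sigma>)"
  shows "reix S (fob F X) (fob F Y) (quo X \<rho>) (quo Y \<sigma>) (prj X \<rho>) (prj Y \<sigma>) (push X \<rho> Y \<sigma> \<alpha>) =
    frel F X Y \<alpha>"
  using assms unfolding push_def
  by (simp add: S.reix_dimg R.fibre_Q_iff R.equiv_rel_fibre kernel_prj frel_rcmp[symmetric])

text \<open>
  Reindexing along the projections is injective, so \<open>push\<close> is characterised by \<open>reix_push\<close>. Every
  law of the extension on relations reduces in this way to the corresponding law of \<open>F\<close>.
\<close>

lemma push_eqI:
  assumes "X \<in> ob (base R)" "equiv_rel R X \<rho>" "Y \<in> ob (base R)" "equiv_rel R Y \<sigma>"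
    "\<alpha> \<in> fibre (Q R) (X, \<rho>) (Y, \<sigma>)" "\<beta> \<in> fibre S (quo X \<rho>) (quo Y \<sigma>)"
    "reix S (fob F X) (fob F Y) (quo X \<rho>) (quo Y \<sigma>) (prj X \<rho>) (prj Y \<sigma>) \<beta> = frel F X Y \<alpha>"
  shows "push X \<rho> Y \<sigma> \<alpha> = \<beta>"
  by (rule S.reix_descent_inj[of "fob F X" "fob F Y" "quo X \<rho>" "quo Y \<sigma>" "prj X \<rho>" "prj Y \<sigma>"])
    (use assms in \<open>simp_all add: push_fibre reix_push\<close>)

definition extension :: "('o \<times> 'r, 'a, 'p, 'b, 'r, 's) onearr" where
  "extension = \<lparr>fob = (\<lambda>(X, \<rho>)\<in>ob (base (Q R)). quo X \<rho>),
    far = (\<lambda>(X, \<rho>)\<in>ob (base (Q R)). \<lambda>(Y, \<sigma>)\<in>ob (base (Q R)).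
      \<lambda>f\<in>hom (base (Q R)) (X, \<rho>) (Y, \<sigma>). lift X \<rho> Y \<sigma> f),
    frel = (\<lambda>(X, \<rho>)\<in>ob (base (Q R)). \<lambda>(Y, \<sigma>)\<in>ob (base (Q R)).
      \<lambda>\<alpha>\<in>fibre (Q R) (X, \<rho>) (Y, \<sigma>). push X \<rho> Y \<sigma> \<alpha>)\<rparr>"

lemma extension_sel [simp]:
  "\<lbrakk>X \<in> ob (base R); equiv_rel R X \<rho>\<rbrakk> \<Longrightarrow> fob extension (X, \<rho>) = quo X \<rho>"
  "\<lbrakk>X \<in> ob (base R); equiv_rel R X \<rho>; Y \<in> ob (base R); equiv_rel R Y \<sigma>;
    f \<in> hom (base R) X Y; le R X X \<rho> (reix R X X Y Y f f \<sigma>)\<rbrakk> \<Longrightarrow>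
    far extension (X, \<rho>) (Y, \<sigma>) f = lift X \<rho> Y \<sigma> f"
  "\<lbrakk>X \<in> ob (base R); equiv_rel R X \<rho>; Y \<in> ob (base R); equiv_rel R Y \<sigma>;
    \<alpha> \<in> fibre (Q R) (X, \<rho>) (Y, \<sigma>)\<rbrakk> \<Longrightarrow>
    frel extension (X, \<rho>) (Y, \<sigma>) \<alpha> = push X \<rho> Y \<sigma> \<alpha>"
  by (simp_all add: extension_def)

lemma is_functor_extension: "is_functor (base (Q R)) (base S) extension"
proof (rule is_functorI, unfold split_paired_all)
  fix X \<rho> assume "(X, \<rho>) \<in> ob (base (Q R))"
  then have X: "X \<in> ob (base R)" "equiv_rel R X \<rho>" by auto
  then have "lift X \<rho> X \<rho> (ide (base R) X) = ide (base S) (quo X \<rho>)"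
    by (intro lift_eqI) (simp_all add: R.equiv_rel_fibre R.le_refl')
  then show "far extension (X, \<rho>) (X, \<rho>) (ide (base (Q R)) (X, \<rho>)) = ide (base S) (fob extension (X, \<rho>))"
    using X by (simp add: R.equiv_rel_fibre R.le_refl')
next
  fix X \<rho> Y \<sigma> Z \<tau> f g
  assume *: "(X, \<rho>) \<in> ob (base (Q R))" "(Y, \<sigma>) \<in> ob (base (Q R))" "(Z, \<tau>) \<in> ob (base (Q R))"
    "f \<in> hom (base (Q R)) (X, \<rho>) (Y, \<sigma>)" "g \<in> hom (base (Q R)) (Y, \<sigma>) (Z, \<tau>)"
  have gf: "cmp (base (Q R)) (X, \<rho>) (Y, \<sigma>) (Z, \<tau>) g f \<in> hom (base (Q R)) (X, \<rho>) (Z, \<tau>)"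
    by (rule category.cmp_hom[OF R.category_Qbase *])
  have X[simp]: "X \<in> ob (base R)" "equiv_rel R X \<rho>" and Y[simp]: "Y \<in> ob (base R)" "equiv_rel R Y \<sigma>"
    and Z[simp]: "Z \<in> ob (base R)" "equiv_rel R Z \<tau>"
    and f[simp]: "f \<in> hom (base R) X Y" "le R X X \<rho> (reix R X X Y Y f f \<sigma>)"
    and g[simp]: "g \<in> hom (base R) Y Z" "le R Y Y \<sigma> (reix R Y Y Z Z g g \<tau>)"
    using * by auto
  let ?C = "cmp (base S)" and ?lf = "lift X \<rho> Y \<sigma> f" and ?lg = "lift Y \<sigma> Z \<tau> g"
  note [simp] = lift_hom[OF X Y f] lift_hom[OF Y Z g]
  have "?C (fob F X) (quo X \<rho>) (quo Z \<tau>) (?C (quo X \<rho>) (quo Y \<sigma>) (quo Z \<tau>) ?lg ?lf) (prj X \<rho>) =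
      ?C (fob F X) (quo Y \<sigma>) (quo Z \<tau>) ?lg (?C (fob F X) (quo X \<rho>) (quo Y \<sigma>) ?lf (prj X \<rho>))"
    by (rule S.base_cat.cmp_assoc[symmetric]) simp_all
  also have "\<dots> = ?C (fob F X) (quo Y \<sigma>) (quo Z \<tau>) ?lg (?C (fob F X) (fob F Y) (quo Y \<sigma>) (prj Y \<sigma>) (far F X Y f))"
    by (simp add: lift_prj[OF X Y f])
  also have "\<dots> = ?C (fob F X) (fob F Y) (quo Z \<tau>) (?C (fob F Y) (quo Y \<sigma>) (quo Z \<tau>) ?lg (prj Y \<sigma>)) (far F X Y f)"
    by (rule S.base_cat.cmp_assoc) simp_all
  also have "\<dots> = ?C (fob F X) (fob F Y) (quo Z \<tau>) (?C (fob F Y) (fob F Z) (quo Z \<tau>) (prj Z \<tau>) (far F Y Z g)) (far F X Y f)"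
    by (simp add: lift_prj[OF Y Z g])
  also have "\<dots> = ?C (fob F X) (fob F Z) (quo Z \<tau>) (prj Z \<tau>) (?C (fob F X) (fob F Y) (fob F Z) (far F Y Z g) (far F X Y f))"
    by (rule S.base_cat.cmp_assoc[symmetric]) simp_all
  finally have "lift X \<rho> Z \<tau> (cmp (base R) X Y Z g f) = ?C (quo X \<rho>) (quo Y \<sigma>) (quo Z \<tau>) ?lg ?lf"
    using gf by (intro lift_eqI) (simp_all add: far_cmp)
  then show "far extension (X, \<rho>) (Z, \<tau>) (cmp (base (Q R)) (X, \<rho>) (Y, \<sigma>) (Z, \<tau>) g f) =
      ?C (fob extension (X, \<rho>)) (fob extension (Y, \<sigma>)) (fob extension (Z, \<tau>))
        (far extension (Y, \<sigma>) (Z, \<tau>) g) (far extension (X, \<rho>) (Y, \<sigma>) f)"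
    using gf by simp
qed (auto simp: lift_hom, auto simp: extension_def)

lemma push_reix:
  assumes X: "X \<in> ob (base R)" "equiv_rel R X \<rho>" and Y: "Y \<in> ob (base R)" "equiv_rel R Y \<sigma>"
    and A: "A \<in> ob (base R)" "equiv_rel R A \<rho>'" and B: "B \<in> ob (base R)" "equiv_rel R B \<sigma>'"
    and f: "f \<in> hom (base R) X A" "le R X X \<rho> (reix R X X A A f f \<rho>')"
    and g: "g \<in> hom (base R) Y B" "le R Y Y \<sigma> (reix R Y Y B B g g \<sigma>')"
    and \<alpha>: "\<alpha> \<in> fibre (Q R) (A, \<rho>') (B, \<sigma>')" and f\<alpha>: "reix R X Y A B f g \<alpha> \<in> fibre (Q R) (X, \<rho>) (Y, \<sigma>)"
  shows "push X \<rho> Y \<sigma> (reix R X Y A B f g \<alpha>) =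
    reix S (quo X \<rho>) (quo Y \<sigma>) (quo A \<rho>') (quo B \<sigma>') (lift X \<rho> A \<rho>' f) (lift Y \<sigma> B \<sigma>' g)
      (push A \<rho>' B \<sigma>' \<alpha>)"
proof (rule push_eqI[OF X Y f\<alpha>])
  note [simp] = X Y A B f g lift_hom[OF X A f] lift_hom[OF Y B g] push_fibre[OF A B \<alpha>] R.fibre_QD[OF \<alpha>]
  show "reix S (quo X \<rho>) (quo Y \<sigma>) (quo A \<rho>') (quo B \<sigma>') (lift X \<rho> A \<rho>' f) (lift Y \<sigma> B \<sigma>' g)
      (push A \<rho>' B \<sigma>' \<alpha>) \<in> fibre S (quo X \<rho>) (quo Y \<sigma>)" by simp
  have "reix S (fob F X) (fob F Y) (quo X \<rho>) (quo Y \<sigma>) (prj X \<rho>) (prj Y \<sigma>)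
      (reix S (quo X \<rho>) (quo Y \<sigma>) (quo A \<rho>') (quo B \<sigma>') (lift X \<rho> A \<rho>' f) (lift Y \<sigma> B \<sigma>' g)
        (push A \<rho>' B \<sigma>' \<alpha>)) =
    reix S (fob F X) (fob F Y) (quo A \<rho>') (quo B \<sigma>')
      (cmp (base S) (fob F X) (quo X \<rho>) (quo A \<rho>') (lift X \<rho> A \<rho>' f) (prj X \<rho>))
      (cmp (base S) (fob F Y) (quo Y \<sigma>) (quo B \<sigma>') (lift Y \<sigma> B \<sigma>' g) (prj Y \<sigma>)) (push A \<rho>' B \<sigma>' \<alpha>)"
    by (simp add: S.reix_cmp)
  also have "\<dots> = reix S (fob F X) (fob F Y) (fob F A) (fob F B) (far F X A f) (far F Y B g)
      (reix S (fob F A) (fob F B) (quo A \<rho>') (quo B \<sigma>') (prj A \<rho>') (prj B \<sigma>') (push A \<rho>' B \<sigma>' \<alpha>))"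
    by (simp add: lift_prj[OF X A f] lift_prj[OF Y B g] S.reix_cmp)
  also have "\<dots> = frel F X Y (reix R X Y A B f g \<alpha>)"
    by (simp add: reix_push[OF A B \<alpha>] frel_reix)
  finally show "reix S (fob F X) (fob F Y) (quo X \<rho>) (quo Y \<sigma>) (prj X \<rho>) (prj Y \<sigma>)
      (reix S (quo X \<rho>) (quo Y \<sigma>) (quo A \<rho>') (quo B \<sigma>') (lift X \<rho> A \<rho>' f) (lift Y \<sigma> B \<sigma>' g)
        (push A \<rho>' B \<sigma>' \<alpha>)) = frel F X Y (reix R X Y A B f g \<alpha>)" .
qed

lemma push_rid:
  assumes "X \<in> ob (base R)" "equiv_rel R X \<rho>"
  shows "push X \<rho> X \<rho> \<rho> = rid S (quo X \<rho>)"
  using assms rel_doctrine.rid_fibre[OF R.rel_doctrine_Q, of "(X, \<rho>)"]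
  by (intro push_eqI) (simp_all add: S.kernel_eq_reix[symmetric] kernel_prj)

lemma push_rcmp:
  assumes "X \<in> ob (base R)" "equiv_rel R X \<rho>" "Y \<in> ob (base R)" "equiv_rel R Y \<sigma>"
    "Z \<in> ob (base R)" "equiv_rel R Z \<tau>"
    "\<alpha> \<in> fibre (Q R) (X, \<rho>) (Y, \<sigma>)" "\<beta> \<in> fibre (Q R) (Y, \<sigma>) (Z, \<tau>)"
  shows "push X \<rho> Z \<tau> (rcmp R X Y Z \<alpha> \<beta>) =
    rcmp S (quo X \<rho>) (quo Y \<sigma>) (quo Z \<tau>) (push X \<rho> Y \<sigma> \<alpha>) (push Y \<sigma> Z \<tau> \<beta>)"
  using assms rel_doctrine.rcmp_fibre[OF R.rel_doctrine_Q, of "(X, \<rho>)" "(Y, \<sigma>)" "(Z, \<tau>)" \<alpha> \<beta>]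
    S.rcmp_reix_descent[of "fob F X" "fob F Y" "fob F Z" "quo X \<rho>" "quo Y \<sigma>" "quo Z \<tau>"
      "prj X \<rho>" "prj Y \<sigma>" "prj Z \<tau>" "push X \<rho> Y \<sigma> \<alpha>" "push Y \<sigma> Z \<tau> \<beta>"]
    R.fibre_QD[OF assms(7)] R.fibre_QD[OF assms(8)]
  by (intro push_eqI) (simp_all add: push_fibre reix_push frel_rcmp)

lemma push_conv:
  assumes "X \<in> ob (base R)" "equiv_rel R X \<rho>" "Y \<in> ob (base R)" "equiv_rel R Y \<sigma>"
    "\<alpha> \<in> fibre (Q R) (X, \<rho>) (Y, \<sigma>)"
  shows "push Y \<sigma> X \<rho> (conv R X Y \<alpha>) = conv S (quo X \<rho>) (quo Y \<sigma>) (push X \<rho> Y \<sigma> \<alpha>)"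
  using assms rel_doctrine.conv_fibre[OF R.rel_doctrine_Q, of "(X, \<rho>)" "(Y, \<sigma>)" \<alpha>]
    S.conv_reix_eq[of "fob F X" "fob F Y" "quo X \<rho>" "quo Y \<sigma>" "prj X \<rho>" "prj Y \<sigma>"
      "push X \<rho> Y \<sigma> \<alpha>"] R.fibre_QD[OF assms(5)]
  by (intro push_eqI) (simp_all add: push_fibre reix_push frel_conv)

lemma lax_arrow_extension: "lax_arrow (Q R) S extension"
proof (rule lax_arrowI, unfold split_paired_all)
  interpret QR: rel_doctrine "Q R" by (rule R.rel_doctrine_Q)
  show "is_functor (base (Q R)) (base S) extension" by (rule is_functor_extension)
  show "frel extension \<in> (\<Pi>\<^sub>E X \<in> ob (base (Q R)). \<Pi>\<^sub>E Y \<in> ob (base (Q R)).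
      fibre (Q R) X Y \<rightarrow>\<^sub>E fibre S (fob extension X) (fob extension Y))"
    by (auto simp: extension_def push_fibre)
  {
    fix X \<rho> Y \<sigma> A \<rho>' B \<sigma>' f g \<alpha>
    assume *: "(X, \<rho>) \<in> ob (base (Q R))" "(Y, \<sigma>) \<in> ob (base (Q R))"
      "(A, \<rho>') \<in> ob (base (Q R))" "(B, \<sigma>') \<in> ob (base (Q R))"
      "f \<in> hom (base (Q R)) (X, \<rho>) (A, \<rho>')" "g \<in> hom (base (Q R)) (Y, \<sigma>) (B, \<sigma>')"
      "\<alpha> \<in> fibre (Q R) (A, \<rho>') (B, \<sigma>')"
    show "frel extension (X, \<rho>) (Y, \<sigma>) (reix (Q R) (X, \<rho>) (Y, \<sigma>) (A, \<rho>') (B, \<sigma>') f g \<alpha>) =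
      reix S (fob extension (X, \<rho>)) (fob extension (Y, \<sigma>)) (fob extension (A, \<rho>'))
        (fob extension (B, \<sigma>')) (far extension (X, \<rho>) (A, \<rho>') f)
        (far extension (Y, \<sigma>) (B, \<sigma>') g) (frel extension (A, \<rho>') (B, \<sigma>') \<alpha>)"
      using QR.reix_fibre[OF *] * by (simp add: push_reix)
  next
    fix X \<rho> Y \<sigma> Z \<tau> \<alpha> \<beta>
    assume *: "(X, \<rho>) \<in> ob (base (Q R))" "(Y, \<sigma>) \<in> ob (base (Q R))" "(Z, \<tau>) \<in> ob (base (Q R))"
      "\<alpha> \<in> fibre (Q R) (X, \<rho>) (Y, \<sigma>)" "\<beta> \<in> fibre (Q R) (Y, \<sigma>) (Z, \<tau>)"
    show "le S (fob extension (X, \<rho>)) (fob extension (Z, \<tau>))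
      (rcmp S (fob extension (X, \<rho>)) (fob extension (Y, \<sigma>)) (fob extension (Z, \<tau>))
        (frel extension (X, \<rho>) (Y, \<sigma>) \<alpha>) (frel extension (Y, \<sigma>) (Z, \<tau>) \<beta>))
      (frel extension (X, \<rho>) (Z, \<tau>) (rcmp (Q R) (X, \<rho>) (Y, \<sigma>) (Z, \<tau>) \<alpha> \<beta>))"
      using QR.rcmp_fibre[OF *] * by (simp add: push_rcmp[of X \<rho> Y \<sigma> Z \<tau>] push_fibre S.le_refl')
  next
    fix X \<rho> Y \<sigma> \<alpha>
    assume *: "(X, \<rho>) \<in> ob (base (Q R))" "(Y, \<sigma>) \<in> ob (base (Q R))" "\<alpha> \<in> fibre (Q R) (X, \<rho>) (Y, \<sigma>)"
    show "le S (fob extension (Y, \<sigma>)) (fob extension (X, \<rho>))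
      (conv S (fob extension (X, \<rho>)) (fob extension (Y, \<sigma>)) (frel extension (X, \<rho>) (Y, \<sigma>) \<alpha>))
      (frel extension (Y, \<sigma>) (X, \<rho>) (conv (Q R) (X, \<rho>) (Y, \<sigma>) \<alpha>))"
      using QR.conv_fibre[OF *] * by (simp add: push_conv push_fibre S.le_refl')
  next
    fix X \<rho>
    assume *: "(X, \<rho>) \<in> ob (base (Q R))"
    show "le S (fob extension (X, \<rho>)) (fob extension (X, \<rho>)) (rid S (fob extension (X, \<rho>)))
      (frel extension (X, \<rho>) (X, \<rho>) (rid (Q R) (X, \<rho>)))"
      using * QR.rid_fibre[OF *] by (simp add: push_rid S.le_refl')
  next
    fix X \<rho> Y \<sigma> \<alpha> \<beta>
    assume *: "(X, \<rho>) \<in> ob (base (Q R))" "(Y, \<sigma>) \<in> ob (base (Q R))"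
      "\<alpha> \<in> fibre (Q R) (X, \<rho>) (Y, \<sigma>)" "\<beta> \<in> fibre (Q R) (X, \<rho>) (Y, \<sigma>)"
      and le: "le (Q R) (X, \<rho>) (Y, \<sigma>) \<alpha> \<beta>"
    show "le S (fob extension (X, \<rho>)) (fob extension (Y, \<sigma>))
        (frel extension (X, \<rho>) (Y, \<sigma>) \<alpha>) (frel extension (X, \<rho>) (Y, \<sigma>) \<beta>)"
      using * le R.fibre_QD[OF *(3)] R.fibre_QD[OF *(4)]
      by (simp add: push_def S.dimg_le frel_le)
  }
qed

lemma strict_arrow_extension: "strict_arrow (Q R) S extension"
proof (rule strict_arrowI, unfold split_paired_all)
  interpret QR: rel_doctrine "Q R" by (rule R.rel_doctrine_Q)
  {
    fix X \<rho> assume *: "(X, \<rho>) \<in> ob (base (Q R))"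
    show "rid S (fob extension (X, \<rho>)) = frel extension (X, \<rho>) (X, \<rho>) (rid (Q R) (X, \<rho>))"
      using * QR.rid_fibre[OF *] by (simp add: push_rid)
  next
    fix X \<rho> Y \<sigma> Z \<tau> \<alpha> \<beta>
    assume *: "(X, \<rho>) \<in> ob (base (Q R))" "(Y, \<sigma>) \<in> ob (base (Q R))" "(Z, \<tau>) \<in> ob (base (Q R))"
      "\<alpha> \<in> fibre (Q R) (X, \<rho>) (Y, \<sigma>)" "\<beta> \<in> fibre (Q R) (Y, \<sigma>) (Z, \<tau>)"
    show "rcmp S (fob extension (X, \<rho>)) (fob extension (Y, \<sigma>)) (fob extension (Z, \<tau>))
        (frel extension (X, \<rho>) (Y, \<sigma>) \<alpha>) (frel extension (Y, \<sigma>) (Z, \<tau>) \<beta>) =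
      frel extension (X, \<rho>) (Z, \<tau>) (rcmp (Q R) (X, \<rho>) (Y, \<sigma>) (Z, \<tau>) \<alpha> \<beta>)"
      using QR.rcmp_fibre[OF *] * by (simp add: push_rcmp[of X \<rho> Y \<sigma> Z \<tau>])
  }
qed

text \<open>
  The lift \<open>h\<close> of the identity satisfies \<open>h \<circ> prj X \<rho> = prj X \<tau>\<close>. Reindexed along \<open>prj X \<rho>\<close>, both its
  kernel and \<open>push \<tau>\<close> become \<open>F \<tau>\<close>, so they agree. An arrow \<open>f\<close> whose kernel contains \<open>push \<tau>\<close>
  gives \<open>f \<circ> prj X \<rho>\<close> with kernel containing \<open>F \<tau>\<close>, hence a factorisation through \<open>prj X \<tau>\<close>, and
  cancelling \<open>prj X \<rho>\<close> turns it into one through \<open>h\<close>.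
\<close>

lemma quotient_arrow_lift:
  assumes X: "X \<in> ob (base R)" and \<rho>: "equiv_rel R X \<rho>" and \<tau>: "equiv_rel R X \<tau>"
    and le: "le R X X \<rho> \<tau>" and \<tau>Q: "\<tau> \<in> fibre (Q R) (X, \<rho>) (X, \<rho>)"
  shows "quotient_arrow S (quo X \<rho>) (push X \<rho> X \<rho> \<tau>) (quo X \<tau>) (lift X \<rho> X \<tau> (ide (base R) X))"
proof -
  note [simp] = X \<rho> \<tau> R.equiv_rel_fibre[OF \<rho>] R.equiv_rel_fibre[OF \<tau>]
  let ?h = "lift X \<rho> X \<tau> (ide (base R) X)"
  have h[simp]: "?h \<in> hom (base S) (quo X \<rho>) (quo X \<tau>)" by (rule lift_hom) (simp_all add: le)
  have hq: "cmp (base S) (fob F X) (quo X \<rho>) (quo X \<tau>) ?h (prj X \<rho>) = prj X \<tau>"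
    using lift_prj[of X \<rho> X \<tau> "ide (base R) X"] le by simp
  have p[simp]: "push X \<rho> X \<rho> \<tau> \<in> fibre S (quo X \<rho>) (quo X \<rho>)"
    by (rule push_fibre) (simp_all add: \<tau>Q)
  note reix_push_\<tau> = reix_push[OF X \<rho> X \<rho> \<tau>Q]
  show ?thesis
    unfolding quotient_arrow_def
  proof (intro conjI ballI impI)
    have "kernel S (fob F X) (quo X \<tau>) (cmp (base S) (fob F X) (quo X \<rho>) (quo X \<tau>) ?h (prj X \<rho>)) =
        frel F X X \<tau>"
      by (simp only: hq kernel_prj[OF X \<tau>])
    then have "frel F X X \<tau> = reix S (fob F X) (fob F X) (quo X \<rho>) (quo X \<rho>) (prj X \<rho>) (prj X \<rho>)
        (kernel S (quo X \<rho>) (quo X \<tau>) ?h)"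
      by (simp add: S.kernel_cmp)
    then have "push X \<rho> X \<rho> \<tau> = kernel S (quo X \<rho>) (quo X \<tau>) ?h"
      by (intro push_eqI) (simp_all add: \<tau>Q)
    then show "le S (quo X \<rho>) (quo X \<rho>) (push X \<rho> X \<rho> \<tau>) (kernel S (quo X \<rho>) (quo X \<tau>) ?h)"
      by (simp add: S.le_refl')
    fix Z f assume Z[simp]: "Z \<in> ob (base S)" and f[simp]: "f \<in> hom (base S) (quo X \<rho>) Z"
      and ker: "le S (quo X \<rho>) (quo X \<rho>) (push X \<rho> X \<rho> \<tau>) (kernel S (quo X \<rho>) Z f)"
    let ?fq = "cmp (base S) (fob F X) (quo X \<rho>) Z f (prj X \<rho>)"
    have "le S (fob F X) (fob F X) (frel F X X \<tau>) (kernel S (fob F X) Z ?fq)"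
      using S.reix_le[OF ker, of "fob F X" "fob F X" "prj X \<rho>" "prj X \<rho>"]
      by (simp add: reix_push_\<tau> S.kernel_cmp)
    then obtain k where k[simp]: "k \<in> hom (base S) (quo X \<tau>) Z"
      and kq: "cmp (base S) (fob F X) (quo X \<tau>) Z k (prj X \<tau>) = ?fq"
      using S.quotient_arrow_factor[OF quotient_prj[OF X \<tau>] Z] by (metis S.base_cat.cmp_hom X Z \<rho> f fob_ob prj_hom quo_ob)
    have assoc: "cmp (base S) (fob F X) (quo X \<rho>) Z (cmp (base S) (quo X \<rho>) (quo X \<tau>) Z k' ?h) (prj X \<rho>) =
        cmp (base S) (fob F X) (quo X \<tau>) Z k' (prj X \<tau>)" if "k' \<in> hom (base S) (quo X \<tau>) Z" for k'
      using S.base_cat.cmp_assoc[of "fob F X" "quo X \<rho>" "quo X \<tau>" Z "prj X \<rho>" ?h k'] that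
      by (simp add: hq)
    show "\<exists>!k. k \<in> hom (base S) (quo X \<tau>) Z \<and> f = cmp (base S) (quo X \<rho>) (quo X \<tau>) Z k ?h"
    proof (rule ex1I[of _ k], intro conjI)
      show "f = cmp (base S) (quo X \<rho>) (quo X \<tau>) Z k ?h"
        by (rule prj_epi[OF X \<rho> Z]) (simp_all add: assoc kq)
      fix k' assume k': "k' \<in> hom (base S) (quo X \<tau>) Z \<and> f = cmp (base S) (quo X \<rho>) (quo X \<tau>) Z k' ?h"
      then have "cmp (base S) (fob F X) (quo X \<tau>) Z k' (prj X \<tau>) = ?fq" using assoc[of k'] by simp
      then show "k' = k" using k' by - (rule prj_epi[OF X \<tau> Z], simp_all add: kq)
    qed (rule k)
  qed simp_all
qed

lemma preserves_quotients_extension: "preserves_quotients (Q R) S extension"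
proof (rule lax_one_arrow.preserves_quotientsI)
  show "lax_one_arrow (Q R) S extension"
    by (intro lax_one_arrowI R.rel_doctrine_Q S.rel_doctrine_axioms lax_arrow_extension)
  fix Z \<tau> assume Z: "Z \<in> ob (base (Q R))" and \<tau>: "equiv_rel (Q R) Z \<tau>"
  obtain X \<rho> where [simp]: "Z = (X, \<rho>)" by (cases Z)
  have *: "X \<in> ob (base R)" "equiv_rel R X \<rho>" "equiv_rel R X \<tau>" "le R X X \<rho> \<tau>"
    using Z \<tau> by (auto simp: R.equiv_rel_Q_iff)
  have **: "\<tau> \<in> fibre (Q R) (X, \<rho>) (X, \<rho>)" using \<tau> by (simp add: equiv_rel_def)
  have "quotient_arrow S (fob extension Z) (frel extension Z Z \<tau>)
      (fob extension (X, \<tau>)) (far extension Z (X, \<tau>) (ide (base R) X))"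
    using * ** quotient_arrow_lift[OF * **] by (simp add: R.equiv_rel_fibre)
  then show "\<exists>W q. quotient_arrow (Q R) Z \<tau> W q \<and>
      quotient_arrow S (fob extension Z) (frel extension Z Z \<tau>)
        (fob extension W) (far extension Z W q)"
    using R.quotient_arrow_Q(3)[OF *] by auto
qed

lemma extension_E: "comp_one R extension (E R) = F"
proof (rule onearr_eqI[OF strict_arrow_comp_one(1)[OF R.strict_arrow_E lax_arrow_extension
    strict_arrow_extension R.rel_doctrine_axioms R.rel_doctrine_Q S.rel_doctrine_axioms] lax])
  fix X Y f assume X[simp]: "X \<in> ob (base R)"
  show "fob (comp_one R extension (E R)) X = fob F X"
    by (simp add: R.equiv_rel_rid quo_rid)
  assume Y[simp]: "Y \<in> ob (base R)"
  {
    assume f[simp]: "f \<in> hom (base R) X Y"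
    have "lift X (rid R X) Y (rid R Y) f = far F X Y f"
      by (rule lift_eqI) (simp_all add: R.equiv_rel_rid R.rid_reix quo_rid prj_rid)
    then show "far (comp_one R extension (E R)) X Y f = far F X Y f"
      by (simp add: R.equiv_rel_rid R.rid_reix)
  }
  fix \<alpha> assume \<alpha>[simp]: "\<alpha> \<in> fibre R X Y"
  have "push X (rid R X) Y (rid R Y) \<alpha> = frel F X Y \<alpha>"
    by (rule push_eqI) (simp_all add: R.equiv_rel_rid R.fibre_Q_rid quo_rid prj_rid)
  then show "frel (comp_one R extension (E R)) X Y \<alpha> = frel F X Y \<alpha>"
    by (simp add: R.equiv_rel_rid R.fibre_Q_rid)
qed

end

section \<open>Extending 2-arrows along the unit\<close>

locale quotient_preserving_from_Q = R0: rel_doctrine R + strict_one_arrow "Q R" S F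
  for R :: "('o, 'a, 'r) rdoc" and S :: "('p, 'b, 's) rdoc"
    and F :: "('o \<times> 'r, 'a, 'p, 'b, 'r, 's) onearr" +
  assumes preserves: "preserves_quotients (Q R) S F"
begin

abbreviation fob0 :: "'o \<Rightarrow> 'p" where "fob0 X \<equiv> fob F (X, rid R X)"

text \<open>
  The image under \<open>F\<close> of the quotient arrow \<open>(X, d\<^sub>X) \<rightarrow> (X, \<rho>)\<close>.
\<close>

definition cover :: "'o \<Rightarrow> 'r \<Rightarrow> 'b" where
  "cover X \<rho> = far F (X, rid R X) (X, \<rho>) (ide (base R) X)"

lemma cover:
  assumes X: "X \<in> ob (base R)" and \<rho>: "equiv_rel R X \<rho>"
  shows fob0_ob: "fob0 X \<in> ob (base S)"
    and fob_pair_ob: "fob F (X, \<rho>) \<in> ob (base S)"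
    and cover_hom: "cover X \<rho> \<in> hom (base S) (fob0 X) (fob F (X, \<rho>))"
    and quotient_cover: "quotient_arrow S (fob0 X) (frel F (X, rid R X) (X, rid R X) \<rho>)
      (fob F (X, \<rho>)) (cover X \<rho>)"
    and kernel_cover: "kernel S (fob0 X) (fob F (X, \<rho>)) (cover X \<rho>) =
      frel F (X, rid R X) (X, rid R X) \<rho>"
    and descent_cover: "descent S (fob0 X) (fob F (X, \<rho>)) (cover X \<rho>)"
proof -
  have ob: "(X, rid R X) \<in> ob (base (Q R))" "(X, \<rho>) \<in> ob (base (Q R))"
    using X \<rho> by (simp_all add: R0.equiv_rel_rid)
  show "fob0 X \<in> ob (base S)" "fob F (X, \<rho>) \<in> ob (base S)" using ob by (auto intro: fob_ob)
  have le: "le R X X (rid R X) \<rho>" using \<rho> by (simp add: equiv_rel_def)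
  note q = R0.quotient_arrow_Q[OF X R0.equiv_rel_rid[OF X] \<rho> le]
  show "cover X \<rho> \<in> hom (base S) (fob0 X) (fob F (X, \<rho>))"
    unfolding cover_def by (rule far_hom[OF ob q(1)])
  have "equiv_rel (Q R) (X, rid R X) \<rho>"
    using R0.equiv_rel_Q_iff[OF X R0.equiv_rel_rid[OF X]] \<rho> le by simp
  then show "quotient_arrow S (fob0 X) (frel F (X, rid R X) (X, rid R X) \<rho>)
      (fob F (X, \<rho>)) (cover X \<rho>)"
    using preserves q(3) ob unfolding preserves_quotients_def cover_def by blast
  show "kernel S (fob0 X) (fob F (X, \<rho>)) (cover X \<rho>) = frel F (X, rid R X) (X, rid R X) \<rho>"
    using frel_kernel[OF ob q(1)] q(4) unfolding effective_def cover_def by simp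
  show "descent S (fob0 X) (fob F (X, \<rho>)) (cover X \<rho>)"
    unfolding cover_def by (rule descent_far[OF ob q(1,5)])
qed

lemma cover_rid: "X \<in> ob (base R) \<Longrightarrow> cover X (rid R X) = ide (base S) (fob0 X)"
  using far_ide[of "(X, rid R X)"] by (simp add: cover_def R0.equiv_rel_rid)

text \<open>
  An arrow \<open>f : (X, \<rho>) \<rightarrow> (Y, \<sigma>)\<close> is also an arrow \<open>(X, d\<^sub>X) \<rightarrow> (Y, d\<^sub>Y)\<close>, and the two form the
  opposite sides of a commuting square whose other sides are identities of the base; this is the
  image of that square under \<open>F\<close>.
\<close>

lemma cover_natural:
  assumes X: "X \<in> ob (base R)" "equiv_rel R X \<rho>" and Y: "Y \<in> ob (base R)" "equiv_rel R Y \<sigma>"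
    and f: "f \<in> hom (base R) X Y" "le R X X \<rho> (reix R X X Y Y f f \<sigma>)"
  shows "cmp (base S) (fob0 X) (fob F (X, \<rho>)) (fob F (Y, \<sigma>)) (far F (X, \<rho>) (Y, \<sigma>) f) (cover X \<rho>) =
    cmp (base S) (fob0 X) (fob0 Y) (fob F (Y, \<sigma>)) (cover Y \<sigma>) (far F (X, rid R X) (Y, rid R Y) f)"
proof -
  have ob: "(X, rid R X) \<in> ob (base (Q R))" "(X, \<rho>) \<in> ob (base (Q R))"
    "(Y, rid R Y) \<in> ob (base (Q R))" "(Y, \<sigma>) \<in> ob (base (Q R))"
    using X Y by (simp_all add: R0.equiv_rel_rid)
  have le: "le R X X (rid R X) \<rho>" "le R Y Y (rid R Y) \<sigma>" using X Y by (simp_all add: equiv_rel_def)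
  have f': "f \<in> hom (base (Q R)) (X, \<rho>) (Y, \<sigma>)" "f \<in> hom (base (Q R)) (X, rid R X) (Y, rid R Y)"
    using X Y f by (simp_all add: R0.rid_reix)
  note qX = R0.quotient_arrow_Q(1)[OF X(1) R0.equiv_rel_rid[OF X(1)] X(2) le(1)]
  note qY = R0.quotient_arrow_Q(1)[OF Y(1) R0.equiv_rel_rid[OF Y(1)] Y(2) le(2)]
  show ?thesis
    using far_cmp[OF ob(1,2,4) qX f'(1)] far_cmp[OF ob(1,3,4) f'(2) qY] X Y f
    by (simp add: cover_def)
qed

lemma frel_cover:
  assumes X: "X \<in> ob (base R)" "equiv_rel R X \<rho>" and Y: "Y \<in> ob (base R)" "equiv_rel R Y \<sigma>"
    and \<alpha>: "\<alpha> \<in> fibre (Q R) (X, \<rho>) (Y, \<sigma>)"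
  shows "reix S (fob0 X) (fob0 Y) (fob F (X, \<rho>)) (fob F (Y, \<sigma>)) (cover X \<rho>) (cover Y \<sigma>)
      (frel F (X, \<rho>) (Y, \<sigma>) \<alpha>) = frel F (X, rid R X) (Y, rid R Y) \<alpha>"
proof -
  have ob: "(X, rid R X) \<in> ob (base (Q R))" "(X, \<rho>) \<in> ob (base (Q R))"
    "(Y, rid R Y) \<in> ob (base (Q R))" "(Y, \<sigma>) \<in> ob (base (Q R))"
    using X Y by (simp_all add: R0.equiv_rel_rid)
  have le: "le R X X (rid R X) \<rho>" "le R Y Y (rid R Y) \<sigma>" using X Y by (simp_all add: equiv_rel_def)
  note qX = R0.quotient_arrow_Q(1)[OF X(1) R0.equiv_rel_rid[OF X(1)] X(2) le(1)]
  note qY = R0.quotient_arrow_Q(1)[OF Y(1) R0.equiv_rel_rid[OF Y(1)] Y(2) le(2)]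
  show ?thesis
    using frel_reix[OF ob(1,3,2,4) qX qY \<alpha>] X Y R0.fibre_QD[OF \<alpha>] by (simp add: cover_def)
qed

lemma cover_epi:
  assumes X: "X \<in> ob (base R)" "equiv_rel R X \<rho>" and Z: "Z \<in> ob (base S)"
    and h: "h \<in> hom (base S) (fob F (X, \<rho>)) Z" "k \<in> hom (base S) (fob F (X, \<rho>)) Z"
    "cmp (base S) (fob0 X) (fob F (X, \<rho>)) Z h (cover X \<rho>) =
      cmp (base S) (fob0 X) (fob F (X, \<rho>)) Z k (cover X \<rho>)"
  shows "h = k"
  by (rule S.quotient_arrow_epi[OF quotient_cover[OF X] fob0_ob[OF X] _ Z h])
    (metis S.kernel_fibre X cover_hom fob0_ob fob_pair_ob kernel_cover)

end

text \<open>
  Naturality at \<open>(X, d\<^sub>X) \<rightarrow> (X, \<rho>)\<close> fixes the composite of the component at \<open>(X, \<rho>)\<close> with \<open>cover X \<rho>\<close>,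
  and this quotient arrow is epi.
\<close>

lemma two_arrow_eq_on_unit:
  assumes F: "quotient_preserving_from_Q R S F" and G: "quotient_preserving_from_Q R S G"
    and \<theta>: "two_arrow (Q R) S F G \<theta>" and \<theta>': "two_arrow (Q R) S F G \<theta>'"
    and eq: "\<And>X. X \<in> ob (base R) \<Longrightarrow> \<theta> (X, rid R X) = \<theta>' (X, rid R X)"
  shows "\<theta> = \<theta>'"
proof (rule extensionalityI[OF two_arrow_ext[OF \<theta>] two_arrow_ext[OF \<theta>']], unfold split_paired_all)
  interpret F: quotient_preserving_from_Q R S F by fact
  interpret G: quotient_preserving_from_Q R S G by fact
  fix X \<rho> assume ob: "(X, \<rho>) \<in> ob (base (Q R))"
  then have X: "X \<in> ob (base R)" "equiv_rel R X \<rho>" by auto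
  have ob0: "(X, rid R X) \<in> ob (base (Q R))" using X by (simp add: F.R0.equiv_rel_rid)
  have c: "ide (base R) X \<in> hom (base (Q R)) (X, rid R X) (X, \<rho>)"
    using X by (intro F.R0.quotient_arrow_Q) (simp_all add: F.R0.equiv_rel_rid, simp add: equiv_rel_def)
  show "\<theta> (X, \<rho>) = \<theta>' (X, \<rho>)"
    by (rule F.cover_epi[OF X G.fob_pair_ob[OF X] two_arrow_hom[OF \<theta> ob] two_arrow_hom[OF \<theta>' ob]])
      (simp only: F.cover_def two_arrow_natural[OF \<theta> ob0 ob c] two_arrow_natural[OF \<theta>' ob0 ob c] eq[OF X(1)])
qed

text \<open>
  The inequality of the 2-arrow \<open>\<theta>\<close> at the relation \<open>\<rho>\<close> says that \<open>F \<rho>\<close> lies below the kernel of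
  \<open>G.cover X \<rho> \<circ> \<theta> X\<close>, so this arrow factors through \<open>F.cover X \<rho>\<close>; the factor is the new component.
  Naturality and the inequality for relations are both inherited from \<open>\<theta>\<close> after composing with, or
  reindexing along, the covers: these are epi, and reindexing along them reflects the order.
\<close>

lemma two_arrow_extends_from_unit:
  assumes F: "quotient_preserving_from_Q R S F" and G: "quotient_preserving_from_Q R S G"
    and \<theta>: "two_arrow R S (comp_one R F (E R)) (comp_one R G (E R)) \<theta>"
  obtains \<theta>' where "two_arrow (Q R) S F G \<theta>'"
    "\<And>X. X \<in> ob (base R) \<Longrightarrow> \<theta>' (X, rid R X) = \<theta> X"
proof -
  interpret F: quotient_preserving_from_Q R S F by fact
  interpret G: quotient_preserving_from_Q R S G by fact
  let ?C = "cmp (base S)"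
  have \<theta>_hom: "\<theta> X \<in> hom (base S) (F.fob0 X) (G.fob0 X)" if "X \<in> ob (base R)" for X
    using two_arrow_hom[OF \<theta> that] that by simp
  have \<theta>_nat: "?C (F.fob0 X) (F.fob0 Y) (G.fob0 Y) (\<theta> Y) (far F (X, rid R X) (Y, rid R Y) f) =
      ?C (F.fob0 X) (G.fob0 X) (G.fob0 Y) (far G (X, rid R X) (Y, rid R Y) f) (\<theta> X)"
    if "X \<in> ob (base R)" "Y \<in> ob (base R)" "f \<in> hom (base R) X Y" for X Y f
    using two_arrow_natural[OF \<theta> that] that by simp
  have \<theta>_le: "le S (F.fob0 X) (F.fob0 Y) (frel F (X, rid R X) (Y, rid R Y) \<alpha>)
      (reix S (F.fob0 X) (F.fob0 Y) (G.fob0 X) (G.fob0 Y) (\<theta> X) (\<theta> Y)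
        (frel G (X, rid R X) (Y, rid R Y) \<alpha>))"
    if "X \<in> ob (base R)" "Y \<in> ob (base R)" "\<alpha> \<in> fibre R X Y" for X Y \<alpha>
    using two_arrow_le[OF \<theta> that] that by simp
  have ex: "\<exists>h. h \<in> hom (base S) (fob F (X, \<rho>)) (fob G (X, \<rho>)) \<and>
      ?C (F.fob0 X) (fob F (X, \<rho>)) (fob G (X, \<rho>)) h (F.cover X \<rho>) =
      ?C (F.fob0 X) (G.fob0 X) (fob G (X, \<rho>)) (G.cover X \<rho>) (\<theta> X)"
    if X: "X \<in> ob (base R)" "equiv_rel R X \<rho>" for X \<rho>
  proof -
    note [simp] = X F.cover(1-3)[OF X] G.cover(1-3)[OF X] \<theta>_hom[OF X(1)]
    let ?g = "?C (F.fob0 X) (G.fob0 X) (fob G (X, \<rho>)) (G.cover X \<rho>) (\<theta> X)"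
    have g: "?g \<in> hom (base S) (F.fob0 X) (fob G (X, \<rho>))" by simp
    have "le S (F.fob0 X) (F.fob0 X) (frel F (X, rid R X) (X, rid R X) \<rho>)
        (kernel S (F.fob0 X) (fob G (X, \<rho>)) ?g)"
      using \<theta>_le[OF X(1) X(1) F.R0.equiv_rel_fibre[OF X(2)]]
      by (simp add: F.S.kernel_cmp G.kernel_cover)
    then show ?thesis
      using F.S.quotient_arrow_factor[OF F.quotient_cover[OF X] G.fob_pair_ob[OF X] g] by blast
  qed
  define ext where "ext X \<rho> = (SOME h. h \<in> hom (base S) (fob F (X, \<rho>)) (fob G (X, \<rho>)) \<and>
      ?C (F.fob0 X) (fob F (X, \<rho>)) (fob G (X, \<rho>)) h (F.cover X \<rho>) =
      ?C (F.fob0 X) (G.fob0 X) (fob G (X, \<rho>)) (G.cover X \<rho>) (\<theta> X))" for X \<rho>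
  have ext_hom: "ext X \<rho> \<in> hom (base S) (fob F (X, \<rho>)) (fob G (X, \<rho>))"
    and ext_cover: "?C (F.fob0 X) (fob F (X, \<rho>)) (fob G (X, \<rho>)) (ext X \<rho>) (F.cover X \<rho>) =
      ?C (F.fob0 X) (G.fob0 X) (fob G (X, \<rho>)) (G.cover X \<rho>) (\<theta> X)"
    if "X \<in> ob (base R)" "equiv_rel R X \<rho>" for X \<rho>
    using someI_ex[OF ex[OF that]] unfolding ext_def by auto
  define \<theta>' where "\<theta>' = (\<lambda>(X, \<rho>)\<in>ob (base (Q R)). ext X \<rho>)"
  have \<theta>'_sel: "\<theta>' (X, \<rho>) = ext X \<rho>" if "X \<in> ob (base R)" "equiv_rel R X \<rho>" for X \<rho>
    using that by (simp add: \<theta>'_def)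
  \<comment> \<open>The two sides of the naturality square agree after composing with the epi \<open>F.cover X \<rho>\<close>.\<close>
  have natural: "?C (fob F (X, \<rho>)) (fob F (Y, \<sigma>)) (fob G (Y, \<sigma>)) (ext Y \<sigma>) (far F (X, \<rho>) (Y, \<sigma>) f) =
      ?C (fob F (X, \<rho>)) (fob G (X, \<rho>)) (fob G (Y, \<sigma>)) (far G (X, \<rho>) (Y, \<sigma>) f) (ext X \<rho>)"
    if X: "X \<in> ob (base R)" "equiv_rel R X \<rho>" and Y: "Y \<in> ob (base R)" "equiv_rel R Y \<sigma>"
      and f: "f \<in> hom (base R) X Y" "le R X X \<rho> (reix R X X Y Y f f \<sigma>)" for X \<rho> Y \<sigma> f
  proof (rule F.cover_epi[OF X])
    have ob: "(X, \<rho>) \<in> ob (base (Q R))" "(Y, \<sigma>) \<in> ob (base (Q R))"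
      "(X, rid R X) \<in> ob (base (Q R))" "(Y, rid R Y) \<in> ob (base (Q R))"
      using X Y by (simp_all add: F.R0.equiv_rel_rid)
    have fh: "f \<in> hom (base (Q R)) (X, \<rho>) (Y, \<sigma>)" "f \<in> hom (base (Q R)) (X, rid R X) (Y, rid R Y)"
      using X Y f by (simp_all add: F.R0.rid_reix)
    note [simp] = F.cover(1-3)[OF X] G.cover(1-3)[OF X] F.cover(1-3)[OF Y] G.cover(1-3)[OF Y]
      \<theta>_hom[OF X(1)] \<theta>_hom[OF Y(1)] ext_hom[OF X] ext_hom[OF Y]
      F.far_hom[OF ob(1,2) fh(1)] G.far_hom[OF ob(1,2) fh(1)]
      F.far_hom[OF ob(3,4) fh(2)] G.far_hom[OF ob(3,4) fh(2)]
    let ?f = "far F (X, \<rho>) (Y, \<sigma>) f" and ?g = "far G (X, \<rho>) (Y, \<sigma>) f"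
      and ?u = "far F (X, rid R X) (Y, rid R Y) f" and ?v = "far G (X, rid R X) (Y, rid R Y) f"
    show "fob G (Y, \<sigma>) \<in> ob (base S)"
      "?C (fob F (X, \<rho>)) (fob F (Y, \<sigma>)) (fob G (Y, \<sigma>)) (ext Y \<sigma>) ?f \<in> hom (base S) (fob F (X, \<rho>)) (fob G (Y, \<sigma>))"
      "?C (fob F (X, \<rho>)) (fob G (X, \<rho>)) (fob G (Y, \<sigma>)) ?g (ext X \<rho>) \<in> hom (base S) (fob F (X, \<rho>)) (fob G (Y, \<sigma>))"
      by simp_all
    have "?C (F.fob0 X) (fob F (X, \<rho>)) (fob G (Y, \<sigma>))
        (?C (fob F (X, \<rho>)) (fob F (Y, \<sigma>)) (fob G (Y, \<sigma>)) (ext Y \<sigma>) ?f) (F.cover X \<rho>) =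
      ?C (F.fob0 X) (fob F (Y, \<sigma>)) (fob G (Y, \<sigma>)) (ext Y \<sigma>)
        (?C (F.fob0 X) (fob F (X, \<rho>)) (fob F (Y, \<sigma>)) ?f (F.cover X \<rho>))"
      by (rule F.S.base_cat.cmp_assoc[symmetric]) simp_all
    also have "\<dots> = ?C (F.fob0 X) (fob F (Y, \<sigma>)) (fob G (Y, \<sigma>)) (ext Y \<sigma>)
        (?C (F.fob0 X) (F.fob0 Y) (fob F (Y, \<sigma>)) (F.cover Y \<sigma>) ?u)"
      by (simp only: F.cover_natural[OF X Y f])
    also have "\<dots> = ?C (F.fob0 X) (F.fob0 Y) (fob G (Y, \<sigma>))
        (?C (F.fob0 Y) (fob F (Y, \<sigma>)) (fob G (Y, \<sigma>)) (ext Y \<sigma>) (F.cover Y \<sigma>)) ?u"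
      by (rule F.S.base_cat.cmp_assoc) simp_all
    also have "\<dots> = ?C (F.fob0 X) (F.fob0 Y) (fob G (Y, \<sigma>))
        (?C (F.fob0 Y) (G.fob0 Y) (fob G (Y, \<sigma>)) (G.cover Y \<sigma>) (\<theta> Y)) ?u"
      by (simp only: ext_cover[OF Y])
    also have "\<dots> = ?C (F.fob0 X) (G.fob0 Y) (fob G (Y, \<sigma>)) (G.cover Y \<sigma>)
        (?C (F.fob0 X) (F.fob0 Y) (G.fob0 Y) (\<theta> Y) ?u)"
      by (rule F.S.base_cat.cmp_assoc[symmetric]) simp_all
    also have "\<dots> = ?C (F.fob0 X) (G.fob0 Y) (fob G (Y, \<sigma>)) (G.cover Y \<sigma>)
        (?C (F.fob0 X) (G.fob0 X) (G.fob0 Y) ?v (\<theta> X))"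
      by (simp only: \<theta>_nat[OF X(1) Y(1) f(1)])
    also have "\<dots> = ?C (F.fob0 X) (G.fob0 X) (fob G (Y, \<sigma>))
        (?C (G.fob0 X) (G.fob0 Y) (fob G (Y, \<sigma>)) (G.cover Y \<sigma>) ?v) (\<theta> X)"
      by (rule F.S.base_cat.cmp_assoc) simp_all
    also have "\<dots> = ?C (F.fob0 X) (G.fob0 X) (fob G (Y, \<sigma>))
        (?C (G.fob0 X) (fob G (X, \<rho>)) (fob G (Y, \<sigma>)) ?g (G.cover X \<rho>)) (\<theta> X)"
      by (simp only: G.cover_natural[OF X Y f])
    also have "\<dots> = ?C (F.fob0 X) (fob G (X, \<rho>)) (fob G (Y, \<sigma>)) ?g
        (?C (F.fob0 X) (G.fob0 X) (fob G (X, \<rho>)) (G.cover X \<rho>) (\<theta> X))"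
      by (rule F.S.base_cat.cmp_assoc[symmetric]) simp_all
    also have "\<dots> = ?C (F.fob0 X) (fob G (X, \<rho>)) (fob G (Y, \<sigma>)) ?g
        (?C (F.fob0 X) (fob F (X, \<rho>)) (fob G (X, \<rho>)) (ext X \<rho>) (F.cover X \<rho>))"
      by (simp only: ext_cover[OF X])
    also have "\<dots> = ?C (F.fob0 X) (fob F (X, \<rho>)) (fob G (Y, \<sigma>))
        (?C (fob F (X, \<rho>)) (fob G (X, \<rho>)) (fob G (Y, \<sigma>)) ?g (ext X \<rho>)) (F.cover X \<rho>)"
      by (rule F.S.base_cat.cmp_assoc) simp_all
    finally show "?C (F.fob0 X) (fob F (X, \<rho>)) (fob G (Y, \<sigma>))
        (?C (fob F (X, \<rho>)) (fob F (Y, \<sigma>)) (fob G (Y, \<sigma>)) (ext Y \<sigma>) ?f) (F.cover X \<rho>) =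
      ?C (F.fob0 X) (fob F (X, \<rho>)) (fob G (Y, \<sigma>))
        (?C (fob F (X, \<rho>)) (fob G (X, \<rho>)) (fob G (Y, \<sigma>)) ?g (ext X \<rho>)) (F.cover X \<rho>)" .
  qed
  \<comment> \<open>The covers of \<open>F\<close> are descent arrows, so the inequality may be tested after reindexing along
    them, where it becomes that of \<open>\<theta>\<close>.\<close>
  have ineq: "le S (fob F (X, \<rho>)) (fob F (Y, \<sigma>)) (frel F (X, \<rho>) (Y, \<sigma>) \<alpha>)
      (reix S (fob F (X, \<rho>)) (fob F (Y, \<sigma>)) (fob G (X, \<rho>)) (fob G (Y, \<sigma>)) (ext X \<rho>) (ext Y \<sigma>)
        (frel G (X, \<rho>) (Y, \<sigma>) \<alpha>))"
    if X: "X \<in> ob (base R)" "equiv_rel R X \<rho>" and Y: "Y \<in> ob (base R)" "equiv_rel R Y \<sigma>"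
      and \<alpha>: "\<alpha> \<in> fibre (Q R) (X, \<rho>) (Y, \<sigma>)" for X \<rho> Y \<sigma> \<alpha>
  proof -
    have ob: "(X, \<rho>) \<in> ob (base (Q R))" "(Y, \<sigma>) \<in> ob (base (Q R))" using X Y by simp_all
    note [simp] = F.cover(1-3)[OF X] G.cover(1-3)[OF X] F.cover(1-3)[OF Y] G.cover(1-3)[OF Y]
      \<theta>_hom[OF X(1)] \<theta>_hom[OF Y(1)] ext_hom[OF X] ext_hom[OF Y]
      F.frel_fibre[OF ob \<alpha>] G.frel_fibre[OF ob \<alpha>] F.descent_cover[OF X] F.descent_cover[OF Y]
    let ?F = "frel F (X, \<rho>) (Y, \<sigma>) \<alpha>" and ?G = "frel G (X, \<rho>) (Y, \<sigma>) \<alpha>"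
    have "reix S (F.fob0 X) (F.fob0 Y) (fob F (X, \<rho>)) (fob F (Y, \<sigma>)) (F.cover X \<rho>) (F.cover Y \<sigma>)
        (reix S (fob F (X, \<rho>)) (fob F (Y, \<sigma>)) (fob G (X, \<rho>)) (fob G (Y, \<sigma>)) (ext X \<rho>) (ext Y \<sigma>) ?G) =
      reix S (F.fob0 X) (F.fob0 Y) (fob G (X, \<rho>)) (fob G (Y, \<sigma>))
        (?C (F.fob0 X) (fob F (X, \<rho>)) (fob G (X, \<rho>)) (ext X \<rho>) (F.cover X \<rho>))
        (?C (F.fob0 Y) (fob F (Y, \<sigma>)) (fob G (Y, \<sigma>)) (ext Y \<sigma>) (F.cover Y \<sigma>)) ?G"
      by (simp add: F.S.reix_cmp)
    also have "\<dots> = reix S (F.fob0 X) (F.fob0 Y) (G.fob0 X) (G.fob0 Y) (\<theta> X) (\<theta> Y)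
        (reix S (G.fob0 X) (G.fob0 Y) (fob G (X, \<rho>)) (fob G (Y, \<sigma>)) (G.cover X \<rho>) (G.cover Y \<sigma>) ?G)"
      by (simp add: ext_cover[OF X] ext_cover[OF Y] F.S.reix_cmp)
    also have "\<dots> = reix S (F.fob0 X) (F.fob0 Y) (G.fob0 X) (G.fob0 Y) (\<theta> X) (\<theta> Y)
        (frel G (X, rid R X) (Y, rid R Y) \<alpha>)"
      by (simp only: G.frel_cover[OF X Y \<alpha>])
    finally have "le S (F.fob0 X) (F.fob0 Y)
      (reix S (F.fob0 X) (F.fob0 Y) (fob F (X, \<rho>)) (fob F (Y, \<sigma>)) (F.cover X \<rho>) (F.cover Y \<sigma>) ?F)
      (reix S (F.fob0 X) (F.fob0 Y) (fob F (X, \<rho>)) (fob F (Y, \<sigma>)) (F.cover X \<rho>) (F.cover Y \<sigma>)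
        (reix S (fob F (X, \<rho>)) (fob F (Y, \<sigma>)) (fob G (X, \<rho>)) (fob G (Y, \<sigma>)) (ext X \<rho>) (ext Y \<sigma>) ?G))"
      using \<theta>_le[OF X(1) Y(1) F.R0.fibre_QD[OF \<alpha>]] by (simp only: F.frel_cover[OF X Y \<alpha>])
    then show ?thesis
      by (rule F.S.reix_descent_le[rotated -1]) simp_all
  qed
  have "two_arrow (Q R) S F G \<theta>'"
    by (rule two_arrowI, unfold split_paired_all)
      (simp_all add: \<theta>'_sel ext_hom natural ineq, simp add: \<theta>'_def)
  moreover have "\<theta>' (X, rid R X) = \<theta> X" if X: "X \<in> ob (base R)" for X
  proof -
    have d: "equiv_rel R X (rid R X)" by (rule F.R0.equiv_rel_rid[OF X])
    show ?thesis
      using ext_cover[OF X d] ext_hom[OF X d] F.cover(1)[OF X d] G.cover(1)[OF X d] \<theta>_hom[OF X]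
      by (simp add: \<theta>'_sel[OF X d] F.cover_rid[OF X] G.cover_rid[OF X])
  qed
  ultimately show ?thesis by (rule that)
qed

section \<open>The universal property\<close>

lemma two_arrow_whisker_E:
  assumes "rel_doctrine R" "rel_doctrine S" "lax_arrow (Q R) S F" "lax_arrow (Q R) S G"
    and \<theta>: "two_arrow (Q R) S F G \<theta>"
  shows "two_arrow R S (comp_one R F (E R)) (comp_one R G (E R)) (\<lambda>X\<in>ob (base R). \<theta> (X, rid R X))"
proof -
  interpret R: rel_doctrine R by fact
  have ob: "(X, rid R X) \<in> ob (base (Q R))" if "X \<in> ob (base R)" for X
    using that by (simp add: R.equiv_rel_rid)
  have hom: "f \<in> hom (base (Q R)) (X, rid R X) (Y, rid R Y)"
    if "X \<in> ob (base R)" "Y \<in> ob (base R)" "f \<in> hom (base R) X Y" for X Y f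
    using that by (simp add: R.rid_reix)
  show ?thesis
    by (rule two_arrowI)
      (simp_all add: two_arrow_hom[OF \<theta> ob] two_arrow_natural[OF \<theta> ob ob hom]
        two_arrow_le[OF \<theta> ob ob] R.fibre_Q_rid del: Q_simps)
qed

lemma precomp_E_equivalence:
  assumes R: "rel_doctrine R" and S: "rel_doctrine S" and quotients: "has_quotients S"
  shows "is_equivalence (QRD_hom (Q R) S) (RD_hom R S) (precomp_E R S (QRD_hom (Q R) S))"
proof -
  interpret R: rel_doctrine R by fact
  let ?K = "QRD_hom (Q R) S" and ?L = "RD_hom R S"
  interpret K: category ?K by (rule category_QRD_hom[OF R.rel_doctrine_Q S])
  define P where "P = precomp_E R S ?K"
  have P_ob: "fob P F = comp_one R F (E R)" if "F \<in> ob ?K" for F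
    using that by (simp add: P_def precomp_E_def)
  have P_hom: "far P F G \<theta> = (\<lambda>X\<in>ob (base R). \<theta> (X, rid R X))"
    if "F \<in> ob ?K" "G \<in> ob ?K" "\<theta> \<in> hom ?K F G" for F G \<theta>
    using that by (simp add: P_def precomp_E_def hcomp_E[OF R S])
  have P_ob': "comp_one R F (E R) \<in> ob ?L" if "F \<in> ob ?K" for F
    using that strict_arrow_comp_one[OF R.strict_arrow_E _ _ R R.rel_doctrine_Q S, of F] by simp
  have P_hom': "(\<lambda>X\<in>ob (base R). \<theta> (X, rid R X)) \<in> hom ?L (comp_one R F (E R)) (comp_one R G (E R))"
    if "F \<in> ob ?K" "G \<in> ob ?K" "\<theta> \<in> hom ?K F G" for F G \<theta>
    using that two_arrow_whisker_E[OF R S, of F G \<theta>] by simp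
  have preserving: "quotient_preserving_from_Q R S F" if "F \<in> ob ?K" for F
    using that R S R.rel_doctrine_Q
    by (simp add: quotient_preserving_from_Q_def quotient_preserving_from_Q_axioms_def strict_one_arrowI)
  have d: "(X, rid R X) \<in> ob (base (Q R))" if "X \<in> ob (base R)" for X
    using that by (simp add: R.equiv_rel_rid)
  have functor_P: "is_functor ?K ?L P"
  proof (rule is_functorI)
    fix F assume F: "F \<in> ob ?K"
    show "fob P F \<in> ob ?L" using P_ob'[OF F] by (simp only: P_ob[OF F])
    have "(\<lambda>X\<in>ob (base R). id_two (Q R) S F (X, rid R X)) = id_two R S (comp_one R F (E R))"
      unfolding id_two_def by (rule restrict_ext) (simp add: R.equiv_rel_rid)
    then show "far P F F (ide ?K F) = ide ?L (fob P F)"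
      using P_hom[OF F F K.ide_hom[OF F]] P_ob[OF F] by simp
  next
    fix F G \<theta> assume *: "F \<in> ob ?K" "G \<in> ob ?K" "\<theta> \<in> hom ?K F G"
    show "far P F G \<theta> \<in> hom ?L (fob P F) (fob P G)"
      using P_hom'[OF *] by (simp only: P_hom[OF *] P_ob[OF *(1)] P_ob[OF *(2)])
  next
    fix F G H \<theta> \<phi>
    assume *: "F \<in> ob ?K" "G \<in> ob ?K" "H \<in> ob ?K" "\<theta> \<in> hom ?K F G" "\<phi> \<in> hom ?K G H"
    have "(\<lambda>X\<in>ob (base R). vcomp (Q R) S F G H \<phi> \<theta> (X, rid R X)) =
      vcomp R S (comp_one R F (E R)) (comp_one R G (E R)) (comp_one R H (E R))
        (\<lambda>X\<in>ob (base R). \<phi> (X, rid R X)) (\<lambda>X\<in>ob (base R). \<theta> (X, rid R X))"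
      unfolding vcomp_def by (rule restrict_ext) (simp add: R.equiv_rel_rid)
    then show "far P F H (cmp ?K F G H \<phi> \<theta>) =
        cmp ?L (fob P F) (fob P G) (fob P H) (far P G H \<phi>) (far P F G \<theta>)"
      using P_hom[OF *(1,3) K.cmp_hom[OF *]]
      by (simp only: P_hom[OF *(1,2,4)] P_hom[OF *(2,3,5)]
          P_ob[OF *(1)] P_ob[OF *(2)] P_ob[OF *(3)] QRD_hom_simps RD_hom_simps)
  qed (auto simp: P_def precomp_E_def)
  have "is_equivalence ?K ?L P"
  proof (rule full_faithful_surj_is_equivalence[OF K.category_axioms category_RD_hom[OF R S] functor_P])
    fix F assume "F \<in> ob ?L"
    then interpret F: strict_into_quotients R S F
      using R S quotients
      by (simp add: strict_into_quotients_def strict_into_quotients_axioms_def strict_one_arrowI)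
    have ext: "F.extension \<in> ob ?K"
      using F.lax_arrow_extension F.strict_arrow_extension F.preserves_quotients_extension by simp
    show "\<exists>G\<in>ob ?K. fob P G = F"
      by (rule bexI[OF _ ext]) (simp only: P_ob[OF ext] F.extension_E)
  next
    fix F G assume F: "F \<in> ob ?K" and G: "G \<in> ob ?K"
    note FG = preserving[OF F] preserving[OF G]
    show "bij_betw (far P F G) (hom ?K F G) (hom ?L (fob P F) (fob P G))"
      unfolding bij_betw_def
    proof (intro conjI inj_onI equalityI subsetI)
      fix \<theta> \<theta>' assume *: "\<theta> \<in> hom ?K F G" "\<theta>' \<in> hom ?K F G" and "far P F G \<theta> = far P F G \<theta>'"
      then have eq: "(\<lambda>X\<in>ob (base R). \<theta> (X, rid R X)) = (\<lambda>X\<in>ob (base R). \<theta>' (X, rid R X))"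
        by (simp only: P_hom[OF F G])
      have "\<theta> (X, rid R X) = \<theta>' (X, rid R X)" if "X \<in> ob (base R)" for X
        using fun_cong[OF eq, of X] that by simp
      then show "\<theta> = \<theta>'" using * two_arrow_eq_on_unit[OF FG] by simp
    next
      fix \<theta> assume "\<theta> \<in> far P F G ` hom ?K F G"
      then obtain \<theta>' where \<theta>': "\<theta>' \<in> hom ?K F G" "\<theta> = far P F G \<theta>'" by blast
      show "\<theta> \<in> hom ?L (fob P F) (fob P G)"
        using P_hom'[OF F G \<theta>'(1)] by (simp only: \<theta>'(2) P_hom[OF F G \<theta>'(1)] P_ob[OF F] P_ob[OF G])
    next
      fix \<theta> assume "\<theta> \<in> hom ?L (fob P F) (fob P G)"
      then have \<theta>: "two_arrow R S (comp_one R F (E R)) (comp_one R G (E R)) \<theta>"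
        by (simp add: P_ob[OF F] P_ob[OF G])
      obtain \<theta>' where \<theta>': "two_arrow (Q R) S F G \<theta>'"
        "\<And>X. X \<in> ob (base R) \<Longrightarrow> \<theta>' (X, rid R X) = \<theta> X"
        using two_arrow_extends_from_unit[OF FG \<theta>] by blast
      have "(\<lambda>X\<in>ob (base R). \<theta>' (X, rid R X)) = \<theta>"
        using two_arrow_ext[OF \<theta>] by (intro extensionalityI[of _ "ob (base R)"]) (simp_all add: \<theta>'(2))
      then have "\<theta> = far P F G \<theta>'" using P_hom[OF F G, of \<theta>'] \<theta>'(1) by simp
      then show "\<theta> \<in> far P F G ` hom ?K F G" using \<theta>'(1) by auto
    qed
  qed
  then show ?thesis by (simp only: P_def)
qed

theorem theorem3p19:
  fixes R :: "('o, 'a, 'r) rdoc" and S :: "('p, 'b, 's) rdoc"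
    and R' :: "('o1, 'a1, 'r1) rdoc" and R'' :: "('o2, 'a2, 'r2) rdoc"
  assumes "rel_doctrine R" and "rel_doctrine R'" and "rel_doctrine R''"
    and "rel_doctrine S" and "has_quotients S"
  shows
    \<comment> \<open>\<open>Q\<close> restricts to a 2-functor from \<open>RD\<close> to \<open>QRD\<close>\<close>
    "(rel_doctrine (Q R) \<and> has_quotients (Q R) \<and>
      is_functor (RD_hom R R') (QRD_hom (Q R) (Q R')) (Q_hom R (RD_hom R R')) \<and>
      Q_one R (id_one R) = id_one (Q R) \<and>
      (\<forall>F \<in> ob (RD_hom R R'). \<forall>G \<in> ob (RD_hom R' R'').
        Q_one R (comp_one R G F) = comp_one (Q R) (Q_one R' G) (Q_one R F)) \<and>
      (\<forall>F \<in> ob (RD_hom R R'). \<forall>G \<in> ob (RD_hom R R').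
       \<forall>H \<in> ob (RD_hom R' R''). \<forall>K \<in> ob (RD_hom R' R'').
       \<forall>\<theta> \<in> hom (RD_hom R R') F G. \<forall>\<phi> \<in> hom (RD_hom R' R'') H K.
        Q_two R (hcomp R R'' H K F G \<phi> \<theta>) =
          hcomp (Q R) (Q R'') (Q_one R' H) (Q_one R' K) (Q_one R F) (Q_one R G)
            (Q_two R' \<phi>) (Q_two R \<theta>))) \<and>
    \<comment> \<open>\<open>E\<close> restricts to a 2-natural transformation from the identity of \<open>RD\<close> to \<open>Q\<close>\<close>
     (E R \<in> ob (RD_hom R (Q R)) \<and>
      (\<forall>F \<in> ob (RD_hom R R'). comp_one R (Q_one R F) (E R) = comp_one R (E R') F) \<and>
      (\<forall>F \<in> ob (RD_hom R R'). \<forall>G \<in> ob (RD_hom R R'). \<forall>\<theta> \<in> hom (RD_hom R R') F G.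
        hcomp R (Q R') (Q_one R F) (Q_one R G) (E R) (E R) (Q_two R \<theta>) (id_two R (Q R) (E R)) =
        hcomp R (Q R') (E R') (E R') F G (id_two R' (Q R') (E R')) \<theta>)) \<and>
    \<comment> \<open>the universal property\<close>
     is_equivalence (QRD_hom (Q R) S) (RD_hom R S) (precomp_E R S (QRD_hom (Q R) S))"
proof (intro conjI ballI)
  interpret R: rel_doctrine R by fact
  have strict: "strict_one_arrow R R' F" if "F \<in> ob (RD_hom R R')" for F
    using that assms by (simp add: strict_one_arrowI)
  have strict': "strict_one_arrow R' R'' F" if "F \<in> ob (RD_hom R' R'')" for F
    using that assms by (simp add: strict_one_arrowI)
  show "rel_doctrine (Q R)" by (rule R.rel_doctrine_Q)
  show "has_quotients (Q R)" by (rule R.has_quotients_Q)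
  show "is_functor (RD_hom R R') (QRD_hom (Q R) (Q R')) (Q_hom R (RD_hom R R'))"
    by (rule is_functor_Q_hom[OF assms(1,2)])
  show "Q_one R (id_one R) = id_one (Q R)" by (rule Q_one_id_one[OF assms(1)])
  show "Q_one R (comp_one R G F) = comp_one (Q R) (Q_one R' G) (Q_one R F)"
    if "F \<in> ob (RD_hom R R')" "G \<in> ob (RD_hom R' R'')" for F G
    by (rule Q_one_comp_one[OF strict[OF that(1)] strict'[OF that(2)]])
  show "Q_two R (hcomp R R'' H K F G \<phi> \<theta>) =
      hcomp (Q R) (Q R'') (Q_one R' H) (Q_one R' K) (Q_one R F) (Q_one R G) (Q_two R' \<phi>) (Q_two R \<theta>)"
    if "F \<in> ob (RD_hom R R')" "G \<in> ob (RD_hom R R')" "\<theta> \<in> hom (RD_hom R R') F G" for F G H K \<phi> \<theta>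
    using Q_two_hcomp[OF strict[OF that(1)] strict[OF that(2)]] that(3) by simp
  show "E R \<in> ob (RD_hom R (Q R))" using R.strict_arrow_E by simp
  show "comp_one R (Q_one R F) (E R) = comp_one R (E R') F" if "F \<in> ob (RD_hom R R')" for F
    by (rule Q_one_E[OF strict[OF that]])
  show "hcomp R (Q R') (Q_one R F) (Q_one R G) (E R) (E R) (Q_two R \<theta>) (id_two R (Q R) (E R)) =
      hcomp R (Q R') (E R') (E R') F G (id_two R' (Q R') (E R')) \<theta>"
    if "F \<in> ob (RD_hom R R')" "G \<in> ob (RD_hom R R')" "\<theta> \<in> hom (RD_hom R R') F G" for F G \<theta>
    using Q_two_E[OF strict[OF that(1)] strict[OF that(2)]] that(3) by simp
  show "is_equivalence (QRD_hom (Q R) S) (RD_hom R S) (precomp_E R S (QRD_hom (Q R) S))"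
    by (rule precomp_E_equivalence[OF assms(1,4,5)])
qed

end
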